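(* Let $\mathcal{L}$ be a 2-category, $\kappa$ an infinite regular cardinal such that $\mathcal{L}$ is $\kappa$-small, and $\mathscr{C}:\mathcal{L}\to\mathbf{Cat}$ a pseudofunctor such that each category $\mathscr{C}_p$ has $\kappa$-small limits and each functor $\mathscr{C}_\mu$ preserves them. Then there is a 2-functor $\widehat{\mathscr{C}}:\mathcal{L}[\mathcal{L}^\dagger]^{\mathsf{coop}}\to\mathbf{Cat}$, extending the 2-functor $\widehat{\mathscr{C}}:\mathcal{L}^{\mathsf{coop}}\to\mathbf{Cat}$, with $\widehat{\mathscr{C}}^{\mu^\dagger}=\widehat{\mathscr{C}}_\mu$ (the right adjoint of $\widehat{\mathscr{C}}^\mu$) for each morphism $\mu$ of $\mathcal{L}$. In particular, considering only the right adjoints $\widehat{\mathscr{C}}_\mu$, there is a pseudofunctor $\widehat{\mathscr{C}}:\mathcal{L}\to\mathbf{Cat}$.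
   Context: In a 2-category, $\circ$ denotes composition of morphisms and vertical composition of 2-cells; $\mu\triangleleft\beta:\mu\circ\nu\Rightarrow\mu\circ\nu'$ (for $\beta:\nu\Rightarrow\nu'$) and $\alpha\triangleright\nu:\mu\circ\nu\Rightarrow\mu'\circ\nu$ (for $\alpha:\mu\Rightarrow\mu'$) denote whiskering. $(-)^{\mathsf{coop}}$ reverses 1-cells and 2-cells. $\mathcal{L}[\mathcal{L}^\dagger]$ is the 2-category obtained from $\mathcal{L}$ by freely adjoining a right adjoint $\mu^\dagger$ to every morphism $\mu$. Coherence isomorphisms of pseudofunctors are suppressed. For $r\in\mathcal{L}$, an object $\Gamma$ of $\widehat{\mathscr{C}}_r$ consists of an object $\Gamma^\mu\in\mathscr{C}_p$ for each $\mu:p\to r$, and for each $\varrho:p\to q$, $\nu:q\to r$ and $\alpha:\mu\Rightarrow\nu\circ\varrho$ a morphism $\Gamma^\alpha:\Gamma^\nu\to\mathscr{C}_\varrho(\Gamma^\mu)$ in $\mathscr{C}_q$ (depending also on the decomposition $\nu\circ\varrho$), such that: $\Gamma^{1_\mu}=1$ for $1_\mu:\mu\Rightarrow\mu\circ1_p$; for $\alpha:\mu\Rightarrow\nu\circ\varrho$ and $\beta:\nu\Rightarrow\varpi\circ\sigma$, $\mathscr{C}_\sigma(\Gamma^\alpha)\circ\Gamma^\beta=\Gamma^{(\beta\triangleright\varrho)\circ\alpha}$; for $\alpha:\mu\Rightarrow\nu\circ\varrho$ and $\beta:\varrho\Rightarrow\sigma$, $\mathscr{C}_\beta(\Gamma^\mu)\circ\Gamma^\alpha=\Gamma^{(\nu\triangleleft\beta)\circ\alpha}$.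 A morphism $\theta:\Gamma\to\Delta$ consists of $\theta^\mu:\Gamma^\mu\to\Delta^\mu$ for each $\mu:p\to r$ with $\mathscr{C}_\varrho(\theta^\mu)\circ\Gamma^\alpha=\Delta^\alpha\circ\theta^\nu$ for each $\alpha:\mu\Rightarrow\nu\circ\varrho$. The 2-functor $\widehat{\mathscr{C}}:\mathcal{L}^{\mathsf{coop}}\to\mathbf{Cat}$ sends $p$ to $\widehat{\mathscr{C}}_p$, sends $\mu:p\to q$ to $\widehat{\mathscr{C}}^\mu:\widehat{\mathscr{C}}_q\to\widehat{\mathscr{C}}_p$ with $(\widehat{\mathscr{C}}^\mu\Gamma)^\nu=\Gamma^{\mu\circ\nu}$, and sends $\beta:\mu\Rightarrow\mu'$ to $\widehat{\mathscr{C}}^\beta:\widehat{\mathscr{C}}^{\mu'}\to\widehat{\mathscr{C}}^{\mu}$ with $(\widehat{\mathscr{C}}^\beta\Gamma)^\varrho=\Gamma^{\beta\triangleright\varrho}$. Each $\widehat{\mathscr{C}}^\mu$ has a right adjoint, denoted $\widehat{\mathscr{C}}_\mu:\widehat{\mathscr{C}}_p\to\widehat{\mathscr{C}}_q$. The resulting pseudofunctor is called the co-dextrification of $\mathscr{C}$. *)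

theory Defs
  imports Main "HOL-Library.FuncSet"
begin

unbundle cardinal_syntax

section \<open>Categories, functors, natural transformations\<close>

text \<open>
  Composition is written in the usual (right-to-left) order throughout, for arrows of a category as
  well as for 1-cells and 2-cells of a 2-category.  The operations are only meaningful on
  composable arguments from the carriers.
\<close>

record ('o, 'm) cat =
  Obj :: "'o set"
  Arr :: "'m set"
  Dom :: "'m \<Rightarrow> 'o"
  Cod :: "'m \<Rightarrow> 'o"
  Idn :: "'o \<Rightarrow> 'm"
  Cmp :: "'m \<Rightarrow> 'm \<Rightarrow> 'm"  (infixr \<open>\<cdot>\<index>\<close> 70)

definition hom :: "('o, 'm) cat \<Rightarrow> 'o \<Rightarrow> 'o \<Rightarrow> 'm set" where
  "hom C x y = {f \<in> Arr C. Dom C f = x \<and> Cod C f = y}"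

locale category =
  fixes C :: "('o, 'm) cat" (structure)
  assumes Dom_closed: "f \<in> Arr C \<Longrightarrow> Dom C f \<in> Obj C"
    and Cod_closed: "f \<in> Arr C \<Longrightarrow> Cod C f \<in> Obj C"
    and Idn_hom: "x \<in> Obj C \<Longrightarrow> Idn C x \<in> hom C x x"
    and Cmp_hom: "\<lbrakk>f \<in> hom C x y; g \<in> hom C y z\<rbrakk> \<Longrightarrow> g \<cdot> f \<in> hom C x z"
    and Cmp_Idn_left: "f \<in> hom C x y \<Longrightarrow> Idn C y \<cdot> f = f"
    and Cmp_Idn_right: "f \<in> hom C x y \<Longrightarrow> f \<cdot> Idn C x = f"
    and Cmp_assoc:
      "\<lbrakk>f \<in> hom C w x; g \<in> hom C x y; h \<in> hom C y z\<rbrakk> \<Longrightarrow> (h \<cdot> g) \<cdot> f = h \<cdot> (g \<cdot> f)"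

definition inverse_arr :: "('o, 'm) cat \<Rightarrow> 'm \<Rightarrow> 'm" where
  "inverse_arr C f =
    (THE g. g \<in> hom C (Cod C f) (Dom C f) \<and>
            g \<cdot>\<^bsub>C\<^esub> f = Idn C (Dom C f) \<and> f \<cdot>\<^bsub>C\<^esub> g = Idn C (Cod C f))"

text \<open>
  Functors and natural transformations carry their boundary and are extensional
  (\<^term>\<open>undefined\<close> outside the carrier), so that HOL equality is equality of functors and
  of natural transformations; this matters because 2-functors into \<open>Cat\<close> preserve composition
  strictly.
\<close>

record ('o, 'm, 'p, 'n) functr =
  fdom :: "('o, 'm) cat"
  fcod :: "('p, 'n) cat"
  fobj :: "'o \<Rightarrow> 'p"
  farr :: "'m \<Rightarrow> 'n"

definition is_functor :: "('o, 'm, 'p, 'n) functr \<Rightarrow> bool" where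
  "is_functor F \<longleftrightarrow>
    category (fdom F) \<and> category (fcod F) \<and>
    fobj F \<in> Obj (fdom F) \<rightarrow>\<^sub>E Obj (fcod F) \<and>
    farr F \<in> extensional (Arr (fdom F)) \<and>
    (\<forall>f\<in>Arr (fdom F). farr F f \<in> hom (fcod F) (fobj F (Dom (fdom F) f)) (fobj F (Cod (fdom F) f))) \<and>
    (\<forall>x\<in>Obj (fdom F). farr F (Idn (fdom F) x) = Idn (fcod F) (fobj F x)) \<and>
    (\<forall>f\<in>Arr (fdom F). \<forall>g\<in>Arr (fdom F). Dom (fdom F) g = Cod (fdom F) f \<longrightarrow>
       farr F (g \<cdot>\<^bsub>fdom F\<^esub> f) = farr F g \<cdot>\<^bsub>fcod F\<^esub> farr F f)"

definition functor_id :: "('o, 'm) cat \<Rightarrow> ('o, 'm, 'o, 'm) functr" where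
  "functor_id C = \<lparr>fdom = C, fcod = C, fobj = (\<lambda>x\<in>Obj C. x), farr = (\<lambda>f\<in>Arr C. f)\<rparr>"

definition functor_comp ::
  "('p, 'n, 'q, 'l) functr \<Rightarrow> ('o, 'm, 'p, 'n) functr \<Rightarrow> ('o, 'm, 'q, 'l) functr" where
  "functor_comp G F =
    \<lparr>fdom = fdom F, fcod = fcod G,
     fobj = compose (Obj (fdom F)) (fobj G) (fobj F),
     farr = compose (Arr (fdom F)) (farr G) (farr F)\<rparr>"

record ('o, 'm, 'p, 'n) ntrans =
  ndom :: "('o, 'm, 'p, 'n) functr"
  ncod :: "('o, 'm, 'p, 'n) functr"
  ncmp :: "'o \<Rightarrow> 'n"

definition is_ntrans :: "('o, 'm, 'p, 'n) ntrans \<Rightarrow> bool" where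
  "is_ntrans t \<longleftrightarrow>
    is_functor (ndom t) \<and> is_functor (ncod t) \<and>
    fdom (ndom t) = fdom (ncod t) \<and> fcod (ndom t) = fcod (ncod t) \<and>
    ncmp t \<in> extensional (Obj (fdom (ndom t))) \<and>
    (\<forall>x\<in>Obj (fdom (ndom t)).
       ncmp t x \<in> hom (fcod (ndom t)) (fobj (ndom t) x) (fobj (ncod t) x)) \<and>
    (\<forall>f\<in>Arr (fdom (ndom t)).
       farr (ncod t) f \<cdot>\<^bsub>fcod (ndom t)\<^esub> ncmp t (Dom (fdom (ndom t)) f)
       = ncmp t (Cod (fdom (ndom t)) f) \<cdot>\<^bsub>fcod (ndom t)\<^esub> farr (ndom t) f)"

definition ntrans_id :: "('o, 'm, 'p, 'n) functr \<Rightarrow> ('o, 'm, 'p, 'n) ntrans" where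
  "ntrans_id F =
    \<lparr>ndom = F, ncod = F, ncmp = (\<lambda>x\<in>Obj (fdom F). Idn (fcod F) (fobj F x))\<rparr>"

definition ntrans_vcomp ::
  "('o, 'm, 'p, 'n) ntrans \<Rightarrow> ('o, 'm, 'p, 'n) ntrans \<Rightarrow> ('o, 'm, 'p, 'n) ntrans" where
  "ntrans_vcomp t s =
    \<lparr>ndom = ndom s, ncod = ncod t,
     ncmp = (\<lambda>x\<in>Obj (fdom (ndom s)). ncmp t x \<cdot>\<^bsub>fcod (ndom s)\<^esub> ncmp s x)\<rparr>"

definition ntrans_hcomp ::
  "('p, 'n, 'q, 'l) ntrans \<Rightarrow> ('o, 'm, 'p, 'n) ntrans \<Rightarrow> ('o, 'm, 'q, 'l) ntrans" where
  "ntrans_hcomp t s =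
    \<lparr>ndom = functor_comp (ndom t) (ndom s), ncod = functor_comp (ncod t) (ncod s),
     ncmp = (\<lambda>x\<in>Obj (fdom (ndom s)).
       ncmp t (fobj (ncod s) x) \<cdot>\<^bsub>fcod (ndom t)\<^esub> farr (ndom t) (ncmp s x))\<rparr>"


section \<open>Small limits\<close>

definition is_cone :: "('j, 'i, 'o, 'm) functr \<Rightarrow> 'o \<Rightarrow> ('j \<Rightarrow> 'm) \<Rightarrow> bool" where
  "is_cone D x l \<longleftrightarrow>
    x \<in> Obj (fcod D) \<and>
    (\<forall>j\<in>Obj (fdom D). l j \<in> hom (fcod D) x (fobj D j)) \<and>
    (\<forall>u\<in>Arr (fdom D). farr D u \<cdot>\<^bsub>fcod D\<^esub> l (Dom (fdom D) u) = l (Cod (fdom D) u))"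

definition is_limit :: "('j, 'i, 'o, 'm) functr \<Rightarrow> 'o \<Rightarrow> ('j \<Rightarrow> 'm) \<Rightarrow> bool" where
  "is_limit D x l \<longleftrightarrow>
    is_cone D x l \<and>
    (\<forall>y k. is_cone D y k \<longrightarrow>
      (\<exists>!h. h \<in> hom (fcod D) y x \<and> (\<forall>j\<in>Obj (fdom D). l j \<cdot>\<^bsub>fcod D\<^esub> h = k j)))"

text \<open>
  A diagram shape with fewer than \<open>k\<close> objects and arrows is isomorphic to one
  whose objects and arrows are elements of the field of \<open>k\<close>, so it is no restriction to take
  diagram shapes with objects and arrows from the type of that field.
\<close>

definition small_diagram :: "'k rel \<Rightarrow> ('k, 'k, 'o, 'm) functr \<Rightarrow> bool" where
  "small_diagram k D \<longleftrightarrow>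
    is_functor D \<and> |Obj (fdom D)| <o k \<and> |Arr (fdom D)| <o k"

definition has_small_limits :: "'k rel \<Rightarrow> ('o, 'm) cat \<Rightarrow> bool" where
  "has_small_limits k C \<longleftrightarrow>
    (\<forall>D :: ('k, 'k, 'o, 'm) functr. small_diagram k D \<and> fcod D = C \<longrightarrow> (\<exists>x l. is_limit D x l))"

definition preserves_small_limits :: "'k rel \<Rightarrow> ('o, 'm, 'p, 'n) functr \<Rightarrow> bool" where
  "preserves_small_limits k F \<longleftrightarrow>
    (\<forall>(D :: ('k, 'k, 'o, 'm) functr) x l. small_diagram k D \<and> fcod D = fdom F \<and> is_limit D x l \<longrightarrow>
       is_limit (functor_comp F D) (fobj F x) (\<lambda>j. farr F (l j)))"


section \<open>Strict 2-categories\<close>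

record ('o, 'a, 'c) two_cat =
  Cells0 :: "'o set"
  Cells1 :: "'a set"
  Cells2 :: "'c set"
  src :: "'a \<Rightarrow> 'o"
  trg :: "'a \<Rightarrow> 'o"
  vsrc :: "'c \<Rightarrow> 'a"
  vtrg :: "'c \<Rightarrow> 'a"
  id1 :: "'o \<Rightarrow> 'a"
  id2 :: "'a \<Rightarrow> 'c"
  comp1 :: "'a \<Rightarrow> 'a \<Rightarrow> 'a"  (infixr \<open>\<odot>\<index>\<close> 75)
  vcomp :: "'c \<Rightarrow> 'c \<Rightarrow> 'c"  (infixr \<open>\<bullet>\<index>\<close> 70)
  hcomp :: "'c \<Rightarrow> 'c \<Rightarrow> 'c"  (infixr \<open>\<star>\<index>\<close> 75)

definition hom1 :: "('o, 'a, 'c) two_cat \<Rightarrow> 'o \<Rightarrow> 'o \<Rightarrow> 'a set" where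
  "hom1 K p q = {f \<in> Cells1 K. src K f = p \<and> trg K f = q}"

definition hom2 :: "('o, 'a, 'c) two_cat \<Rightarrow> 'a \<Rightarrow> 'a \<Rightarrow> 'c set" where
  "hom2 K f g = {a \<in> Cells2 K. vsrc K a = f \<and> vtrg K a = g}"

locale two_category =
  fixes K :: "('o, 'a, 'c) two_cat" (structure)
  assumes src_closed: "f \<in> Cells1 K \<Longrightarrow> src K f \<in> Cells0 K"
    and trg_closed: "f \<in> Cells1 K \<Longrightarrow> trg K f \<in> Cells0 K"
    and id1_hom1: "p \<in> Cells0 K \<Longrightarrow> id1 K p \<in> hom1 K p p"
    and comp1_hom1: "\<lbrakk>f \<in> hom1 K p q; g \<in> hom1 K q r\<rbrakk> \<Longrightarrow> g \<odot> f \<in> hom1 K p r"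
    and comp1_id1_left: "f \<in> hom1 K p q \<Longrightarrow> id1 K q \<odot> f = f"
    and comp1_id1_right: "f \<in> hom1 K p q \<Longrightarrow> f \<odot> id1 K p = f"
    and comp1_assoc:
      "\<lbrakk>f \<in> hom1 K p q; g \<in> hom1 K q r; h \<in> hom1 K r s\<rbrakk> \<Longrightarrow> (h \<odot> g) \<odot> f = h \<odot> (g \<odot> f)"
    and vsrc_closed: "a \<in> Cells2 K \<Longrightarrow> vsrc K a \<in> Cells1 K"
    and vtrg_closed: "a \<in> Cells2 K \<Longrightarrow> vtrg K a \<in> Cells1 K"
    and src_vsrc: "a \<in> Cells2 K \<Longrightarrow> src K (vsrc K a) = src K (vtrg K a)"
    and trg_vsrc: "a \<in> Cells2 K \<Longrightarrow> trg K (vsrc K a) = trg K (vtrg K a)"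
    and id2_hom2: "f \<in> Cells1 K \<Longrightarrow> id2 K f \<in> hom2 K f f"
    and vcomp_hom2: "\<lbrakk>a \<in> hom2 K f g; b \<in> hom2 K g h\<rbrakk> \<Longrightarrow> b \<bullet> a \<in> hom2 K f h"
    and vcomp_id2_left: "a \<in> hom2 K f g \<Longrightarrow> id2 K g \<bullet> a = a"
    and vcomp_id2_right: "a \<in> hom2 K f g \<Longrightarrow> a \<bullet> id2 K f = a"
    and vcomp_assoc:
      "\<lbrakk>a \<in> hom2 K f g; b \<in> hom2 K g h; c \<in> hom2 K h k\<rbrakk> \<Longrightarrow> (c \<bullet> b) \<bullet> a = c \<bullet> (b \<bullet> a)"
    and hcomp_hom2:
      "\<lbrakk>f \<in> hom1 K p q; f' \<in> hom1 K p q; a \<in> hom2 K f f';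
        g \<in> hom1 K q r; g' \<in> hom1 K q r; b \<in> hom2 K g g'\<rbrakk>
       \<Longrightarrow> b \<star> a \<in> hom2 K (g \<odot> f) (g' \<odot> f')"
    and hcomp_id1_left: "\<lbrakk>a \<in> Cells2 K; trg K (vsrc K a) = q\<rbrakk> \<Longrightarrow> id2 K (id1 K q) \<star> a = a"
    and hcomp_id1_right: "\<lbrakk>a \<in> Cells2 K; src K (vsrc K a) = p\<rbrakk> \<Longrightarrow> a \<star> id2 K (id1 K p) = a"
    and hcomp_assoc:
      "\<lbrakk>a \<in> Cells2 K; b \<in> Cells2 K; c \<in> Cells2 K;
        src K (vsrc K b) = trg K (vsrc K a); src K (vsrc K c) = trg K (vsrc K b)\<rbrakk>
       \<Longrightarrow> (c \<star> b) \<star> a = c \<star> (b \<star> a)"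
    and hcomp_id2: "\<lbrakk>f \<in> hom1 K p q; g \<in> hom1 K q r\<rbrakk> \<Longrightarrow> id2 K g \<star> id2 K f = id2 K (g \<odot> f)"
    and interchange:
      "\<lbrakk>a \<in> hom2 K f f'; a' \<in> hom2 K f' f''; b \<in> hom2 K g g'; b' \<in> hom2 K g' g'';
        src K g = trg K f\<rbrakk>
       \<Longrightarrow> (b' \<bullet> b) \<star> (a' \<bullet> a) = (b' \<star> a') \<bullet> (b \<star> a)"

definition lwhisk :: "('o, 'a, 'c) two_cat \<Rightarrow> 'a \<Rightarrow> 'c \<Rightarrow> 'c"  (\<open>_ \<lhd>\<index> _\<close> [76, 75] 75) where
  "f \<lhd>\<^bsub>K\<^esub> a = id2 K f \<star>\<^bsub>K\<^esub> a"

definition rwhisk :: "('o, 'a, 'c) two_cat \<Rightarrow> 'c \<Rightarrow> 'a \<Rightarrow> 'c"  (\<open>_ \<rhd>\<index> _\<close> [76, 75] 75) where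
  "a \<rhd>\<^bsub>K\<^esub> f = a \<star>\<^bsub>K\<^esub> id2 K f"

definition coop :: "('o, 'a, 'c) two_cat \<Rightarrow> ('o, 'a, 'c) two_cat" where
  "coop K =
    \<lparr>Cells0 = Cells0 K, Cells1 = Cells1 K, Cells2 = Cells2 K,
     src = trg K, trg = src K, vsrc = vtrg K, vtrg = vsrc K,
     id1 = id1 K, id2 = id2 K,
     comp1 = (\<lambda>g f. f \<odot>\<^bsub>K\<^esub> g), vcomp = (\<lambda>b a. a \<bullet>\<^bsub>K\<^esub> b), hcomp = (\<lambda>b a. a \<star>\<^bsub>K\<^esub> b)\<rparr>"

definition small_two_cat :: "'k rel \<Rightarrow> ('o, 'a, 'c) two_cat \<Rightarrow> bool" where
  "small_two_cat k K \<longleftrightarrow> |Cells0 K| <o k \<and> |Cells1 K| <o k \<and> |Cells2 K| <o k"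

definition invertible2 :: "('o, 'a, 'c) two_cat \<Rightarrow> 'c \<Rightarrow> bool" where
  "invertible2 K a \<longleftrightarrow>
    a \<in> Cells2 K \<and>
    (\<exists>b \<in> hom2 K (vtrg K a) (vsrc K a).
       b \<bullet>\<^bsub>K\<^esub> a = id2 K (vsrc K a) \<and> a \<bullet>\<^bsub>K\<^esub> b = id2 K (vtrg K a))"

text \<open>\<open>adjunction K f g \<eta> \<epsilon>\<close>: the 1-cell \<open>f\<close> is left adjoint to \<open>g\<close>.\<close>

definition adjunction :: "('o, 'a, 'c) two_cat \<Rightarrow> 'a \<Rightarrow> 'a \<Rightarrow> 'c \<Rightarrow> 'c \<Rightarrow> bool" where
  "adjunction K f g \<eta> \<epsilon> \<longleftrightarrow>
    f \<in> Cells1 K \<and> g \<in> hom1 K (trg K f) (src K f) \<and>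
    \<eta> \<in> hom2 K (id1 K (src K f)) (g \<odot>\<^bsub>K\<^esub> f) \<and>
    \<epsilon> \<in> hom2 K (f \<odot>\<^bsub>K\<^esub> g) (id1 K (trg K f)) \<and>
    (\<epsilon> \<rhd>\<^bsub>K\<^esub> f) \<bullet>\<^bsub>K\<^esub> (f \<lhd>\<^bsub>K\<^esub> \<eta>) = id2 K f \<and>
    (g \<lhd>\<^bsub>K\<^esub> \<epsilon>) \<bullet>\<^bsub>K\<^esub> (\<eta> \<rhd>\<^bsub>K\<^esub> g) = id2 K g"

text \<open>
  For adjunctions \<open>f \<stileturn> g\<close> with unit \<open>\<eta>\<close> and \<open>f' \<stileturn> g'\<close> with counit \<open>\<epsilon>'\<close>, the mate of
  \<open>a : f \<Rightarrow> f'\<close> is a 2-cell \<open>g' \<Rightarrow> g\<close>.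
\<close>

definition mate :: "('o, 'a, 'c) two_cat \<Rightarrow> 'a \<Rightarrow> 'c \<Rightarrow> 'a \<Rightarrow> 'c \<Rightarrow> 'c \<Rightarrow> 'c" where
  "mate K g \<eta> g' \<epsilon>' a =
    (g \<lhd>\<^bsub>K\<^esub> \<epsilon>') \<bullet>\<^bsub>K\<^esub> (g \<lhd>\<^bsub>K\<^esub> (a \<rhd>\<^bsub>K\<^esub> g')) \<bullet>\<^bsub>K\<^esub> (\<eta> \<rhd>\<^bsub>K\<^esub> g')"

definition Cat :: "(('o, 'm) cat, ('o, 'm, 'o, 'm) functr, ('o, 'm, 'o, 'm) ntrans) two_cat" where
  "Cat =
    \<lparr>Cells0 = {C. category C}, Cells1 = {F. is_functor F}, Cells2 = {t. is_ntrans t},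
     src = fdom, trg = fcod, vsrc = ndom, vtrg = ncod,
     id1 = functor_id, id2 = ntrans_id,
     comp1 = functor_comp, vcomp = ntrans_vcomp, hcomp = ntrans_hcomp\<rparr>"


section \<open>2-functors and pseudofunctors\<close>

record ('o, 'a, 'c, 'p, 'b, 'd) two_map =
  act0 :: "'o \<Rightarrow> 'p"
  act1 :: "'a \<Rightarrow> 'b"
  act2 :: "'c \<Rightarrow> 'd"

locale two_functor = K: two_category K + M: two_category M
  for K :: "('o, 'a, 'c) two_cat" and M :: "('p, 'b, 'd) two_cat" +
  fixes F :: "('o, 'a, 'c, 'p, 'b, 'd) two_map"
  assumes act0_closed: "p \<in> Cells0 K \<Longrightarrow> act0 F p \<in> Cells0 M"
    and act1_hom1: "f \<in> hom1 K p q \<Longrightarrow> act1 F f \<in> hom1 M (act0 F p) (act0 F q)"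
    and act2_hom2: "a \<in> hom2 K f g \<Longrightarrow> act2 F a \<in> hom2 M (act1 F f) (act1 F g)"
    and act1_id1: "p \<in> Cells0 K \<Longrightarrow> act1 F (id1 K p) = id1 M (act0 F p)"
    and act1_comp1:
      "\<lbrakk>f \<in> hom1 K p q; g \<in> hom1 K q r\<rbrakk> \<Longrightarrow> act1 F (g \<odot>\<^bsub>K\<^esub> f) = act1 F g \<odot>\<^bsub>M\<^esub> act1 F f"
    and act2_id2: "f \<in> Cells1 K \<Longrightarrow> act2 F (id2 K f) = id2 M (act1 F f)"
    and act2_vcomp:
      "\<lbrakk>a \<in> hom2 K f g; b \<in> hom2 K g h\<rbrakk> \<Longrightarrow> act2 F (b \<bullet>\<^bsub>K\<^esub> a) = act2 F b \<bullet>\<^bsub>M\<^esub> act2 F a"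
    and act2_hcomp:
      "\<lbrakk>a \<in> Cells2 K; b \<in> Cells2 K; src K (vsrc K b) = trg K (vsrc K a)\<rbrakk>
       \<Longrightarrow> act2 F (b \<star>\<^bsub>K\<^esub> a) = act2 F b \<star>\<^bsub>M\<^esub> act2 F a"

text \<open>
  The coherence isomorphisms are
  \<open>pcomp F g f : F g \<odot> F f \<Rightarrow> F (g \<odot> f)\<close> and \<open>punit F p : 1 \<Rightarrow> F 1\<close>.
\<close>

record ('o, 'a, 'c, 'p, 'b, 'd) pseudo_map = "('o, 'a, 'c, 'p, 'b, 'd) two_map" +
  pcomp :: "'a \<Rightarrow> 'a \<Rightarrow> 'd"
  punit :: "'o \<Rightarrow> 'd"

locale pseudofunctor = K: two_category K + M: two_category M
  for K :: "('o, 'a, 'c) two_cat" and M :: "('p, 'b, 'd) two_cat" +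
  fixes F :: "('o, 'a, 'c, 'p, 'b, 'd) pseudo_map"
  assumes act0_closed: "p \<in> Cells0 K \<Longrightarrow> act0 F p \<in> Cells0 M"
    and act1_hom1: "f \<in> hom1 K p q \<Longrightarrow> act1 F f \<in> hom1 M (act0 F p) (act0 F q)"
    and act2_hom2: "a \<in> hom2 K f g \<Longrightarrow> act2 F a \<in> hom2 M (act1 F f) (act1 F g)"
    and act2_id2: "f \<in> Cells1 K \<Longrightarrow> act2 F (id2 K f) = id2 M (act1 F f)"
    and act2_vcomp:
      "\<lbrakk>a \<in> hom2 K f g; b \<in> hom2 K g h\<rbrakk> \<Longrightarrow> act2 F (b \<bullet>\<^bsub>K\<^esub> a) = act2 F b \<bullet>\<^bsub>M\<^esub> act2 F a"
    and pcomp_hom2: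
      "\<lbrakk>f \<in> hom1 K p q; g \<in> hom1 K q r\<rbrakk>
       \<Longrightarrow> pcomp F g f \<in> hom2 M (act1 F g \<odot>\<^bsub>M\<^esub> act1 F f) (act1 F (g \<odot>\<^bsub>K\<^esub> f))"
    and pcomp_invertible:
      "\<lbrakk>f \<in> hom1 K p q; g \<in> hom1 K q r\<rbrakk> \<Longrightarrow> invertible2 M (pcomp F g f)"
    and punit_hom2:
      "p \<in> Cells0 K \<Longrightarrow> punit F p \<in> hom2 M (id1 M (act0 F p)) (act1 F (id1 K p))"
    and punit_invertible: "p \<in> Cells0 K \<Longrightarrow> invertible2 M (punit F p)"
    and pcomp_natural:
      "\<lbrakk>a \<in> hom2 K f f'; b \<in> hom2 K g g'; src K g = trg K f\<rbrakk>
       \<Longrightarrow> act2 F (b \<star>\<^bsub>K\<^esub> a) \<bullet>\<^bsub>M\<^esub> pcomp F g f = pcomp F g' f' \<bullet>\<^bsub>M\<^esub> (act2 F b \<star>\<^bsub>M\<^esub> act2 F a)"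
    and pcomp_assoc:
      "\<lbrakk>f \<in> hom1 K p q; g \<in> hom1 K q r; h \<in> hom1 K r s\<rbrakk>
       \<Longrightarrow> pcomp F h (g \<odot>\<^bsub>K\<^esub> f) \<bullet>\<^bsub>M\<^esub> (act1 F h \<lhd>\<^bsub>M\<^esub> pcomp F g f)
         = pcomp F (h \<odot>\<^bsub>K\<^esub> g) f \<bullet>\<^bsub>M\<^esub> (pcomp F h g \<rhd>\<^bsub>M\<^esub> act1 F f)"
    and pcomp_punit_left:
      "f \<in> hom1 K p q \<Longrightarrow> pcomp F (id1 K q) f \<bullet>\<^bsub>M\<^esub> (punit F q \<rhd>\<^bsub>M\<^esub> act1 F f) = id2 M (act1 F f)"
    and pcomp_punit_right:
      "f \<in> hom1 K p q \<Longrightarrow> pcomp F f (id1 K p) \<bullet>\<^bsub>M\<^esub> (act1 F f \<lhd>\<^bsub>M\<^esub> punit F p) = id2 M (act1 F f)"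


section \<open>Freely adjoining right adjoints\<close>

text \<open>
  The 0-cells of \<open>adjoin L\<close> are those of \<open>L\<close>.  Its underlying 1-category is
  obtained from that of \<open>L\<close> by freely adjoining an arrow \<open>m\<^sup>\<dagger> : q \<rightarrow> p\<close> for every \<open>m : p \<rightarrow> q\<close>.
  Its arrows have the unique normal forms \<open>m\<^sub>0 \<odot> n\<^sub>1\<^sup>\<dagger> \<odot> m\<^sub>1 \<odot> \<dots> \<odot> n\<^sub>k\<^sup>\<dagger> \<odot> m\<^sub>k\<close> with all
  \<open>m\<^sub>i\<close> (possibly identities) and \<open>n\<^sub>i\<close> in \<open>L\<close>, which are what the datatype below
  represents: \<open>Zig m n w\<close> stands for \<open>m \<odot> n\<^sup>\<dagger> \<odot> w\<close>.
\<close>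

datatype 'a zigzag = Base 'a | Zig 'a 'a "'a zigzag"

primrec zsrc :: "('o, 'a, 'c) two_cat \<Rightarrow> 'a zigzag \<Rightarrow> 'o" where
  "zsrc L (Base m) = src L m"
| "zsrc L (Zig m n w) = zsrc L w"

primrec ztrg :: "('o, 'a, 'c) two_cat \<Rightarrow> 'a zigzag \<Rightarrow> 'o" where
  "ztrg L (Base m) = trg L m"
| "ztrg L (Zig m n w) = trg L m"

primrec zigzag_in :: "('o, 'a, 'c) two_cat \<Rightarrow> 'a zigzag \<Rightarrow> bool" where
  "zigzag_in L (Base m) \<longleftrightarrow> m \<in> Cells1 L"
| "zigzag_in L (Zig m n w) \<longleftrightarrow>
     m \<in> Cells1 L \<and> n \<in> Cells1 L \<and> src L m = src L n \<and> trg L n = ztrg L w \<and> zigzag_in L w"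

primrec zprefix :: "('o, 'a, 'c) two_cat \<Rightarrow> 'a \<Rightarrow> 'a zigzag \<Rightarrow> 'a zigzag" where
  "zprefix L m (Base m') = Base (m \<odot>\<^bsub>L\<^esub> m')"
| "zprefix L m (Zig m' n w) = Zig (m \<odot>\<^bsub>L\<^esub> m') n w"

primrec zcomp :: "('o, 'a, 'c) two_cat \<Rightarrow> 'a zigzag \<Rightarrow> 'a zigzag \<Rightarrow> 'a zigzag" where
  "zcomp L (Base m) v = zprefix L m v"
| "zcomp L (Zig m n w) v = Zig m n (zcomp L w v)"

definition dagger :: "('o, 'a, 'c) two_cat \<Rightarrow> 'a \<Rightarrow> 'a zigzag" where
  "dagger L m = Zig (id1 L (src L m)) m (Base (id1 L (trg L m)))"

text \<open>
  The 2-cells are formal composites of 2-cells of \<open>L\<close>, units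
  \<open>Unit m : 1 \<Rightarrow> m\<^sup>\<dagger> \<odot> m\<close> and counits \<open>Counit m : m \<odot> m\<^sup>\<dagger> \<Rightarrow> 1\<close>, modulo the least
  congruence that makes \<open>adjoin L\<close> a 2-category, the inclusion of \<open>L\<close> a 2-functor
  and the triangle identities hold.
\<close>

datatype ('a, 'c) cexpr =
    Emb 'c
  | Unit 'a
  | Counit 'a
  | Ident "'a zigzag"
  | VComp "('a, 'c) cexpr" "('a, 'c) cexpr"
  | HComp "('a, 'c) cexpr" "('a, 'c) cexpr"

primrec esrc :: "('o, 'a, 'c) two_cat \<Rightarrow> ('a, 'c) cexpr \<Rightarrow> 'a zigzag" where
  "esrc L (Emb a) = Base (vsrc L a)"
| "esrc L (Unit m) = Base (id1 L (src L m))"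
| "esrc L (Counit m) = zcomp L (Base m) (dagger L m)"
| "esrc L (Ident w) = w"
| "esrc L (VComp e d) = esrc L d"
| "esrc L (HComp e d) = zcomp L (esrc L e) (esrc L d)"

primrec etrg :: "('o, 'a, 'c) two_cat \<Rightarrow> ('a, 'c) cexpr \<Rightarrow> 'a zigzag" where
  "etrg L (Emb a) = Base (vtrg L a)"
| "etrg L (Unit m) = zcomp L (dagger L m) (Base m)"
| "etrg L (Counit m) = Base (id1 L (trg L m))"
| "etrg L (Ident w) = w"
| "etrg L (VComp e d) = etrg L e"
| "etrg L (HComp e d) = zcomp L (etrg L e) (etrg L d)"

primrec cexpr_in :: "('o, 'a, 'c) two_cat \<Rightarrow> ('a, 'c) cexpr \<Rightarrow> bool" where
  "cexpr_in L (Emb a) \<longleftrightarrow> a \<in> Cells2 L"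
| "cexpr_in L (Unit m) \<longleftrightarrow> m \<in> Cells1 L"
| "cexpr_in L (Counit m) \<longleftrightarrow> m \<in> Cells1 L"
| "cexpr_in L (Ident w) \<longleftrightarrow> zigzag_in L w"
| "cexpr_in L (VComp e d) \<longleftrightarrow> cexpr_in L e \<and> cexpr_in L d \<and> esrc L e = etrg L d"
| "cexpr_in L (HComp e d) \<longleftrightarrow>
     cexpr_in L e \<and> cexpr_in L d \<and> zsrc L (esrc L e) = ztrg L (esrc L d)"

inductive cexpr_eq :: "('o, 'a, 'c) two_cat \<Rightarrow> ('a, 'c) cexpr \<Rightarrow> ('a, 'c) cexpr \<Rightarrow> bool"
  for L where
  refl: "cexpr_in L e \<Longrightarrow> cexpr_eq L e e"
| sym: "cexpr_eq L e d \<Longrightarrow> cexpr_eq L d e"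
| trans: "\<lbrakk>cexpr_eq L e d; cexpr_eq L d c\<rbrakk> \<Longrightarrow> cexpr_eq L e c"
| VComp_cong:
    "\<lbrakk>cexpr_eq L e e'; cexpr_eq L d d'; cexpr_in L (VComp e d)\<rbrakk>
     \<Longrightarrow> cexpr_eq L (VComp e d) (VComp e' d')"
| HComp_cong:
    "\<lbrakk>cexpr_eq L e e'; cexpr_eq L d d'; cexpr_in L (HComp e d)\<rbrakk>
     \<Longrightarrow> cexpr_eq L (HComp e d) (HComp e' d')"
| VComp_assoc:
    "cexpr_in L (VComp (VComp e d) c) \<Longrightarrow> cexpr_eq L (VComp (VComp e d) c) (VComp e (VComp d c))"
| VComp_Ident_left: "cexpr_in L e \<Longrightarrow> cexpr_eq L (VComp (Ident (etrg L e)) e) e"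
| VComp_Ident_right: "cexpr_in L e \<Longrightarrow> cexpr_eq L (VComp e (Ident (esrc L e))) e"
| HComp_assoc:
    "cexpr_in L (HComp (HComp e d) c) \<Longrightarrow> cexpr_eq L (HComp (HComp e d) c) (HComp e (HComp d c))"
| HComp_Ident_left:
    "cexpr_in L e \<Longrightarrow> cexpr_eq L (HComp (Ident (Base (id1 L (ztrg L (esrc L e))))) e) e"
| HComp_Ident_right:
    "cexpr_in L e \<Longrightarrow> cexpr_eq L (HComp e (Ident (Base (id1 L (zsrc L (esrc L e)))))) e"
| HComp_Ident:
    "cexpr_in L (HComp (Ident w) (Ident v)) \<Longrightarrow>
     cexpr_eq L (HComp (Ident w) (Ident v)) (Ident (zcomp L w v))"
| interchange:
    "\<lbrakk>cexpr_in L (VComp e' e); cexpr_in L (VComp d' d); zsrc L (esrc L e) = ztrg L (esrc L d)\<rbrakk>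
     \<Longrightarrow> cexpr_eq L (HComp (VComp e' e) (VComp d' d)) (VComp (HComp e' d') (HComp e d))"
| Emb_id2: "m \<in> Cells1 L \<Longrightarrow> cexpr_eq L (Emb (id2 L m)) (Ident (Base m))"
| Emb_vcomp:
    "\<lbrakk>a \<in> Cells2 L; b \<in> Cells2 L; vsrc L b = vtrg L a\<rbrakk>
     \<Longrightarrow> cexpr_eq L (Emb (b \<bullet>\<^bsub>L\<^esub> a)) (VComp (Emb b) (Emb a))"
| Emb_hcomp:
    "\<lbrakk>a \<in> Cells2 L; b \<in> Cells2 L; src L (vsrc L b) = trg L (vsrc L a)\<rbrakk>
     \<Longrightarrow> cexpr_eq L (Emb (b \<star>\<^bsub>L\<^esub> a)) (HComp (Emb b) (Emb a))"
| triangle_left: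
    "m \<in> Cells1 L \<Longrightarrow>
     cexpr_eq L
       (VComp (HComp (Counit m) (Ident (Base m))) (HComp (Ident (Base m)) (Unit m)))
       (Ident (Base m))"
| triangle_right:
    "m \<in> Cells1 L \<Longrightarrow>
     cexpr_eq L
       (VComp (HComp (Ident (dagger L m)) (Counit m)) (HComp (Unit m) (Ident (dagger L m))))
       (Ident (dagger L m))"

definition cell_class :: "('o, 'a, 'c) two_cat \<Rightarrow> ('a, 'c) cexpr \<Rightarrow> ('a, 'c) cexpr set" where
  "cell_class L e = {d. cexpr_eq L e d}"

definition cell_rep :: "('a, 'c) cexpr set \<Rightarrow> ('a, 'c) cexpr" where
  "cell_rep X = (SOME e. e \<in> X)"

definition adjoin :: "('o, 'a, 'c) two_cat \<Rightarrow> ('o, 'a zigzag, ('a, 'c) cexpr set) two_cat" where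
  "adjoin L =
    \<lparr>Cells0 = Cells0 L,
     Cells1 = {w. zigzag_in L w},
     Cells2 = cell_class L ` {e. cexpr_in L e},
     src = zsrc L, trg = ztrg L,
     vsrc = (\<lambda>X. esrc L (cell_rep X)), vtrg = (\<lambda>X. etrg L (cell_rep X)),
     id1 = (\<lambda>p. Base (id1 L p)),
     id2 = (\<lambda>w. cell_class L (Ident w)),
     comp1 = zcomp L,
     vcomp = (\<lambda>Y X. cell_class L (VComp (cell_rep Y) (cell_rep X))),
     hcomp = (\<lambda>Y X. cell_class L (HComp (cell_rep Y) (cell_rep X)))\<rparr>"

definition adjoin_incl ::
  "('o, 'a, 'c) two_cat \<Rightarrow> ('o, 'a, 'c, 'o, 'a zigzag, ('a, 'c) cexpr set) two_map" where
  "adjoin_incl L = \<lparr>act0 = (\<lambda>p. p), act1 = Base, act2 = (\<lambda>a. cell_class L (Emb a))\<rparr>"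


section \<open>The co-dextrification\<close>

text \<open>
  An object \<open>G\<close> of the category at \<open>r\<close> has components \<open>hob G m\<close> for \<open>m : p \<rightarrow> r\<close> and
  \<open>hmor G (a, n, s)\<close> for \<open>a : m \<Rightarrow> n \<odot> s\<close>; the decomposition \<open>(n, s)\<close> of the target of
  \<open>a\<close> is part of the index.  All these families are extensional.
\<close>

type_synonym ('o, 'a, 'c, 'x, 'y) cat_valued =
  "('o, 'a, 'c, ('x, 'y) cat, ('x, 'y, 'x, 'y) functr, ('x, 'y, 'x, 'y) ntrans) pseudo_map"

record ('a, 'c, 'x, 'y) hat_obj =
  hob :: "'a \<Rightarrow> 'x"
  hmor :: "'c \<times> 'a \<times> 'a \<Rightarrow> 'y"

record ('a, 'c, 'x, 'y) hat_arr =
  hsrc :: "('a, 'c, 'x, 'y) hat_obj"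
  htrg :: "('a, 'c, 'x, 'y) hat_obj"
  hcmp :: "'a \<Rightarrow> 'y"

definition into :: "('o, 'a, 'c) two_cat \<Rightarrow> 'o \<Rightarrow> 'a set" where
  "into L r = {m \<in> Cells1 L. trg L m = r}"

definition decomps :: "('o, 'a, 'c) two_cat \<Rightarrow> 'o \<Rightarrow> ('c \<times> 'a \<times> 'a) set" where
  "decomps L r =
    {(a, n, s). a \<in> Cells2 L \<and> n \<in> into L r \<and> s \<in> into L (src L n) \<and> vtrg L a = n \<odot>\<^bsub>L\<^esub> s}"

definition is_hat_obj ::
  "('o, 'a, 'c) two_cat \<Rightarrow> ('o, 'a, 'c, 'x, 'y) cat_valued \<Rightarrow> 'o \<Rightarrow> ('a, 'c, 'x, 'y) hat_obj \<Rightarrow> bool"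
  where
  "is_hat_obj L C r G \<longleftrightarrow>
    hob G \<in> extensional (into L r) \<and> hmor G \<in> extensional (decomps L r) \<and>
    (\<forall>m\<in>into L r. hob G m \<in> Obj (act0 C (src L m))) \<and>
    (\<forall>(a, n, s)\<in>decomps L r.
       hmor G (a, n, s) \<in> hom (act0 C (src L n)) (hob G n) (fobj (act1 C s) (hob G (vsrc L a)))) \<and>
    (\<forall>m\<in>into L r.
       hmor G (id2 L m, m, id1 L (src L m)) = ncmp (punit C (src L m)) (hob G m)) \<and>
    (\<forall>(a, n, s)\<in>decomps L r. \<forall>(b, w, t)\<in>decomps L r. vsrc L b = n \<longrightarrow>
       ncmp (pcomp C t s) (hob G (vsrc L a)) \<cdot>\<^bsub>act0 C (src L w)\<^esub>
         farr (act1 C t) (hmor G (a, n, s)) \<cdot>\<^bsub>act0 C (src L w)\<^esub> hmor G (b, w, t)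
       = hmor G ((b \<rhd>\<^bsub>L\<^esub> s) \<bullet>\<^bsub>L\<^esub> a, w, t \<odot>\<^bsub>L\<^esub> s)) \<and>
    (\<forall>(a, n, s)\<in>decomps L r. \<forall>b\<in>Cells2 L. vsrc L b = s \<longrightarrow>
       ncmp (act2 C b) (hob G (vsrc L a)) \<cdot>\<^bsub>act0 C (src L n)\<^esub> hmor G (a, n, s)
       = hmor G ((n \<lhd>\<^bsub>L\<^esub> b) \<bullet>\<^bsub>L\<^esub> a, n, vtrg L b))"

definition is_hat_arr ::
  "('o, 'a, 'c) two_cat \<Rightarrow> ('o, 'a, 'c, 'x, 'y) cat_valued \<Rightarrow> 'o \<Rightarrow> ('a, 'c, 'x, 'y) hat_arr \<Rightarrow> bool"
  where
  "is_hat_arr L C r \<theta> \<longleftrightarrow>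
    is_hat_obj L C r (hsrc \<theta>) \<and> is_hat_obj L C r (htrg \<theta>) \<and>
    hcmp \<theta> \<in> extensional (into L r) \<and>
    (\<forall>m\<in>into L r. hcmp \<theta> m \<in> hom (act0 C (src L m)) (hob (hsrc \<theta>) m) (hob (htrg \<theta>) m)) \<and>
    (\<forall>(a, n, s)\<in>decomps L r.
       farr (act1 C s) (hcmp \<theta> (vsrc L a)) \<cdot>\<^bsub>act0 C (src L n)\<^esub> hmor (hsrc \<theta>) (a, n, s)
       = hmor (htrg \<theta>) (a, n, s) \<cdot>\<^bsub>act0 C (src L n)\<^esub> hcmp \<theta> n)"

definition hat_cat ::
  "('o, 'a, 'c) two_cat \<Rightarrow> ('o, 'a, 'c, 'x, 'y) cat_valued \<Rightarrow> 'o \<Rightarrow>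
   (('a, 'c, 'x, 'y) hat_obj, ('a, 'c, 'x, 'y) hat_arr) cat" where
  "hat_cat L C r =
    \<lparr>Obj = {G. is_hat_obj L C r G}, Arr = {\<theta>. is_hat_arr L C r \<theta>}, Dom = hsrc, Cod = htrg,
     Idn = (\<lambda>G. \<lparr>hsrc = G, htrg = G,
       hcmp = (\<lambda>m\<in>into L r. Idn (act0 C (src L m)) (hob G m))\<rparr>),
     Cmp = (\<lambda>\<theta> \<zeta>. \<lparr>hsrc = hsrc \<zeta>, htrg = htrg \<theta>,
       hcmp = (\<lambda>m\<in>into L r. hcmp \<theta> m \<cdot>\<^bsub>act0 C (src L m)\<^esub> hcmp \<zeta> m)\<rparr>)\<rparr>"

definition hat_fun ::
  "('o, 'a, 'c) two_cat \<Rightarrow> ('o, 'a, 'c, 'x, 'y) cat_valued \<Rightarrow> 'a \<Rightarrow>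
   (('a, 'c, 'x, 'y) hat_obj, ('a, 'c, 'x, 'y) hat_arr,
    ('a, 'c, 'x, 'y) hat_obj, ('a, 'c, 'x, 'y) hat_arr) functr" where
  "hat_fun L C m =
    (let ob = (\<lambda>G. \<lparr>hob = (\<lambda>n\<in>into L (src L m). hob G (m \<odot>\<^bsub>L\<^esub> n)),
                    hmor = (\<lambda>(a, n, s)\<in>decomps L (src L m). hmor G (m \<lhd>\<^bsub>L\<^esub> a, m \<odot>\<^bsub>L\<^esub> n, s))\<rparr>)
     in
    \<lparr>fdom = hat_cat L C (trg L m), fcod = hat_cat L C (src L m),
     fobj = (\<lambda>G\<in>Obj (hat_cat L C (trg L m)). ob G),
     farr = (\<lambda>\<theta>\<in>Arr (hat_cat L C (trg L m)).
       \<lparr>hsrc = ob (hsrc \<theta>), htrg = ob (htrg \<theta>),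
        hcmp = (\<lambda>n\<in>into L (src L m). hcmp \<theta> (m \<odot>\<^bsub>L\<^esub> n))\<rparr>)\<rparr>)"

text \<open>
  For \<open>b : m \<Rightarrow> m'\<close> and \<open>s : p \<rightarrow> src m\<close>, the 2-cell \<open>b \<rhd> s\<close> has target \<open>m' \<odot> s\<close>, read as
  \<open>(m' \<odot> s) \<odot> 1\<close>.  So \<open>hmor G\<close> at \<open>b \<rhd> s\<close> is an arrow from \<open>hob G (m' \<odot> s)\<close> to the
  value of \<open>C 1\<close> at \<open>hob G (m \<odot> s)\<close>, to be composed with the inverse of the unit
  isomorphism of the pseudofunctor \<open>C\<close>.
\<close>

definition hat_nat ::
  "('o, 'a, 'c) two_cat \<Rightarrow> ('o, 'a, 'c, 'x, 'y) cat_valued \<Rightarrow> 'c \<Rightarrow>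
   (('a, 'c, 'x, 'y) hat_obj, ('a, 'c, 'x, 'y) hat_arr,
    ('a, 'c, 'x, 'y) hat_obj, ('a, 'c, 'x, 'y) hat_arr) ntrans" where
  "hat_nat L C b =
    (let m = vsrc L b; m' = vtrg L b in
    \<lparr>ndom = hat_fun L C m', ncod = hat_fun L C m,
     ncmp = (\<lambda>G\<in>Obj (hat_cat L C (trg L m)).
       \<lparr>hsrc = fobj (hat_fun L C m') G, htrg = fobj (hat_fun L C m) G,
        hcmp = (\<lambda>s\<in>into L (src L m).
          inverse_arr (act0 C (src L s)) (ncmp (punit C (src L s)) (hob G (m \<odot>\<^bsub>L\<^esub> s)))
          \<cdot>\<^bsub>act0 C (src L s)\<^esub> hmor G (b \<rhd>\<^bsub>L\<^esub> s, m' \<odot>\<^bsub>L\<^esub> s, id1 L (src L s)))\<rparr>)\<rparr>)"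

definition hat ::
  "('o, 'a, 'c) two_cat \<Rightarrow> ('o, 'a, 'c, 'x, 'y) cat_valued \<Rightarrow>
   ('o, 'a, 'c,
    (('a, 'c, 'x, 'y) hat_obj, ('a, 'c, 'x, 'y) hat_arr) cat,
    (('a, 'c, 'x, 'y) hat_obj, ('a, 'c, 'x, 'y) hat_arr,
     ('a, 'c, 'x, 'y) hat_obj, ('a, 'c, 'x, 'y) hat_arr) functr,
    (('a, 'c, 'x, 'y) hat_obj, ('a, 'c, 'x, 'y) hat_arr,
     ('a, 'c, 'x, 'y) hat_obj, ('a, 'c, 'x, 'y) hat_arr) ntrans) two_map" where
  "hat L C = \<lparr>act0 = hat_cat L C, act1 = hat_fun L C, act2 = hat_nat L C\<rparr>"

text \<open>A choice of a right adjoint \<open>R m\<close>, with unit \<open>\<eta> m\<close> and counit \<open>\<epsilon> m\<close>, of each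
  \<open>act1 (hat L C) m\<close>.\<close>

definition right_adjoints where
  "right_adjoints L C R \<eta> \<epsilon> \<longleftrightarrow>
    (\<forall>m\<in>Cells1 L. adjunction Cat (act1 (hat L C) m) (R m) (\<eta> m) (\<epsilon> m))"

end

theory Submission
  imports Defs
begin

text \<open>
  Restriction along \<open>m\<close> has a right adjoint by the formula for right Kan extensions: its value at
  \<open>D\<close> and \<open>\<nu>\<close> is the limit of the objects \<open>C \<sigma> (D \<rho>)\<close> over all 2-cells \<open>\<alpha> : m \<odot> \<rho> \<Rightarrow> \<nu> \<odot> \<sigma>\<close>, which
  is small because \<open>L\<close> is, and the structure arrows \<open>R D \<nu> \<rightarrow> C \<phi> (R D \<mu>)\<close> exist because \<open>C \<phi>\<close>
  preserves this limit.  Everything else holds for an arbitrary 2-functor \<open>H\<close> on \<open>coop L\<close> with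
  chosen right adjoints \<open>R m\<close> of all \<open>H m\<close>: interpreting formal daggers, units and counits by
  \<open>R\<close> and the counits and units of the adjunctions respects the defining relations of \<open>adjoin L\<close>,
  and the coherence isomorphisms of \<open>R\<close> are mates of identities, so that every coherence law
  follows from the uniqueness of mates.
\<close>


section \<open>The 2-category of categories\<close>

text \<open>Restriction along \<open>m\<close> only reindexes families, and the coherence
  isomorphisms of \<open>C\<close> are part of the equations that define an object, so
  \<open>hat_fun\<close> composes strictly although \<open>C\<close> does not. They return in the
  construction of the adjoint: an arrow into \<open>C \<phi> (R D \<nu>)\<close> comes from a cone
  with legs in \<open>C \<phi> (C \<sigma> (D \<rho>))\<close>, whereas the legs at hand lie in
  \<open>C (\<phi> \<odot> \<sigma>) (D \<rho>)\<close>, so every such argument passes through a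
  comparison isomorphism. The constraints on the limit are those forced on the arrows that come from
  a morphism into \<open>D\<close>: transport along a structure arrow of \<open>D\<close>, and along
  a 2-cell out of \<open>\<sigma>\<close>. A cone has to respect these generating constraints only,
  so the limit is formed over a bare graph. A mate is recognised by one equation between the two
  counits. In this form mates paste vertically and horizontally, which is what makes both sides of a
  coherence law mates of the same 2-cell. Since \<open>coop\<close> reverses 1-cells and 2-cells, a
  formal unit \<open>1 \<Rightarrow> m\<^sup>\<dagger> \<odot> m\<close> has to be interpreted by a
  2-cell from the composite of \<open>H m\<close> and \<open>R m\<close> to an identity, that is by
  the counit \<open>\<epsilon> m\<close>.\<close>

lemma homI: "f \<in> Arr C \<Longrightarrow> Dom C f = x \<Longrightarrow> Cod C f = y \<Longrightarrow> f \<in> hom C x y"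
  by (simp add: hom_def)

lemma homD: assumes "f \<in> hom C x y" shows "f \<in> Arr C" "Dom C f = x" "Cod C f = y"
  using assms by (simp_all add: hom_def)

lemma hom_iff: "f \<in> hom C x y \<longleftrightarrow> f \<in> Arr C \<and> Dom C f = x \<and> Cod C f = y"
  by (simp add: hom_def)

context category
begin

lemma Idn_Arr: "x \<in> Obj C \<Longrightarrow> Idn C x \<in> Arr C"
  and Dom_Idn: "x \<in> Obj C \<Longrightarrow> Dom C (Idn C x) = x"
  and Cod_Idn: "x \<in> Obj C \<Longrightarrow> Cod C (Idn C x) = x"
  using Idn_hom by (auto dest: homD)

lemma
  assumes "f \<in> Arr C" "g \<in> Arr C" "Dom C g = Cod C f"
  shows Cmp_Arr: "g \<cdot> f \<in> Arr C" and Dom_Cmp: "Dom C (g \<cdot> f) = Dom C f"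
    and Cod_Cmp: "Cod C (g \<cdot> f) = Cod C g"
  using Cmp_hom[of f "Dom C f" "Cod C f" g "Cod C g"] assms by (auto simp: hom_def)

lemma Idn_Cmp: "\<lbrakk>f \<in> Arr C; Cod C f = y\<rbrakk> \<Longrightarrow> Idn C y \<cdot> f = f"
  by (rule Cmp_Idn_left[of f "Dom C f"]) (simp add: hom_def)

lemma Cmp_Idn: "\<lbrakk>f \<in> Arr C; Dom C f = x\<rbrakk> \<Longrightarrow> f \<cdot> Idn C x = f"
  by (rule Cmp_Idn_right[of f _ "Cod C f"]) (simp add: hom_def)

lemma Cmp_Cmp:
  "\<lbrakk>f \<in> Arr C; g \<in> Arr C; h \<in> Arr C; Dom C g = Cod C f; Dom C h = Cod C g\<rbrakk>
   \<Longrightarrow> (h \<cdot> g) \<cdot> f = h \<cdot> (g \<cdot> f)"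
  by (rule Cmp_assoc[of f "Dom C f" "Cod C f" g "Cod C g" h "Cod C h"]) (simp_all add: hom_def)

end

lemmas [simp] = category.Dom_closed category.Cod_closed category.Idn_Arr category.Dom_Idn
  category.Cod_Idn category.Cmp_Arr category.Dom_Cmp category.Cod_Cmp category.Idn_Cmp
  category.Cmp_Idn category.Cmp_Cmp

text \<open>
  Typing facts are kept in the form \<open>Arr\<close>, \<open>Dom\<close>, \<open>Cod\<close> rather than \<open>hom\<close>, with the
  ambient category a variable constrained by an equation, so that the simplifier can discharge
  composability conditions by itself.
\<close>

lemma
  assumes "is_functor F"
  shows functor_dom: "category (fdom F)" and functor_cod: "category (fcod F)"
    and fobj_closed: "fcod F = D \<Longrightarrow> x \<in> Obj (fdom F) \<Longrightarrow> fobj F x \<in> Obj D"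
    and farr_Arr: "fcod F = D \<Longrightarrow> f \<in> Arr (fdom F) \<Longrightarrow> farr F f \<in> Arr D"
    and Dom_farr: "fcod F = D \<Longrightarrow> f \<in> Arr (fdom F) \<Longrightarrow> Dom D (farr F f) = fobj F (Dom (fdom F) f)"
    and Cod_farr: "fcod F = D \<Longrightarrow> f \<in> Arr (fdom F) \<Longrightarrow> Cod D (farr F f) = fobj F (Cod (fdom F) f)"
    and farr_Idn: "fdom F = C \<Longrightarrow> x \<in> Obj C \<Longrightarrow> farr F (Idn C x) = Idn (fcod F) (fobj F x)"
    and farr_Cmp: "fdom F = C \<Longrightarrow> f \<in> Arr C \<Longrightarrow> g \<in> Arr C \<Longrightarrow> Dom C g = Cod C f \<Longrightarrow>
       farr F (g \<cdot>\<^bsub>C\<^esub> f) = farr F g \<cdot>\<^bsub>fcod F\<^esub> farr F f"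
    and fobj_ext: "fobj F \<in> extensional (Obj (fdom F))"
    and farr_ext: "farr F \<in> extensional (Arr (fdom F))"
  using assms by (auto simp: is_functor_def hom_def PiE_def)

lemmas [simp] = functor_dom functor_cod fobj_closed farr_Arr Dom_farr Cod_farr farr_Idn farr_Cmp

lemma is_functorI:
  assumes "category C" "category D" "fdom F = C" "fcod F = D"
    and "fobj F \<in> extensional (Obj C)" "farr F \<in> extensional (Arr C)"
    and "\<And>x. x \<in> Obj C \<Longrightarrow> fobj F x \<in> Obj D"
    and "\<And>f. f \<in> Arr C \<Longrightarrow> farr F f \<in> hom D (fobj F (Dom C f)) (fobj F (Cod C f))"
    and "\<And>x. x \<in> Obj C \<Longrightarrow> farr F (Idn C x) = Idn D (fobj F x)"
    and "\<And>f g. f \<in> Arr C \<Longrightarrow> g \<in> Arr C \<Longrightarrow> Dom C g = Cod C f \<Longrightarrow>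
      farr F (g \<cdot>\<^bsub>C\<^esub> f) = farr F g \<cdot>\<^bsub>D\<^esub> farr F f"
  shows "is_functor F"
  using assms unfolding is_functor_def PiE_def by auto

lemma functor_eqI:
  fixes F G :: "('o, 'm, 'p, 'n) functr"
  assumes "is_functor F" "is_functor G" "fdom F = fdom G" "fcod F = fcod G"
    and "\<And>x. x \<in> Obj (fdom G) \<Longrightarrow> fobj F x = fobj G x"
    and "\<And>f. f \<in> Arr (fdom G) \<Longrightarrow> farr F f = farr G f"
  shows "F = G"
proof (rule functr.equality)
  show "fobj F = fobj G"
    by (rule extensionalityI[where A = "Obj (fdom G)"])
      (use assms(3,5) fobj_ext[OF assms(1)] fobj_ext[OF assms(2)] in simp_all)
  show "farr F = farr G"
    by (rule extensionalityI[where A = "Arr (fdom G)"])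
      (use assms(3,6) farr_ext[OF assms(1)] farr_ext[OF assms(2)] in simp_all)
qed (use assms in auto)

lemma functor_id_simps [simp]:
  "fdom (functor_id C) = C" "fcod (functor_id C) = C"
  "x \<in> Obj C \<Longrightarrow> fobj (functor_id C) x = x" "f \<in> Arr C \<Longrightarrow> farr (functor_id C) f = f"
  by (simp_all add: functor_id_def)

lemma functor_id_functor [simp]: "category C \<Longrightarrow> is_functor (functor_id C)"
  by (rule is_functorI[of C C]) (auto simp: functor_id_def hom_def)

lemma functor_comp_simps [simp]:
  "fdom (functor_comp G F) = fdom F" "fcod (functor_comp G F) = fcod G"
  "x \<in> Obj (fdom F) \<Longrightarrow> fobj (functor_comp G F) x = fobj G (fobj F x)"
  "f \<in> Arr (fdom F) \<Longrightarrow> farr (functor_comp G F) f = farr G (farr F f)"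
  by (simp_all add: functor_comp_def compose_def)

lemma functor_comp_functor [simp]:
  assumes "is_functor F" "is_functor G" "fcod F = fdom G"
  shows "is_functor (functor_comp G F)"
  using assms
  by (intro is_functorI[of "fdom F" "fcod G"])
    (auto simp: functor_comp_def compose_def hom_def)

lemma functor_comp_id_left [simp]: "is_functor F \<Longrightarrow> fcod F = D \<Longrightarrow> functor_comp (functor_id D) F = F"
  by (rule functor_eqI) auto

lemma functor_comp_id_right [simp]: "is_functor F \<Longrightarrow> fdom F = C \<Longrightarrow> functor_comp F (functor_id C) = F"
  by (rule functor_eqI) auto

lemma functor_comp_assoc:
  "\<lbrakk>is_functor F; is_functor G; is_functor H; fcod F = fdom G; fcod G = fdom H\<rbrakk>
   \<Longrightarrow> functor_comp (functor_comp H G) F = functor_comp H (functor_comp G F)"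
  by (rule functor_eqI) auto

section \<open>Natural transformations and their two compositions\<close>

lemma
  assumes "is_ntrans t"
  shows ndom_functor: "is_functor (ndom t)" and ncod_functor: "is_functor (ncod t)"
    and ntrans_fdom: "fdom (ncod t) = fdom (ndom t)" and ntrans_fcod: "fcod (ncod t) = fcod (ndom t)"
    and ncmp_Arr: "fcod (ndom t) = D \<Longrightarrow> x \<in> Obj (fdom (ndom t)) \<Longrightarrow> ncmp t x \<in> Arr D"
    and Dom_ncmp: "fcod (ndom t) = D \<Longrightarrow> x \<in> Obj (fdom (ndom t)) \<Longrightarrow>
      Dom D (ncmp t x) = fobj (ndom t) x"
    and Cod_ncmp: "fcod (ndom t) = D \<Longrightarrow> x \<in> Obj (fdom (ndom t)) \<Longrightarrow>
      Cod D (ncmp t x) = fobj (ncod t) x"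
    and ncmp_ext: "ncmp t \<in> extensional (Obj (fdom (ndom t)))"
  using assms unfolding is_ntrans_def hom_def by auto

lemmas [simp] = ndom_functor ncod_functor ncmp_Arr Dom_ncmp Cod_ncmp

lemma ncmp_natural:
  assumes "is_ntrans t" "ndom t = F" "ncod t = G" "fdom F = C" "fcod F = D" "f \<in> Arr C"
    "Dom C f = x" "Cod C f = y"
  shows "farr G f \<cdot>\<^bsub>D\<^esub> ncmp t x = ncmp t y \<cdot>\<^bsub>D\<^esub> farr F f"
  using assms unfolding is_ntrans_def by auto

lemma is_ntransI:
  assumes "is_functor F" "is_functor G" "ndom t = F" "ncod t = G" "fdom F = C" "fdom G = C"
    "fcod F = D" "fcod G = D" "ncmp t \<in> extensional (Obj C)"
    and "\<And>x. x \<in> Obj C \<Longrightarrow> ncmp t x \<in> hom D (fobj F x) (fobj G x)"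
    and "\<And>f. f \<in> Arr C \<Longrightarrow>
      farr G f \<cdot>\<^bsub>D\<^esub> ncmp t (Dom C f) = ncmp t (Cod C f) \<cdot>\<^bsub>D\<^esub> farr F f"
  shows "is_ntrans t"
  using assms unfolding is_ntrans_def by auto

lemma ntrans_eqI:
  fixes s t :: "('o, 'm, 'p, 'n) ntrans"
  assumes "is_ntrans s" "is_ntrans t" "ndom s = ndom t" "ncod s = ncod t"
    and "\<And>x. x \<in> Obj (fdom (ndom t)) \<Longrightarrow> ncmp s x = ncmp t x"
  shows "s = t"
proof (rule ntrans.equality)
  show "ncmp s = ncmp t"
    by (rule extensionalityI[where A = "Obj (fdom (ndom t))"])
      (use assms(3,5) ncmp_ext[OF assms(1)] ncmp_ext[OF assms(2)] in simp_all)
qed (use assms in auto)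

lemma ntrans_id_simps [simp]:
  "ndom (ntrans_id F) = F" "ncod (ntrans_id F) = F"
  "x \<in> Obj (fdom F) \<Longrightarrow> ncmp (ntrans_id F) x = Idn (fcod F) (fobj F x)"
  by (simp_all add: ntrans_id_def)

lemma ntrans_id_ntrans [simp]: "is_functor F \<Longrightarrow> is_ntrans (ntrans_id F)"
  by (rule is_ntransI[of F F]) (auto simp: hom_def, auto simp: ntrans_id_def)

lemma ntrans_vcomp_simps [simp]:
  "ndom (ntrans_vcomp t s) = ndom s" "ncod (ntrans_vcomp t s) = ncod t"
  "x \<in> Obj (fdom (ndom s)) \<Longrightarrow> ncmp (ntrans_vcomp t s) x = ncmp t x \<cdot>\<^bsub>fcod (ndom s)\<^esub> ncmp s x"
  by (simp_all add: ntrans_vcomp_def)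

lemma ntrans_vcomp_ntrans [simp]:
  assumes s: "is_ntrans s" and t: "is_ntrans t" and st: "ncod s = ndom t"
  shows "is_ntrans (ntrans_vcomp t s)"
proof (rule is_ntransI[of "ndom s" "ncod t" _ "fdom (ndom s)" "fcod (ndom s)"])
  have [simp]: "fdom (ndom t) = fdom (ndom s)" "fcod (ndom t) = fcod (ndom s)"
    "fdom (ncod t) = fdom (ndom s)" "fcod (ncod t) = fcod (ndom s)"
    using s t ntrans_fdom[of s] ntrans_fcod[of s] ntrans_fdom[of t] ntrans_fcod[of t] st by simp_all
  note [simp] = s t st
  show "fdom (ncod t) = fdom (ndom s)" "fcod (ncod t) = fcod (ndom s)" by simp_all
  show "ncmp (ntrans_vcomp t s) x \<in> hom (fcod (ndom s)) (fobj (ndom s) x) (fobj (ncod t) x)"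
    if "x \<in> Obj (fdom (ndom s))" for x
    using that by (intro homI) (simp_all)
  show "farr (ncod t) f \<cdot>\<^bsub>fcod (ndom s)\<^esub> ncmp (ntrans_vcomp t s) (Dom (fdom (ndom s)) f) =
      ncmp (ntrans_vcomp t s) (Cod (fdom (ndom s)) f) \<cdot>\<^bsub>fcod (ndom s)\<^esub> farr (ndom s) f"
    (is "_ \<cdot>\<^bsub>?D\<^esub> _ = _")
    if f: "f \<in> Arr (fdom (ndom s))" for f
  proof -
    let ?x = "Dom (fdom (ndom s)) f" and ?y = "Cod (fdom (ndom s)) f"
    have [simp]: "category (fdom (ndom s))" "category (fcod (ndom s))" by simp_all
    have n: "farr (ncod t) f \<cdot>\<^bsub>?D\<^esub> ncmp t ?x = ncmp t ?y \<cdot>\<^bsub>?D\<^esub> farr (ndom t) f"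
      "farr (ndom t) f \<cdot>\<^bsub>?D\<^esub> ncmp s ?x = ncmp s ?y \<cdot>\<^bsub>?D\<^esub> farr (ndom s) f"
      using ncmp_natural[OF t HOL.refl HOL.refl _ _ f[folded \<open>fdom (ndom t) = fdom (ndom s)\<close>]]
        ncmp_natural[OF s HOL.refl st _ _ f] by simp_all
    have "farr (ncod t) f \<cdot>\<^bsub>?D\<^esub> ncmp t ?x \<cdot>\<^bsub>?D\<^esub> ncmp s ?x =
      (farr (ncod t) f \<cdot>\<^bsub>?D\<^esub> ncmp t ?x) \<cdot>\<^bsub>?D\<^esub> ncmp s ?x"
      using f by simp
    also have "\<dots> = ncmp t ?y \<cdot>\<^bsub>?D\<^esub> farr (ndom t) f \<cdot>\<^bsub>?D\<^esub> ncmp s ?x"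
      unfolding n(1) using f by simp
    also have "\<dots> = ncmp t ?y \<cdot>\<^bsub>?D\<^esub> ncmp s ?y \<cdot>\<^bsub>?D\<^esub> farr (ndom s) f"
      unfolding n(2) ..
    finally show ?thesis using f by simp
  qed
qed (use s t in \<open>simp_all add: ntrans_vcomp_def\<close>)

lemma ntrans_hcomp_simps [simp]:
  "ndom (ntrans_hcomp t s) = functor_comp (ndom t) (ndom s)"
  "ncod (ntrans_hcomp t s) = functor_comp (ncod t) (ncod s)"
  "x \<in> Obj (fdom (ndom s)) \<Longrightarrow> ncmp (ntrans_hcomp t s) x =
     ncmp t (fobj (ncod s) x) \<cdot>\<^bsub>fcod (ndom t)\<^esub> farr (ndom t) (ncmp s x)"
  by (simp_all add: ntrans_hcomp_def)

text \<open>The naturality square of the composite is pasted from the square of \<open>t\<close> at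
  an arrow in the image of \<open>ncod s\<close> and the image under \<open>ndom t\<close> of the
  square of \<open>s\<close>.\<close>

lemma ntrans_hcomp_ntrans [simp]:
  assumes s: "is_ntrans s" and t: "is_ntrans t" and st: "fcod (ndom s) = fdom (ndom t)"
  shows "is_ntrans (ntrans_hcomp t s)"
proof (rule is_ntransI[of "functor_comp (ndom t) (ndom s)" "functor_comp (ncod t) (ncod s)" _
      "fdom (ndom s)" "fcod (ndom t)"])
  have [simp]: "fcod (ncod t) = fcod (ndom t)" "fdom (ncod s) = fdom (ndom s)"
    "fdom (ncod t) = fdom (ndom t)" "fcod (ncod s) = fdom (ndom t)"
    using ntrans_fdom[OF s] ntrans_fcod[OF s] ntrans_fdom[OF t] ntrans_fcod[OF t] st by simp_all
  have cats: "category (fdom (ndom s))" "category (fcod (ndom t))" "category (fdom (ndom t))"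
    using functor_dom[OF ndom_functor] functor_cod[OF ndom_functor] s t by auto
  note [simp] = s t st cats
  show "is_functor (functor_comp (ndom t) (ndom s))" "is_functor (functor_comp (ncod t) (ncod s))"
    "fdom (functor_comp (ncod t) (ncod s)) = fdom (ndom s)"
    "fcod (functor_comp (ncod t) (ncod s)) = fcod (ndom t)" by simp_all
  show "ncmp (ntrans_hcomp t s) x \<in> hom (fcod (ndom t)) (fobj (functor_comp (ndom t) (ndom s)) x)
      (fobj (functor_comp (ncod t) (ncod s)) x)"
    if "x \<in> Obj (fdom (ndom s))" for x
    using that by (intro homI) simp_all
  show "farr (functor_comp (ncod t) (ncod s)) f \<cdot>\<^bsub>fcod (ndom t)\<^esub>
        ncmp (ntrans_hcomp t s) (Dom (fdom (ndom s)) f) =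
      ncmp (ntrans_hcomp t s) (Cod (fdom (ndom s)) f) \<cdot>\<^bsub>fcod (ndom t)\<^esub>
        farr (functor_comp (ndom t) (ndom s)) f"
    (is "_ \<cdot>\<^bsub>?D\<^esub> _ = _")
    if f: "f \<in> Arr (fdom (ndom s))" for f
  proof -
    let ?x = "Dom (fdom (ndom s)) f" and ?y = "Cod (fdom (ndom s)) f"
    let ?F = "ndom s" and ?F' = "ncod s" and ?G = "ndom t" and ?G' = "ncod t"
    have xy: "?x \<in> Obj (fdom (ndom s))" "?y \<in> Obj (fdom (ndom s))" using f cats by simp_all
    have n1: "farr ?G' (farr ?F' f) \<cdot>\<^bsub>?D\<^esub> ncmp t (fobj ?F' ?x) =
      ncmp t (fobj ?F' ?y) \<cdot>\<^bsub>?D\<^esub> farr ?G (farr ?F' f)"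
      by (rule ncmp_natural[where C = "fdom ?G"]) (use f xy in simp_all)
    have n2: "farr ?F' f \<cdot>\<^bsub>fdom ?G\<^esub> ncmp s ?x = ncmp s ?y \<cdot>\<^bsub>fdom ?G\<^esub> farr ?F f"
      by (rule ncmp_natural[where C = "fdom ?F"]) (use f xy in simp_all)
    have n3: "farr ?G (farr ?F' f) \<cdot>\<^bsub>?D\<^esub> farr ?G (ncmp s ?x) =
        farr ?G (ncmp s ?y) \<cdot>\<^bsub>?D\<^esub> farr ?G (farr ?F f)"
      using arg_cong[OF n2, of "farr ?G"] f xy by simp
    have "(farr ?G' (farr ?F' f) \<cdot>\<^bsub>?D\<^esub> ncmp t (fobj ?F' ?x)) \<cdot>\<^bsub>?D\<^esub> farr ?G (ncmp s ?x) =
       ncmp t (fobj ?F' ?y) \<cdot>\<^bsub>?D\<^esub> farr ?G (ncmp s ?y) \<cdot>\<^bsub>?D\<^esub> farr ?G (farr ?F f)"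
      unfolding n1 using f xy n3 by simp
    then show ?thesis using f xy by simp
  qed
qed (use s t st in \<open>simp_all add: ntrans_hcomp_def\<close>)

section \<open>The axioms of a 2-category for functors and natural transformations\<close>

lemma Cat_simps [simp]:
  "Cells0 Cat = {C. category C}" "Cells1 Cat = {F. is_functor F}" "Cells2 Cat = {t. is_ntrans t}"
  "src Cat = fdom" "trg Cat = fcod" "vsrc Cat = ndom" "vtrg Cat = ncod"
  "id1 Cat = functor_id" "id2 Cat = ntrans_id"
  "comp1 Cat = functor_comp" "vcomp Cat = ntrans_vcomp" "hcomp Cat = ntrans_hcomp"
  by (simp_all add: Cat_def)

lemma two_category_Cat: "two_category Cat"
proof
  fix a b c :: "('o, 'm, 'o, 'm) ntrans" and f g h k :: "('o, 'm, 'o, 'm) functr"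
  show "(c \<bullet>\<^bsub>Cat\<^esub> b) \<bullet>\<^bsub>Cat\<^esub> a = c \<bullet>\<^bsub>Cat\<^esub> (b \<bullet>\<^bsub>Cat\<^esub> a)"
    if "a \<in> hom2 Cat f g" "b \<in> hom2 Cat g h" "c \<in> hom2 Cat h k"
    using that ntrans_fdom[of a] ntrans_fcod[of a] ntrans_fdom[of b] ntrans_fcod[of b]
    by (intro ntrans_eqI) (auto simp: hom2_def)
next
  fix a b c :: "('o, 'm, 'o, 'm) ntrans"
  assume *: "a \<in> Cells2 Cat" "b \<in> Cells2 Cat" "c \<in> Cells2 Cat"
    "src Cat (vsrc Cat b) = trg Cat (vsrc Cat a)" "src Cat (vsrc Cat c) = trg Cat (vsrc Cat b)"
  then show "(c \<star>\<^bsub>Cat\<^esub> b) \<star>\<^bsub>Cat\<^esub> a = c \<star>\<^bsub>Cat\<^esub> (b \<star>\<^bsub>Cat\<^esub> a)"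
    using ntrans_fdom[of a] ntrans_fcod[of a] ntrans_fdom[of b] ntrans_fcod[of b]
      ntrans_fdom[of c] ntrans_fcod[of c]
    by (intro ntrans_eqI) (auto simp: functor_comp_assoc)
next
  fix a a' b b' :: "('o, 'm, 'o, 'm) ntrans" and f f' f'' g g' g'' :: "('o, 'm, 'o, 'm) functr"
  assume *: "a \<in> hom2 Cat f f'" "a' \<in> hom2 Cat f' f''" "b \<in> hom2 Cat g g'" "b' \<in> hom2 Cat g' g''"
    "src Cat g = trg Cat f"
  then have nt [simp]: "is_ntrans a" "is_ntrans a'" "is_ntrans b" "is_ntrans b'"
      "ndom a = f" "ncod a = f'" "ndom a' = f'" "ncod a' = f''"
      "ndom b = g" "ncod b = g'" "ndom b' = g'" "ncod b' = g''" "fdom g = fcod f"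
    by (auto simp: hom2_def)
  have [simp]: "fdom f' = fdom f" "fdom f'' = fdom f" "fcod f' = fcod f" "fcod f'' = fcod f"
      "fdom g' = fcod f" "fdom g'' = fcod f" "fcod g' = fcod g" "fcod g'' = fcod g"
    using ntrans_fdom[of a] ntrans_fcod[of a] ntrans_fdom[of b] ntrans_fcod[of b]
      ntrans_fdom[of a'] ntrans_fcod[of a'] ntrans_fdom[of b'] ntrans_fcod[of b'] by simp_all
  have fct [simp]: "is_functor f" "is_functor f'" "is_functor f''"
      "is_functor g" "is_functor g'" "is_functor g''"
    using ndom_functor[OF nt(1)] ncod_functor[OF nt(1)] ncod_functor[OF nt(2)]
      ndom_functor[OF nt(3)] ncod_functor[OF nt(3)] ncod_functor[OF nt(4)] by simp_all
  have cats [simp]: "category (fdom f)" "category (fcod f)" "category (fcod g)"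
    using functor_dom functor_cod fct by auto
  show "(b' \<bullet>\<^bsub>Cat\<^esub> b) \<star>\<^bsub>Cat\<^esub> (a' \<bullet>\<^bsub>Cat\<^esub> a) = (b' \<star>\<^bsub>Cat\<^esub> a') \<bullet>\<^bsub>Cat\<^esub> (b \<star>\<^bsub>Cat\<^esub> a)"
  proof (rule ntrans_eqI)
    fix x assume "x \<in> Obj (fdom (ndom ((b' \<star>\<^bsub>Cat\<^esub> a') \<bullet>\<^bsub>Cat\<^esub> (b \<star>\<^bsub>Cat\<^esub> a))))"
    then have x: "x \<in> Obj (fdom f)" by simp
    let ?D = "fcod g"
    \<comment> \<open>The two composites differ only in the order of \<open>b\<close> and
      \<open>a'\<close>, so interchange is the naturality of \<open>b\<close> at a component of
      \<open>a'\<close>.\<close>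
    have "ncmp b (fobj f'' x) \<cdot>\<^bsub>?D\<^esub> farr g (ncmp a' x) = farr g' (ncmp a' x) \<cdot>\<^bsub>?D\<^esub> ncmp b (fobj f' x)"
      by (rule ncmp_natural[where C = "fcod f", symmetric]) (use x in simp_all)
    then have "(ncmp b (fobj f'' x) \<cdot>\<^bsub>?D\<^esub> farr g (ncmp a' x)) \<cdot>\<^bsub>?D\<^esub> farr g (ncmp a x) =
      (farr g' (ncmp a' x) \<cdot>\<^bsub>?D\<^esub> ncmp b (fobj f' x)) \<cdot>\<^bsub>?D\<^esub> farr g (ncmp a x)" by simp
    then show "ncmp ((b' \<bullet>\<^bsub>Cat\<^esub> b) \<star>\<^bsub>Cat\<^esub> (a' \<bullet>\<^bsub>Cat\<^esub> a)) x =
        ncmp ((b' \<star>\<^bsub>Cat\<^esub> a') \<bullet>\<^bsub>Cat\<^esub> (b \<star>\<^bsub>Cat\<^esub> a)) x"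
      using x by simp
  qed simp_all
next
  fix f g :: "('o, 'm, 'o, 'm) functr" and p q r
  assume "f \<in> hom1 Cat p q" "g \<in> hom1 Cat q r"
  then show "id2 Cat g \<star>\<^bsub>Cat\<^esub> id2 Cat f = id2 Cat (g \<odot>\<^bsub>Cat\<^esub> f)"
    by (intro ntrans_eqI) (auto simp: hom1_def)
next
  fix a :: "('o, 'm, 'o, 'm) ntrans" and q :: "('o, 'm) cat"
  assume "a \<in> Cells2 Cat" "trg Cat (vsrc Cat a) = q"
  then show "id2 Cat (id1 Cat q) \<star>\<^bsub>Cat\<^esub> a = a"
    using ntrans_fdom[of a] ntrans_fcod[of a] functor_cod[of "ndom a"]
    by (intro ntrans_eqI) auto
next
  fix a :: "('o, 'm, 'o, 'm) ntrans" and p :: "('o, 'm) cat"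
  assume "a \<in> Cells2 Cat" "src Cat (vsrc Cat a) = p"
  then show "a \<star>\<^bsub>Cat\<^esub> id2 Cat (id1 Cat p) = a"
    using ntrans_fdom[of a] ntrans_fcod[of a] functor_dom[of "ndom a"]
      functor_dom[of "ncod a"]
    by (intro ntrans_eqI) auto
next
  fix a :: "('o, 'm, 'o, 'm) ntrans" and f g
  assume "a \<in> hom2 Cat f g"
  then show "id2 Cat g \<bullet>\<^bsub>Cat\<^esub> a = a" "a \<bullet>\<^bsub>Cat\<^esub> id2 Cat f = a"
    using ntrans_fdom[of a] ntrans_fcod[of a]
    by (auto intro!: ntrans_eqI simp: hom2_def)
qed (auto simp: hom1_def hom2_def ntrans_fdom ntrans_fcod functor_comp_assoc)


section \<open>Mates in a 2-category\<close>

lemma hom2_iff: "a \<in> hom2 K f g \<longleftrightarrow> a \<in> Cells2 K \<and> vsrc K a = f \<and> vtrg K a = g"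
  by (simp add: hom2_def)

lemma hom1_iff: "f \<in> hom1 K p q \<longleftrightarrow> f \<in> Cells1 K \<and> src K f = p \<and> trg K f = q"
  by (simp add: hom1_def)

context two_category
begin

lemma id1_simps [simp]:
  assumes "p \<in> Cells0 K"
  shows "id1 K p \<in> Cells1 K" "src K (id1 K p) = p" "trg K (id1 K p) = p"
  using id1_hom1[OF assms] by (auto simp: hom1_def)

lemmas [simp] = src_closed trg_closed vsrc_closed vtrg_closed src_vsrc[symmetric] trg_vsrc[symmetric]

lemma comp1_simps [simp]:
  assumes "f \<in> Cells1 K" "g \<in> Cells1 K" "src K g = trg K f"
  shows "g \<odot> f \<in> Cells1 K" "src K (g \<odot> f) = src K f" "trg K (g \<odot> f) = trg K g"
  using comp1_hom1[of f "src K f" "trg K f" g "trg K g"] assms by (auto simp: hom1_def)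

lemma id1_comp1 [simp]: "f \<in> Cells1 K \<Longrightarrow> trg K f = q \<Longrightarrow> id1 K q \<odot> f = f"
  by (rule comp1_id1_left[of f "src K f"]) (simp add: hom1_def)

lemma comp1_id1 [simp]: "f \<in> Cells1 K \<Longrightarrow> src K f = p \<Longrightarrow> f \<odot> id1 K p = f"
  by (rule comp1_id1_right[of f _ "trg K f"]) (simp add: hom1_def)

lemma comp1_comp1 [simp]:
  "\<lbrakk>f \<in> Cells1 K; g \<in> Cells1 K; h \<in> Cells1 K; src K g = trg K f; src K h = trg K g\<rbrakk>
   \<Longrightarrow> (h \<odot> g) \<odot> f = h \<odot> g \<odot> f"
  by (rule comp1_assoc[of f "src K f" "trg K f" g "trg K g" h "trg K h"]) (simp_all add: hom1_def)

lemma id2_simps [simp]: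
  assumes "f \<in> Cells1 K"
  shows "id2 K f \<in> Cells2 K" "vsrc K (id2 K f) = f" "vtrg K (id2 K f) = f"
  using id2_hom2[OF assms] by (auto simp: hom2_def)

lemma vcomp_simps [simp]:
  assumes "a \<in> Cells2 K" "b \<in> Cells2 K" "vsrc K b = vtrg K a"
  shows "b \<bullet> a \<in> Cells2 K" "vsrc K (b \<bullet> a) = vsrc K a" "vtrg K (b \<bullet> a) = vtrg K b"
  using vcomp_hom2[of a "vsrc K a" "vtrg K a" b "vtrg K b"] assms by (auto simp: hom2_def)

lemma id2_vcomp [simp]: "a \<in> Cells2 K \<Longrightarrow> vtrg K a = g \<Longrightarrow> id2 K g \<bullet> a = a"
  by (rule vcomp_id2_left[of a "vsrc K a"]) (simp add: hom2_def)

lemma vcomp_id2 [simp]: "a \<in> Cells2 K \<Longrightarrow> vsrc K a = f \<Longrightarrow> a \<bullet> id2 K f = a"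
  by (rule vcomp_id2_right[of a _ "vtrg K a"]) (simp add: hom2_def)

lemma vcomp_vcomp [simp]:
  "\<lbrakk>a \<in> Cells2 K; b \<in> Cells2 K; c \<in> Cells2 K; vsrc K b = vtrg K a; vsrc K c = vtrg K b\<rbrakk>
   \<Longrightarrow> (c \<bullet> b) \<bullet> a = c \<bullet> b \<bullet> a"
  by (rule vcomp_assoc[of a "vsrc K a" "vtrg K a" b "vtrg K b" c "vtrg K c"])
    (simp_all add: hom2_def)

lemma hcomp_simps [simp]:
  assumes "a \<in> Cells2 K" "b \<in> Cells2 K" "src K (vsrc K b) = trg K (vsrc K a)"
  shows "b \<star> a \<in> Cells2 K" "vsrc K (b \<star> a) = vsrc K b \<odot> vsrc K a"
    "vtrg K (b \<star> a) = vtrg K b \<odot> vtrg K a"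
  using hcomp_hom2[of "vsrc K a" "src K (vsrc K a)" "trg K (vsrc K a)" "vtrg K a" a
      "vsrc K b" "trg K (vsrc K b)" "vtrg K b" b] assms
  by (auto simp: hom2_def hom1_def)

lemmas hcomp_id1_simps [simp] = hcomp_id1_left hcomp_id1_right

lemma hcomp_hcomp [simp]:
  "\<lbrakk>a \<in> Cells2 K; b \<in> Cells2 K; c \<in> Cells2 K;
    src K (vsrc K b) = trg K (vsrc K a); src K (vsrc K c) = trg K (vsrc K b)\<rbrakk>
   \<Longrightarrow> (c \<star> b) \<star> a = c \<star> b \<star> a"
  by (rule hcomp_assoc)

lemma id2_hcomp_id2 [simp]:
  "\<lbrakk>f \<in> Cells1 K; g \<in> Cells1 K; src K g = trg K f\<rbrakk> \<Longrightarrow> id2 K g \<star> id2 K f = id2 K (g \<odot> f)"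
  by (rule hcomp_id2[of f "src K f" "trg K f" g "trg K g"]) (simp_all add: hom1_def)

lemma hcomp_vcomp:
  "\<lbrakk>a \<in> Cells2 K; a' \<in> Cells2 K; b \<in> Cells2 K; b' \<in> Cells2 K; vsrc K a' = vtrg K a;
    vsrc K b' = vtrg K b; src K (vsrc K b) = trg K (vsrc K a)\<rbrakk>
   \<Longrightarrow> (b' \<bullet> b) \<star> (a' \<bullet> a) = (b' \<star> a') \<bullet> (b \<star> a)"
  by (rule interchange[of a "vsrc K a" "vtrg K a" a' "vtrg K a'" b "vsrc K b" "vtrg K b" b' "vtrg K b'"])
    (simp_all add: hom2_def)

lemma lwhisk_simps [simp]:
  assumes "a \<in> Cells2 K" "f \<in> Cells1 K" "src K f = trg K (vsrc K a)"
  shows "f \<lhd> a \<in> Cells2 K" "vsrc K (f \<lhd> a) = f \<odot> vsrc K a" "vtrg K (f \<lhd> a) = f \<odot> vtrg K a"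
  using assms by (simp_all add: lwhisk_def)

lemma rwhisk_simps [simp]:
  assumes "a \<in> Cells2 K" "f \<in> Cells1 K" "src K (vsrc K a) = trg K f"
  shows "a \<rhd> f \<in> Cells2 K" "vsrc K (a \<rhd> f) = vsrc K a \<odot> f" "vtrg K (a \<rhd> f) = vtrg K a \<odot> f"
  using assms by (simp_all add: rwhisk_def)

lemma lwhisk_vcomp [simp]:
  "\<lbrakk>a \<in> Cells2 K; b \<in> Cells2 K; f \<in> Cells1 K; vsrc K b = vtrg K a; src K f = trg K (vsrc K a)\<rbrakk>
   \<Longrightarrow> f \<lhd> (b \<bullet> a) = (f \<lhd> b) \<bullet> (f \<lhd> a)"
  using hcomp_vcomp[of a b "id2 K f" "id2 K f"] by (simp add: lwhisk_def)

lemma rwhisk_vcomp [simp]: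
  "\<lbrakk>a \<in> Cells2 K; b \<in> Cells2 K; f \<in> Cells1 K; vsrc K b = vtrg K a; src K (vsrc K a) = trg K f\<rbrakk>
   \<Longrightarrow> (b \<bullet> a) \<rhd> f = (b \<rhd> f) \<bullet> (a \<rhd> f)"
  using hcomp_vcomp[of "id2 K f" "id2 K f" a b] by (simp add: rwhisk_def)

lemma lwhisk_lwhisk [simp]:
  assumes "a \<in> Cells2 K" "f \<in> Cells1 K" "g \<in> Cells1 K" "src K f = trg K (vsrc K a)" "src K g = trg K f"
  shows "g \<lhd> (f \<lhd> a) = (g \<odot> f) \<lhd> a"
  using hcomp_hcomp[of a "id2 K f" "id2 K g"] assms by (simp add: lwhisk_def)

lemma rwhisk_rwhisk [simp]:
  assumes "a \<in> Cells2 K" "f \<in> Cells1 K" "g \<in> Cells1 K" "src K (vsrc K a) = trg K f" "src K f = trg K g"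
  shows "(a \<rhd> f) \<rhd> g = a \<rhd> (f \<odot> g)"
  using assms by (simp add: rwhisk_def)

lemma lwhisk_rwhisk [simp]:
  assumes "a \<in> Cells2 K" "f \<in> Cells1 K" "g \<in> Cells1 K" "src K f = trg K (vsrc K a)"
    "src K (vsrc K a) = trg K g"
  shows "(f \<lhd> a) \<rhd> g = f \<lhd> (a \<rhd> g)"
  using assms by (simp add: lwhisk_def rwhisk_def)

lemma whisk_id1 [simp]:
  "a \<in> Cells2 K \<Longrightarrow> trg K (vsrc K a) = q \<Longrightarrow> id1 K q \<lhd> a = a"
  "a \<in> Cells2 K \<Longrightarrow> src K (vsrc K a) = p \<Longrightarrow> a \<rhd> id1 K p = a"
  by (simp_all add: lwhisk_def rwhisk_def)

lemma whisk_id2 [simp]: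
  assumes "f \<in> Cells1 K" "g \<in> Cells1 K" "src K g = trg K f"
  shows "g \<lhd> id2 K f = id2 K (g \<odot> f)" "id2 K g \<rhd> f = id2 K (g \<odot> f)"
  using assms by (simp_all add: lwhisk_def rwhisk_def)

text \<open>Interchange against identity 2-cells. Both equations together give the sliding rule
  \<open>(g' \<lhd> a) \<bullet> (b \<rhd> f) = (b \<rhd> f') \<bullet> (g \<lhd> a)\<close>, the
  step on which the calculations with units and counits rest.\<close>

lemma whisk_exchange:
  assumes "a \<in> Cells2 K" "b \<in> Cells2 K" "src K (vsrc K b) = trg K (vsrc K a)"
    and "vsrc K a = f" "vtrg K a = f'" "vsrc K b = g" "vtrg K b = g'"
  shows hcomp_eq_lr: "b \<star> a = (g' \<lhd> a) \<bullet> (b \<rhd> f)"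
    and hcomp_eq_rl: "b \<star> a = (b \<rhd> f') \<bullet> (g \<lhd> a)"
proof -
  note [simp] = assms(1,2,4-)
  have [simp]: "f \<in> Cells1 K" "f' \<in> Cells1 K" "g \<in> Cells1 K" "g' \<in> Cells1 K"
    using assms vsrc_closed vtrg_closed by metis+
  have [simp]: "src K g = trg K f" "src K g' = trg K f" "trg K f' = trg K f"
    using assms src_vsrc[of b] trg_vsrc[of a] by auto
  show "b \<star> a = (g' \<lhd> a) \<bullet> (b \<rhd> f)"
    using hcomp_vcomp[of "id2 K f" a b "id2 K g'"] by (simp add: lwhisk_def rwhisk_def)
  show "b \<star> a = (b \<rhd> f') \<bullet> (g \<lhd> a)"
    using hcomp_vcomp[of a "id2 K f'" "id2 K g" b] by (simp add: lwhisk_def rwhisk_def)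
qed

section \<open>Adjunctions and transposition of 2-cells\<close>

lemma adjunctionD:
  assumes "adjunction K f g \<eta> \<epsilon>"
  shows "f \<in> Cells1 K" "g \<in> Cells1 K" "src K g = trg K f" "trg K g = src K f"
    "\<eta> \<in> Cells2 K" "vsrc K \<eta> = id1 K (src K f)" "vtrg K \<eta> = g \<odot> f"
    "\<epsilon> \<in> Cells2 K" "vsrc K \<epsilon> = f \<odot> g" "vtrg K \<epsilon> = id1 K (trg K f)"
    "(\<epsilon> \<rhd> f) \<bullet> (f \<lhd> \<eta>) = id2 K f" "(g \<lhd> \<epsilon>) \<bullet> (\<eta> \<rhd> g) = id2 K g"
  using assms by (auto simp: adjunction_def hom1_def hom2_def)

lemma adjunctionI:
  assumes "f \<in> Cells1 K" "g \<in> Cells1 K" "src K g = trg K f" "trg K g = src K f"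
    "\<eta> \<in> Cells2 K" "vsrc K \<eta> = id1 K (src K f)" "vtrg K \<eta> = g \<odot> f"
    "\<epsilon> \<in> Cells2 K" "vsrc K \<epsilon> = f \<odot> g" "vtrg K \<epsilon> = id1 K (trg K f)"
    "(\<epsilon> \<rhd> f) \<bullet> (f \<lhd> \<eta>) = id2 K f" "(g \<lhd> \<epsilon>) \<bullet> (\<eta> \<rhd> g) = id2 K g"
  shows "adjunction K f g \<eta> \<epsilon>"
  using assms by (auto simp: adjunction_def hom1_def hom2_def)

lemma adjunction_id1:
  assumes "p \<in> Cells0 K"
  shows "adjunction K (id1 K p) (id1 K p) (id2 K (id1 K p)) (id2 K (id1 K p))"
  using assms by (intro adjunctionI) simp_all

text \<open>The transpose \<open>\<epsilon> \<bullet> (f \<lhd> b)\<close> determines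
  \<open>b\<close>: whiskering it by \<open>g\<close> and pasting on the unit gives \<open>b\<close>
  back, by the triangle identity for \<open>g\<close>.\<close>

lemma adjunction_unique:
  assumes adj: "adjunction K f g \<eta> \<epsilon>"
    and b: "b \<in> hom2 K g' g" and b': "b' \<in> hom2 K g' g"
    and eq: "\<epsilon> \<bullet> (f \<lhd> b) = \<epsilon> \<bullet> (f \<lhd> b')"
  shows "b = b'"
proof -
  note [simp] = adjunctionD(1-10)[OF adj]
  have recover: "b = (g \<lhd> (\<epsilon> \<bullet> (f \<lhd> b))) \<bullet> (\<eta> \<rhd> g')" if b: "b \<in> hom2 K g' g" for b
  proof -
    note [simp] = b[unfolded hom2_iff, THEN conjunct1] b[unfolded hom2_iff, THEN conjunct2, THEN conjunct1]
      b[unfolded hom2_iff, THEN conjunct2, THEN conjunct2]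
    have g' [simp]: "g' \<in> Cells1 K" "src K g' = src K g" "trg K g' = trg K g"
      using b vsrc_closed[of b] src_vsrc[of b] trg_vsrc[of b] by (auto simp: hom2_def)
    have "b = ((g \<lhd> \<epsilon>) \<bullet> (\<eta> \<rhd> g)) \<bullet> b" using adjunctionD(12)[OF adj] by simp
    also have "\<dots> = (g \<lhd> \<epsilon>) \<bullet> ((\<eta> \<rhd> g) \<bullet> (id1 K (src K f) \<lhd> b))" by simp
    \<comment> \<open>\<open>b\<close> is written as a whiskering by an identity 1-cell so that it
      can slide past the unit; \<open>whisk_id1\<close> would undo this.\<close>
    also have "(\<eta> \<rhd> g) \<bullet> (id1 K (src K f) \<lhd> b) = ((g \<odot> f) \<lhd> b) \<bullet> (\<eta> \<rhd> g')"
      using whisk_exchange[of b \<eta> g' g "id1 K (src K f)" "g \<odot> f"] by (simp del: whisk_id1)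
    finally show ?thesis by simp
  qed
  show ?thesis using recover[OF b] recover[OF b'] eq by simp
qed

text \<open>After expanding the mate, \<open>\<epsilon>\<close> slides past
  \<open>\<epsilon>'\<close> and \<open>a\<close> until it meets \<open>\<eta>\<close>, and the
  triangle identity for \<open>f\<close> removes both.\<close>

lemma mate_counit:
  assumes adj: "adjunction K f g \<eta> \<epsilon>" and adj': "adjunction K f' g' \<eta>' \<epsilon>'"
    and a: "a \<in> hom2 K f f'"
  shows "mate K g \<eta> g' \<epsilon>' a \<in> hom2 K g' g"
    and "\<epsilon> \<bullet> (f \<lhd> mate K g \<eta> g' \<epsilon>' a) = \<epsilon>' \<bullet> (a \<rhd> g')"
proof -
  note [simp] = adjunctionD(1-10)[OF adj] adjunctionD(1-10)[OF adj']
  have [simp]: "a \<in> Cells2 K" "vsrc K a = f" "vtrg K a = f'" "src K f' = src K f" "trg K f' = trg K f"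
    using a src_vsrc[of a] trg_vsrc[of a] by (auto simp: hom2_def)
  show "mate K g \<eta> g' \<epsilon>' a \<in> hom2 K g' g" by (simp add: mate_def hom2_def)
  have "\<epsilon> \<bullet> (f \<lhd> mate K g \<eta> g' \<epsilon>' a) =
      (\<epsilon> \<bullet> ((f \<odot> g) \<lhd> \<epsilon>')) \<bullet> ((f \<odot> g) \<lhd> (a \<rhd> g')) \<bullet> (f \<lhd> (\<eta> \<rhd> g'))"
    by (simp add: mate_def)
  also have "\<epsilon> \<bullet> ((f \<odot> g) \<lhd> \<epsilon>') = \<epsilon>' \<bullet> (\<epsilon> \<rhd> (f' \<odot> g'))"
    using whisk_exchange[of \<epsilon>' \<epsilon> "f' \<odot> g'" "id1 K (trg K f)" "f \<odot> g" "id1 K (trg K f)"] by simp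
  also have "(\<epsilon>' \<bullet> (\<epsilon> \<rhd> (f' \<odot> g'))) \<bullet> ((f \<odot> g) \<lhd> (a \<rhd> g')) \<bullet> (f \<lhd> (\<eta> \<rhd> g')) =
      \<epsilon>' \<bullet> (((\<epsilon> \<rhd> f') \<bullet> ((f \<odot> g) \<lhd> a)) \<rhd> g') \<bullet> (f \<lhd> (\<eta> \<rhd> g'))" by simp
  also have "(\<epsilon> \<rhd> f') \<bullet> ((f \<odot> g) \<lhd> a) = a \<bullet> (\<epsilon> \<rhd> f)"
    using whisk_exchange[of a \<epsilon> f f' "f \<odot> g" "id1 K (trg K f)"] by simp
  also have "\<epsilon>' \<bullet> ((a \<bullet> (\<epsilon> \<rhd> f)) \<rhd> g') \<bullet> (f \<lhd> (\<eta> \<rhd> g')) =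
      \<epsilon>' \<bullet> (a \<rhd> g') \<bullet> (((\<epsilon> \<rhd> f) \<bullet> (f \<lhd> \<eta>)) \<rhd> g')" by simp
  also have "\<dots> = \<epsilon>' \<bullet> (a \<rhd> g')"
    unfolding adjunctionD(11)[OF adj] by simp
  finally show "\<epsilon> \<bullet> (f \<lhd> mate K g \<eta> g' \<epsilon>' a) = \<epsilon>' \<bullet> (a \<rhd> g')" .
qed

text \<open>
  \<open>b\<close> is the mate of \<open>a : f \<Rightarrow> f'\<close> iff transposing \<open>b\<close> along \<open>f \<stileturn> g\<close> agrees with the action of
  \<open>a\<close> followed by the counit of \<open>f' \<stileturn> g'\<close>.
\<close>

definition mates where
  "mates f g \<epsilon> f' g' \<epsilon>' a b \<longleftrightarrow>
    f \<in> Cells1 K \<and> g \<in> Cells1 K \<and> src K g = trg K f \<and> trg K g = src K f \<and>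
    \<epsilon> \<in> hom2 K (f \<odot> g) (id1 K (trg K f)) \<and>
    g' \<in> Cells1 K \<and> src K g' = trg K f' \<and> trg K g' = src K f' \<and>
    \<epsilon>' \<in> hom2 K (f' \<odot> g') (id1 K (trg K f')) \<and>
    a \<in> hom2 K f f' \<and> b \<in> hom2 K g' g \<and> \<epsilon> \<bullet> (f \<lhd> b) = \<epsilon>' \<bullet> (a \<rhd> g')"

lemma matesD:
  assumes "mates f g \<epsilon> f' g' \<epsilon>' a b"
  shows "f \<in> Cells1 K" "g \<in> Cells1 K" "src K g = trg K f" "trg K g = src K f"
    "\<epsilon> \<in> Cells2 K" "vsrc K \<epsilon> = f \<odot> g" "vtrg K \<epsilon> = id1 K (trg K f)"
    "f' \<in> Cells1 K" "g' \<in> Cells1 K" "src K g' = trg K f" "trg K g' = src K f"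
    "src K f' = src K f" "trg K f' = trg K f"
    "\<epsilon>' \<in> Cells2 K" "vsrc K \<epsilon>' = f' \<odot> g'" "vtrg K \<epsilon>' = id1 K (trg K f)"
    "a \<in> Cells2 K" "vsrc K a = f" "vtrg K a = f'" "b \<in> Cells2 K" "vsrc K b = g'" "vtrg K b = g"
    "\<epsilon> \<bullet> (f \<lhd> b) = \<epsilon>' \<bullet> (a \<rhd> g')"
  using assms src_vsrc[of a] trg_vsrc[of a] vtrg_closed[of a]
  by (auto simp: mates_def hom2_def)

lemma mates_mate:
  assumes "adjunction K f g \<eta> \<epsilon>" "adjunction K f' g' \<eta>' \<epsilon>'" "a \<in> hom2 K f f'"
  shows "mates f g \<epsilon> f' g' \<epsilon>' a (mate K g \<eta> g' \<epsilon>' a)"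
  using mate_counit[OF assms] adjunctionD[OF assms(1)] adjunctionD[OF assms(2)] assms(3)
  by (auto simp: mates_def hom2_def)

lemma mates_unique:
  assumes "adjunction K f g \<eta> \<epsilon>" "mates f g \<epsilon> f' g' \<epsilon>' a b" "mates f g \<epsilon> f' g' \<epsilon>' a b'"
  shows "b = b'"
  using adjunction_unique[OF assms(1), of b g' b'] assms(2,3) by (auto simp: mates_def)

lemma mates_id2:
  assumes "adjunction K f g \<eta> \<epsilon>"
  shows "mates f g \<epsilon> f g \<epsilon> (id2 K f) (id2 K g)"
  using adjunctionD[OF assms] by (auto simp: mates_def hom2_def)

text \<open>The two defining equations are pasted; \<open>a\<close> and \<open>b'\<close> act on
  different sides and slide past each other in between.\<close>

lemma mates_vcomp:
  assumes ab: "mates f g \<epsilon> f' g' \<epsilon>' a b" and ab': "mates f' g' \<epsilon>' f'' g'' \<epsilon>'' a' b'"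
  shows "mates f g \<epsilon> f'' g'' \<epsilon>'' (a' \<bullet> a) (b \<bullet> b')"
proof -
  note [simp] = matesD(1-22)[OF ab] matesD(1-22)[OF ab']
  have "\<epsilon> \<bullet> (f \<lhd> (b \<bullet> b')) = (\<epsilon> \<bullet> (f \<lhd> b)) \<bullet> (f \<lhd> b')" by simp
  also have "\<dots> = \<epsilon>' \<bullet> (a \<rhd> g') \<bullet> (f \<lhd> b')" unfolding matesD(23)[OF ab] by simp
  also have "(a \<rhd> g') \<bullet> (f \<lhd> b') = (f' \<lhd> b') \<bullet> (a \<rhd> g'')"
    using whisk_exchange[of b' a g'' g' f f'] by simp
  also have "\<epsilon>' \<bullet> (f' \<lhd> b') \<bullet> (a \<rhd> g'') = (\<epsilon>' \<bullet> (f' \<lhd> b')) \<bullet> (a \<rhd> g'')" by simp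
  also have "\<dots> = \<epsilon>'' \<bullet> ((a' \<bullet> a) \<rhd> g'')" unfolding matesD(23)[OF ab'] by simp
  finally show ?thesis by (auto simp: mates_def hom2_def)
qed

text \<open>The counit of the composite adjunction
  \<open>f2 \<odot> f1 \<stileturn> g1 \<odot> g2\<close>: the inner pair is cancelled first, then
  the outer one.\<close>

definition counit_comp where
  "counit_comp f2 g2 \<epsilon>2 \<epsilon>1 = \<epsilon>2 \<bullet> (f2 \<lhd> (\<epsilon>1 \<rhd> g2))"

text \<open>In each triangle the inner counit \<open>\<epsilon>1\<close> and the inner unit
  \<open>\<eta>2\<close> slide past each other, after which the triangle identities of the two given
  adjunctions apply separately.\<close>

lemma adjunction_comp:
  assumes adj1: "adjunction K f1 g1 \<eta>1 \<epsilon>1" and adj2: "adjunction K f2 g2 \<eta>2 \<epsilon>2"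
    and st: "src K f2 = trg K f1"
  shows "adjunction K (f2 \<odot> f1) (g1 \<odot> g2) ((g1 \<lhd> (\<eta>2 \<rhd> f1)) \<bullet> \<eta>1) (counit_comp f2 g2 \<epsilon>2 \<epsilon>1)"
proof (rule adjunctionI)
  note [simp] = adjunctionD(1-10)[OF adj1] adjunctionD(1-10)[OF adj2] st
  let ?\<eta> = "(g1 \<lhd> (\<eta>2 \<rhd> f1)) \<bullet> \<eta>1" and ?\<epsilon> = "counit_comp f2 g2 \<epsilon>2 \<epsilon>1"
  have "(?\<epsilon> \<rhd> (f2 \<odot> f1)) \<bullet> ((f2 \<odot> f1) \<lhd> ?\<eta>) = (\<epsilon>2 \<rhd> (f2 \<odot> f1)) \<bullet>
      (f2 \<lhd> ((\<epsilon>1 \<rhd> (g2 \<odot> f2)) \<bullet> ((f1 \<odot> g1) \<lhd> \<eta>2)) \<rhd> f1) \<bullet> ((f2 \<odot> f1) \<lhd> \<eta>1)"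
    by (simp add: counit_comp_def)
  also have "(\<epsilon>1 \<rhd> (g2 \<odot> f2)) \<bullet> ((f1 \<odot> g1) \<lhd> \<eta>2) = \<eta>2 \<bullet> \<epsilon>1"
    using whisk_exchange[of \<eta>2 \<epsilon>1 "id1 K (src K f2)" "g2 \<odot> f2" "f1 \<odot> g1" "id1 K (trg K f1)"] by simp
  also have "(\<epsilon>2 \<rhd> (f2 \<odot> f1)) \<bullet> (f2 \<lhd> (\<eta>2 \<bullet> \<epsilon>1) \<rhd> f1) \<bullet> ((f2 \<odot> f1) \<lhd> \<eta>1) =
    (((\<epsilon>2 \<rhd> f2) \<bullet> (f2 \<lhd> \<eta>2)) \<rhd> f1) \<bullet> (f2 \<lhd> ((\<epsilon>1 \<rhd> f1) \<bullet> (f1 \<lhd> \<eta>1)))" by simp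
  also have "\<dots> = id2 K (f2 \<odot> f1)"
    unfolding adjunctionD(11)[OF adj1] adjunctionD(11)[OF adj2] by simp
  finally show "(?\<epsilon> \<rhd> (f2 \<odot> f1)) \<bullet> ((f2 \<odot> f1) \<lhd> ?\<eta>) = id2 K (f2 \<odot> f1)" .
  have "((g1 \<odot> g2) \<lhd> ?\<epsilon>) \<bullet> (?\<eta> \<rhd> (g1 \<odot> g2)) = ((g1 \<odot> g2) \<lhd> \<epsilon>2) \<bullet>
      (g1 \<lhd> (((g2 \<odot> f2) \<lhd> \<epsilon>1) \<bullet> (\<eta>2 \<rhd> (f1 \<odot> g1))) \<rhd> g2) \<bullet> (\<eta>1 \<rhd> (g1 \<odot> g2))"
    by (simp add: counit_comp_def)
  also have "((g2 \<odot> f2) \<lhd> \<epsilon>1) \<bullet> (\<eta>2 \<rhd> (f1 \<odot> g1)) = \<eta>2 \<bullet> \<epsilon>1"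
    using whisk_exchange[of \<epsilon>1 \<eta>2 "f1 \<odot> g1" "id1 K (trg K f1)" "id1 K (src K f2)" "g2 \<odot> f2"] by simp
  also have "((g1 \<odot> g2) \<lhd> \<epsilon>2) \<bullet> (g1 \<lhd> (\<eta>2 \<bullet> \<epsilon>1) \<rhd> g2) \<bullet> (\<eta>1 \<rhd> (g1 \<odot> g2)) =
    (g1 \<lhd> ((g2 \<lhd> \<epsilon>2) \<bullet> (\<eta>2 \<rhd> g2))) \<bullet> (((g1 \<lhd> \<epsilon>1) \<bullet> (\<eta>1 \<rhd> g1)) \<rhd> g2)" by simp
  also have "\<dots> = id2 K (g1 \<odot> g2)"
    unfolding adjunctionD(12)[OF adj1] adjunctionD(12)[OF adj2] by simp
  finally show "((g1 \<odot> g2) \<lhd> ?\<epsilon>) \<bullet> (?\<eta> \<rhd> (g1 \<odot> g2)) = id2 K (g1 \<odot> g2)" .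
qed (use adjunctionD(1-10)[OF adj1] adjunctionD(1-10)[OF adj2] st in \<open>simp_all add: counit_comp_def\<close>)

text \<open>The factors are transposed from the inside out: the equation for \<open>b1\<close> is
  used under \<open>f2\<close> and \<open>g2\<close>, its result slides past \<open>b2\<close>, and
  then the equation for \<open>b2\<close> applies. Right adjoints compose in the reverse order,
  hence \<open>b1 \<star> b2\<close> against \<open>a2 \<star> a1\<close>.\<close>

lemma mates_hcomp:
  assumes ab1: "mates f1 g1 \<epsilon>1 f1' g1' \<epsilon>1' a1 b1" and ab2: "mates f2 g2 \<epsilon>2 f2' g2' \<epsilon>2' a2 b2"
    and st: "src K f2 = trg K f1"
  shows "mates (f2 \<odot> f1) (g1 \<odot> g2) (counit_comp f2 g2 \<epsilon>2 \<epsilon>1)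
    (f2' \<odot> f1') (g1' \<odot> g2') (counit_comp f2' g2' \<epsilon>2' \<epsilon>1') (a2 \<star> a1) (b1 \<star> b2)"
proof -
  note [simp] = matesD(1-22)[OF ab1] matesD(1-22)[OF ab2] st
  have "counit_comp f2 g2 \<epsilon>2 \<epsilon>1 \<bullet> ((f2 \<odot> f1) \<lhd> (b1 \<star> b2)) =
      \<epsilon>2 \<bullet> (f2 \<lhd> (\<epsilon>1 \<bullet> (f1 \<lhd> b1)) \<rhd> g2) \<bullet> ((f2 \<odot> f1 \<odot> g1') \<lhd> b2)"
    using hcomp_eq_rl[of b2 b1 g2' g2 g1' g1] by (simp add: counit_comp_def)
  also have "\<dots> = \<epsilon>2 \<bullet> (f2 \<lhd> (((\<epsilon>1' \<bullet> (a1 \<rhd> g1')) \<rhd> g2) \<bullet> ((f1 \<odot> g1') \<lhd> b2)))"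
    unfolding matesD(23)[OF ab1] by simp
  also have "((\<epsilon>1' \<bullet> (a1 \<rhd> g1')) \<rhd> g2) \<bullet> ((f1 \<odot> g1') \<lhd> b2) = b2 \<bullet> ((\<epsilon>1' \<bullet> (a1 \<rhd> g1')) \<rhd> g2')"
    using whisk_exchange[of b2 "\<epsilon>1' \<bullet> (a1 \<rhd> g1')" g2' g2 "f1 \<odot> g1'" "id1 K (trg K f1)"] by simp
  also have "\<epsilon>2 \<bullet> (f2 \<lhd> (b2 \<bullet> ((\<epsilon>1' \<bullet> (a1 \<rhd> g1')) \<rhd> g2'))) =
      (\<epsilon>2 \<bullet> (f2 \<lhd> b2)) \<bullet> (f2 \<lhd> ((\<epsilon>1' \<bullet> (a1 \<rhd> g1')) \<rhd> g2'))" by simp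
  also have "\<dots> = \<epsilon>2' \<bullet> ((a2 \<bullet> (f2 \<lhd> (\<epsilon>1' \<bullet> (a1 \<rhd> g1')))) \<rhd> g2')"
    unfolding matesD(23)[OF ab2] by simp
  also have "a2 \<bullet> (f2 \<lhd> (\<epsilon>1' \<bullet> (a1 \<rhd> g1'))) =
      (f2' \<lhd> (\<epsilon>1' \<bullet> (a1 \<rhd> g1'))) \<bullet> (a2 \<rhd> (f1 \<odot> g1'))"
    using whisk_exchange[of "\<epsilon>1' \<bullet> (a1 \<rhd> g1')" a2 "f1 \<odot> g1'" "id1 K (trg K f1)" f2 f2'] by simp
  also have "\<epsilon>2' \<bullet> (((f2' \<lhd> (\<epsilon>1' \<bullet> (a1 \<rhd> g1'))) \<bullet> (a2 \<rhd> (f1 \<odot> g1'))) \<rhd> g2') =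
    counit_comp f2' g2' \<epsilon>2' \<epsilon>1' \<bullet> ((a2 \<star> a1) \<rhd> (g1' \<odot> g2'))"
    using hcomp_eq_lr[of a1 a2 f1 f1' f2 f2'] by (simp add: counit_comp_def)
  finally show ?thesis by (auto simp: mates_def hom2_def counit_comp_def)
qed

text \<open>Right adjoints are unique up to isomorphism: the inverse is the mate of the identity in
  the other direction, since both composites are mates of an identity and thus identities.\<close>

lemma invertible2_mates_id2:
  assumes adj: "adjunction K f g \<eta> \<epsilon>" and adj': "adjunction K f g' \<eta>' \<epsilon>'"
    and b: "mates f g \<epsilon> f g' \<epsilon>' (id2 K f) b"
  shows "invertible2 K b"
proof -
  define c where "c = mate K g' \<eta>' g \<epsilon> (id2 K f)"
  note [simp] = adjunctionD(1-10)[OF adj]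
  have c: "mates f g' \<epsilon>' f g \<epsilon> (id2 K f) c"
    unfolding c_def by (rule mates_mate[OF adj' adj]) (simp add: hom2_def)
  have "b \<bullet> c = id2 K g"
    using mates_unique[OF adj mates_vcomp[OF b c]] mates_id2[OF adj] by simp
  moreover have "c \<bullet> b = id2 K g'"
    using mates_unique[OF adj' mates_vcomp[OF c b]] mates_id2[OF adj'] by simp
  ultimately show ?thesis using matesD[OF b] matesD[OF c] unfolding invertible2_def hom2_def by auto
qed

end


section \<open>Right adjoints of the values of a 2-functor\<close>

lemma coop_simps [simp]:
  "Cells0 (coop K) = Cells0 K" "Cells1 (coop K) = Cells1 K" "Cells2 (coop K) = Cells2 K"
  "src (coop K) = trg K" "trg (coop K) = src K" "vsrc (coop K) = vtrg K" "vtrg (coop K) = vsrc K"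
  "id1 (coop K) = id1 K" "id2 (coop K) = id2 K"
  "g \<odot>\<^bsub>coop K\<^esub> f = f \<odot>\<^bsub>K\<^esub> g" "b \<bullet>\<^bsub>coop K\<^esub> a = a \<bullet>\<^bsub>K\<^esub> b" "b \<star>\<^bsub>coop K\<^esub> a = a \<star>\<^bsub>K\<^esub> b"
  by (simp_all add: coop_def)

lemma two_category_coop:
  assumes "two_category K" shows "two_category (coop K)"
proof -
  interpret K: two_category K by fact
  show ?thesis
  proof
    fix a a' b b' f f' f'' g g' g''
    assume "a \<in> hom2 (coop K) f f'" "a' \<in> hom2 (coop K) f' f''" "b \<in> hom2 (coop K) g g'"
      "b' \<in> hom2 (coop K) g' g''" "src (coop K) g = trg (coop K) f"
    then show "(b' \<bullet>\<^bsub>coop K\<^esub> b) \<star>\<^bsub>coop K\<^esub> (a' \<bullet>\<^bsub>coop K\<^esub> a) =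
        (b' \<star>\<^bsub>coop K\<^esub> a') \<bullet>\<^bsub>coop K\<^esub> (b \<star>\<^bsub>coop K\<^esub> a)"
      using K.hcomp_vcomp[of b' b a' a] K.src_vsrc[of a] K.src_vsrc[of a'] K.trg_vsrc[of b]
        K.trg_vsrc[of b'] by (auto simp: hom2_iff)
  qed (auto simp: hom1_iff hom2_iff)
qed

text \<open>As \<open>H\<close> is defined on \<open>coop L\<close>, \<open>act1 H m\<close> runs
  against \<open>m\<close> and \<open>act2 H\<close> reverses 2-cells. The right adjoints therefore
  run in the direction of \<open>m\<close>, and passing to mates reverses 2-cells once more, so that
  \<open>R\<close> becomes covariant on both levels.\<close>

locale local_right_adjoints = L: two_category L + M: two_category M
  for L :: "('o, 'a, 'c) two_cat" and M :: "('p, 'b, 'd) two_cat" (structure) +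
  fixes H :: "('o, 'a, 'c, 'p, 'b, 'd) two_map" and R :: "'a \<Rightarrow> 'b" and \<eta> \<epsilon> :: "'a \<Rightarrow> 'd"
  assumes two_functor_H: "two_functor (coop L) M H"
    and adj: "m \<in> Cells1 L \<Longrightarrow> adjunction M (act1 H m) (R m) (\<eta> m) (\<epsilon> m)"
begin

interpretation H: two_functor "coop L" M H by (rule two_functor_H)

lemma act0_H [simp]: "p \<in> Cells0 L \<Longrightarrow> act0 H p \<in> Cells0 M"
  using H.act0_closed by simp

lemma act1_H [simp]:
  assumes "m \<in> Cells1 L"
  shows "act1 H m \<in> Cells1 M" "src M (act1 H m) = act0 H (trg L m)"
    "trg M (act1 H m) = act0 H (src L m)"
  using H.act1_hom1[of m "trg L m" "src L m"] assms by (auto simp: hom1_iff)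

lemma act2_H [simp]:
  assumes "a \<in> Cells2 L"
  shows "act2 H a \<in> Cells2 M" "vsrc M (act2 H a) = act1 H (vtrg L a)"
    "vtrg M (act2 H a) = act1 H (vsrc L a)"
  using H.act2_hom2[of a "vtrg L a" "vsrc L a"] assms by (auto simp: hom2_iff)

lemma act1_H_id1 [simp]: "p \<in> Cells0 L \<Longrightarrow> act1 H (id1 L p) = id1 M (act0 H p)"
  using H.act1_id1 by simp

lemma act1_H_comp1 [simp]:
  assumes "f \<in> Cells1 L" "g \<in> Cells1 L" "src L g = trg L f"
  shows "act1 H (g \<odot>\<^bsub>L\<^esub> f) = act1 H f \<odot> act1 H g"
  using H.act1_comp1[of g "trg L g" "trg L f" f "src L f"] assms by (simp add: hom1_iff)

lemma act2_H_id2 [simp]: "f \<in> Cells1 L \<Longrightarrow> act2 H (id2 L f) = id2 M (act1 H f)"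
  using H.act2_id2 by simp

lemma act2_H_vcomp [simp]:
  assumes "a \<in> Cells2 L" "b \<in> Cells2 L" "vsrc L b = vtrg L a"
  shows "act2 H (b \<bullet>\<^bsub>L\<^esub> a) = act2 H a \<bullet> act2 H b"
  using H.act2_vcomp[of b "vtrg L b" "vtrg L a" a "vsrc L a"] assms by (simp add: hom2_iff)

lemma act2_H_hcomp [simp]:
  assumes "a \<in> Cells2 L" "b \<in> Cells2 L" "src L (vsrc L b) = trg L (vsrc L a)"
  shows "act2 H (b \<star>\<^bsub>L\<^esub> a) = act2 H a \<star> act2 H b"
  using H.act2_hcomp[of b a] assms by (simp add: hom2_iff)

lemma R_simps [simp]:
  assumes "m \<in> Cells1 L"
  shows "R m \<in> Cells1 M" "src M (R m) = act0 H (src L m)" "trg M (R m) = act0 H (trg L m)"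
  using M.adjunctionD[OF adj[OF assms]] assms by simp_all

lemma unit_counit_simps [simp]:
  assumes "m \<in> Cells1 L"
  shows "\<eta> m \<in> Cells2 M" "vsrc M (\<eta> m) = id1 M (act0 H (trg L m))"
    "vtrg M (\<eta> m) = R m \<odot> act1 H m"
    "\<epsilon> m \<in> Cells2 M" "vsrc M (\<epsilon> m) = act1 H m \<odot> R m"
    "vtrg M (\<epsilon> m) = id1 M (act0 H (src L m))"
  using M.adjunctionD[OF adj[OF assms]] assms by simp_all

section \<open>Mates of 2-cells and comparison cells between right adjoints\<close>

definition Rmap :: "'c \<Rightarrow> 'd" where
  "Rmap a = mate M (R (vtrg L a)) (\<eta> (vtrg L a)) (R (vsrc L a)) (\<epsilon> (vsrc L a)) (act2 H a)"

definition \<epsilon>2 :: "'a \<Rightarrow> 'a \<Rightarrow> 'd" where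
  "\<epsilon>2 g f = M.counit_comp (act1 H f) (R f) (\<epsilon> f) (\<epsilon> g)"

text \<open>Because \<open>H\<close> preserves composition strictly, \<open>R (g \<odot> f)\<close>
  and \<open>R g \<odot> R f\<close> are right adjoint to the same 1-cell, and the comparison
  between them is the mate of its identity.\<close>

definition Rcomp :: "'a \<Rightarrow> 'a \<Rightarrow> 'd" where
  "Rcomp g f = mate M (R (g \<odot>\<^bsub>L\<^esub> f)) (\<eta> (g \<odot>\<^bsub>L\<^esub> f)) (R g \<odot> R f) (\<epsilon>2 g f) (id2 M (act1 H (g \<odot>\<^bsub>L\<^esub> f)))"

definition Runit :: "'o \<Rightarrow> 'd" where
  "Runit p = mate M (R (id1 L p)) (\<eta> (id1 L p)) (id1 M (act0 H p)) (id2 M (id1 M (act0 H p)))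
     (id2 M (id1 M (act0 H p)))"

definition Rps :: "('o, 'a, 'c, 'p, 'b, 'd) pseudo_map" where
  "Rps = \<lparr>act0 = act0 H, act1 = R, act2 = Rmap, pcomp = Rcomp, punit = Runit\<rparr>"

lemma mates_Rmap:
  assumes "a \<in> hom2 L f f'"
  shows "M.mates (act1 H f') (R f') (\<epsilon> f') (act1 H f) (R f) (\<epsilon> f) (act2 H a) (Rmap a)"
proof -
  have "f \<in> Cells1 L" "f' \<in> Cells1 L" using assms by (auto simp: hom2_iff)
  then show ?thesis
    using M.mates_mate[OF adj adj, of f' f "act2 H a"] assms by (auto simp: Rmap_def hom2_iff)
qed

context
  fixes f g p q r
  assumes f: "f \<in> hom1 L p q" and g: "g \<in> hom1 L q r"
begin

lemma adj_comp1:
  "\<exists>\<eta>'. adjunction M (act1 H f \<odot> act1 H g) (R g \<odot> R f) \<eta>' (\<epsilon>2 g f)"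
  using M.adjunction_comp[OF adj[of g] adj[of f]] f g unfolding \<epsilon>2_def hom1_iff by auto

lemma mates_Rcomp:
  "M.mates (act1 H f \<odot> act1 H g) (R (g \<odot>\<^bsub>L\<^esub> f)) (\<epsilon> (g \<odot>\<^bsub>L\<^esub> f))
    (act1 H f \<odot> act1 H g) (R g \<odot> R f) (\<epsilon>2 g f) (id2 M (act1 H f \<odot> act1 H g)) (Rcomp g f)"
proof -
  obtain \<eta>' where *: "adjunction M (act1 H f \<odot> act1 H g) (R g \<odot> R f) \<eta>' (\<epsilon>2 g f)"
    using adj_comp1 by blast
  have "adjunction M (act1 H (g \<odot>\<^bsub>L\<^esub> f)) (R (g \<odot>\<^bsub>L\<^esub> f)) (\<eta> (g \<odot>\<^bsub>L\<^esub> f)) (\<epsilon> (g \<odot>\<^bsub>L\<^esub> f))"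
    using f g by (intro adj) (simp add: hom1_iff)
  moreover have "act1 H (g \<odot>\<^bsub>L\<^esub> f) = act1 H f \<odot> act1 H g"
    using f g by (simp add: hom1_iff)
  ultimately have "adjunction M (act1 H f \<odot> act1 H g) (R (g \<odot>\<^bsub>L\<^esub> f)) (\<eta> (g \<odot>\<^bsub>L\<^esub> f)) (\<epsilon> (g \<odot>\<^bsub>L\<^esub> f))"
    by simp
  from M.mates_mate[OF this *] show ?thesis
    using f g unfolding Rcomp_def by (simp add: hom1_iff hom2_iff)
qed

lemma invertible_Rcomp: "invertible2 M (Rcomp g f)"
proof -
  obtain \<eta>' where *: "adjunction M (act1 H f \<odot> act1 H g) (R g \<odot> R f) \<eta>' (\<epsilon>2 g f)"
    using adj_comp1 by blast
  have "adjunction M (act1 H (g \<odot>\<^bsub>L\<^esub> f)) (R (g \<odot>\<^bsub>L\<^esub> f)) (\<eta> (g \<odot>\<^bsub>L\<^esub> f)) (\<epsilon> (g \<odot>\<^bsub>L\<^esub> f))"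
    using f g by (intro adj) (simp add: hom1_iff)
  then show ?thesis
    using M.invertible2_mates_id2[OF _ * mates_Rcomp, of "\<eta> (g \<odot>\<^bsub>L\<^esub> f)"] f g by (simp add: hom1_iff)
qed

end

lemma mates_Runit:
  assumes "p \<in> Cells0 L"
  shows "M.mates (id1 M (act0 H p)) (R (id1 L p)) (\<epsilon> (id1 L p))
    (id1 M (act0 H p)) (id1 M (act0 H p)) (id2 M (id1 M (act0 H p))) (id2 M (id1 M (act0 H p))) (Runit p)"
  using M.mates_mate[OF adj[of "id1 L p"] M.adjunction_id1[of "act0 H p"]] assms
  unfolding Runit_def by (simp add: hom2_iff)

lemma invertible_Runit:
  assumes "p \<in> Cells0 L"
  shows "invertible2 M (Runit p)"
  using M.invertible2_mates_id2[OF _ _ mates_Runit[OF assms]] adj[of "id1 L p"]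
    M.adjunction_id1[of "act0 H p"] assms by simp

text \<open>Either way of composing three adjunctions cancels \<open>h\<close>, then
  \<open>g\<close>, then \<open>f\<close>. The equation lets the two sides of the associativity law
  be mates with respect to the same counits.\<close>

lemma counit_comp_assoc:
  assumes "f \<in> hom1 L p q" "g \<in> hom1 L q r" "h \<in> hom1 L r s"
  shows "M.counit_comp (act1 H f \<odot> act1 H g) (R g \<odot> R f) (\<epsilon>2 g f) (\<epsilon> h) =
    M.counit_comp (act1 H f) (R f) (\<epsilon> f) (\<epsilon>2 h g)"
  using assms by (simp add: M.counit_comp_def \<epsilon>2_def hom1_iff)

text \<open>Both sides of each equation are exhibited as mates of one 2-cell, an identity for the
  unit and associativity laws and \<open>act2 H a \<star> act2 H b\<close> for naturality of
  \<open>Rcomp\<close>; \<open>mates_unique\<close> then identifies them. Invertibility comes from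
  \<open>invertible2_mates_id2\<close>.\<close>

lemma pseudofunctor_Rps: "pseudofunctor L M Rps"
proof
  fix f :: 'a and p q assume f: "f \<in> hom1 L p q"
  then have fpq: "f \<in> Cells1 L" "p \<in> Cells0 L" "q \<in> Cells0 L" "src L f = p" "trg L f = q"
    by (auto simp: hom1_iff)
  have pq: "id1 L p \<in> hom1 L p p" "id1 L q \<in> hom1 L q q" using fpq by (simp_all add: hom1_iff)
  have 1: "M.mates (act1 H f) (R f) (\<epsilon> f) (act1 H f) (R f) (\<epsilon> f) (id2 M (act1 H f)) (id2 M (R f))"
    using M.mates_id2[OF adj] fpq by blast
  \<comment> \<open>Composition with the identity adjunction leaves a counit unchanged, so that the
    composites below end in \<open>R f\<close> with counit \<open>\<epsilon> f\<close>
    again.\<close>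
  have 2: "M.counit_comp (act1 H f) (R f) (\<epsilon> f) (id2 M (id1 M (act0 H q))) = \<epsilon> f"
    "M.counit_comp (id1 M (act0 H p)) (id1 M (act0 H p)) (id2 M (id1 M (act0 H p))) (\<epsilon> f) = \<epsilon> f"
    using fpq by (simp_all add: M.counit_comp_def)
  have 3: "M.mates (act1 H f) (R f) (\<epsilon> f) (act1 H f) (R (id1 L q) \<odot> R f) (\<epsilon>2 (id1 L q) f)
      (id2 M (act1 H f)) (Rcomp (id1 L q) f)"
    using mates_Rcomp[OF f pq(2)] fpq by simp
  have 4: "M.mates (act1 H f) (R (id1 L q) \<odot> R f) (\<epsilon>2 (id1 L q) f) (act1 H f) (R f) (\<epsilon> f)
      (id2 M (act1 H f)) (Runit q \<star> id2 M (R f))"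
    using M.mates_hcomp[OF mates_Runit[of q] 1] fpq by (simp add: 2 \<epsilon>2_def)
  have 5: "M.mates (act1 H f) (R f) (\<epsilon> f) (act1 H f) (R f \<odot> R (id1 L p)) (\<epsilon>2 f (id1 L p))
      (id2 M (act1 H f)) (Rcomp f (id1 L p))"
    using mates_Rcomp[OF pq(1) f] fpq by simp
  have 6: "M.mates (act1 H f) (R f \<odot> R (id1 L p)) (\<epsilon>2 f (id1 L p)) (act1 H f) (R f) (\<epsilon> f)
      (id2 M (act1 H f)) (id2 M (R f) \<star> Runit p)"
    using M.mates_hcomp[OF 1 mates_Runit[of p]] fpq by (simp add: 2 \<epsilon>2_def)
  show "pcomp Rps (id1 L q) f \<bullet> (punit Rps q \<rhd> act1 Rps f) = id2 M (act1 Rps f)"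
    by (rule M.mates_unique[OF adj[OF fpq(1)]])
      (use M.mates_vcomp[OF 3 4] 1 fpq in \<open>simp_all add: Rps_def rwhisk_def\<close>)
  show "pcomp Rps f (id1 L p) \<bullet> (act1 Rps f \<lhd> punit Rps p) = id2 M (act1 Rps f)"
    by (rule M.mates_unique[OF adj[OF fpq(1)]])
      (use M.mates_vcomp[OF 5 6] 1 fpq in \<open>simp_all add: Rps_def lwhisk_def\<close>)
next
  fix f g h :: 'a and p q r s
  assume *: "f \<in> hom1 L p q" "g \<in> hom1 L q r" "h \<in> hom1 L r s"
  then have fgh: "f \<in> Cells1 L" "g \<in> Cells1 L" "h \<in> Cells1 L" "src L g = trg L f" "src L h = trg L g"
    by (auto simp: hom1_iff)
  have gf: "g \<odot>\<^bsub>L\<^esub> f \<in> hom1 L p r" and hg: "h \<odot>\<^bsub>L\<^esub> g \<in> hom1 L q s"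
    using * by (auto simp: hom1_iff)
  have id: "M.mates (act1 H x) (R x) (\<epsilon> x) (act1 H x) (R x) (\<epsilon> x) (id2 M (act1 H x)) (id2 M (R x))"
    if "x \<in> Cells1 L" for x using M.mates_id2[OF adj] that by blast
  let ?H = "act1 H f \<odot> act1 H g \<odot> act1 H h" and ?R = "R (h \<odot>\<^bsub>L\<^esub> g \<odot>\<^bsub>L\<^esub> f)"
    and ?\<epsilon> = "\<epsilon> (h \<odot>\<^bsub>L\<^esub> g \<odot>\<^bsub>L\<^esub> f)"
  have a1: "M.mates ?H ?R ?\<epsilon> ?H (R h \<odot> R (g \<odot>\<^bsub>L\<^esub> f)) (\<epsilon>2 h (g \<odot>\<^bsub>L\<^esub> f)) (id2 M ?H) (Rcomp h (g \<odot>\<^bsub>L\<^esub> f))"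
    using mates_Rcomp[OF gf *(3)] fgh by simp
  have a2: "M.mates ?H (R h \<odot> R (g \<odot>\<^bsub>L\<^esub> f)) (\<epsilon>2 h (g \<odot>\<^bsub>L\<^esub> f)) ?H (R h \<odot> R g \<odot> R f)
      (M.counit_comp (act1 H f \<odot> act1 H g) (R g \<odot> R f) (\<epsilon>2 g f) (\<epsilon> h)) (id2 M ?H) (id2 M (R h) \<star> Rcomp g f)"
    using M.mates_hcomp[OF id[OF fgh(3)] mates_Rcomp[OF *(1,2)]] fgh by (simp add: \<epsilon>2_def)
  have a3: "M.mates ?H ?R ?\<epsilon> ?H (R (h \<odot>\<^bsub>L\<^esub> g) \<odot> R f) (\<epsilon>2 (h \<odot>\<^bsub>L\<^esub> g) f) (id2 M ?H) (Rcomp (h \<odot>\<^bsub>L\<^esub> g) f)"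
    using mates_Rcomp[OF *(1) hg] fgh by simp
  \<comment> \<open>The composite counit is rebracketed here, so that both sides of the law have the
    boundary data that \<open>mates_unique\<close> asks to be equal.\<close>
  have a4: "M.mates ?H (R (h \<odot>\<^bsub>L\<^esub> g) \<odot> R f) (\<epsilon>2 (h \<odot>\<^bsub>L\<^esub> g) f) ?H (R h \<odot> R g \<odot> R f)
      (M.counit_comp (act1 H f \<odot> act1 H g) (R g \<odot> R f) (\<epsilon>2 g f) (\<epsilon> h)) (id2 M ?H) (Rcomp h g \<star> id2 M (R f))"
    using M.mates_hcomp[OF mates_Rcomp[OF *(2,3)] id[OF fgh(1)]] fgh
    unfolding counit_comp_assoc[OF *] by (simp add: \<epsilon>2_def)
  have 1: "M.mates (act1 H (h \<odot>\<^bsub>L\<^esub> g \<odot>\<^bsub>L\<^esub> f)) (R (h \<odot>\<^bsub>L\<^esub> g \<odot>\<^bsub>L\<^esub> f)) (\<epsilon> (h \<odot>\<^bsub>L\<^esub> g \<odot>\<^bsub>L\<^esub> f))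
      (act1 H f \<odot> act1 H g \<odot> act1 H h) (R h \<odot> R g \<odot> R f)
      (M.counit_comp (act1 H f \<odot> act1 H g) (R g \<odot> R f) (\<epsilon>2 g f) (\<epsilon> h))
      (id2 M (act1 H f \<odot> act1 H g \<odot> act1 H h))
      (Rcomp h (g \<odot>\<^bsub>L\<^esub> f) \<bullet> (R h \<lhd> Rcomp g f))"
    using M.mates_vcomp[OF a1 a2] fgh by (simp add: lwhisk_def)
  have 2: "M.mates (act1 H (h \<odot>\<^bsub>L\<^esub> g \<odot>\<^bsub>L\<^esub> f)) (R (h \<odot>\<^bsub>L\<^esub> g \<odot>\<^bsub>L\<^esub> f)) (\<epsilon> (h \<odot>\<^bsub>L\<^esub> g \<odot>\<^bsub>L\<^esub> f))
      (act1 H f \<odot> act1 H g \<odot> act1 H h) (R h \<odot> R g \<odot> R f)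
      (M.counit_comp (act1 H f \<odot> act1 H g) (R g \<odot> R f) (\<epsilon>2 g f) (\<epsilon> h))
      (id2 M (act1 H f \<odot> act1 H g \<odot> act1 H h))
      (Rcomp (h \<odot>\<^bsub>L\<^esub> g) f \<bullet> (Rcomp h g \<rhd> R f))"
    using M.mates_vcomp[OF a3 a4] fgh by (simp add: rwhisk_def)
  have hgf: "h \<odot>\<^bsub>L\<^esub> g \<odot>\<^bsub>L\<^esub> f \<in> Cells1 L" using fgh by simp
  show "pcomp Rps h (g \<odot>\<^bsub>L\<^esub> f) \<bullet> (act1 Rps h \<lhd> pcomp Rps g f)
      = pcomp Rps (h \<odot>\<^bsub>L\<^esub> g) f \<bullet> (pcomp Rps h g \<rhd> act1 Rps f)"
    unfolding Rps_def pseudo_map.select_convs two_map.select_convs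
    by (rule M.mates_unique[OF adj[OF hgf] 1 2])
next
  fix a b :: 'c and f f' g g'
  assume *: "a \<in> hom2 L f f'" "b \<in> hom2 L g g'" "src L g = trg L f"
  then have ab': "a \<in> Cells2 L" "vsrc L a = f" "vtrg L a = f'" "b \<in> Cells2 L" "vsrc L b = g" "vtrg L b = g'"
    by (simp_all add: hom2_iff)
  have st: "f \<in> Cells1 L" "f' \<in> Cells1 L" "g \<in> Cells1 L" "g' \<in> Cells1 L" "src L f' = src L f"
      "trg L f' = trg L f" "src L g' = trg L f" "trg L g' = trg L g"
    using *(3) L.vsrc_closed[OF ab'(1)] L.vtrg_closed[OF ab'(1)] L.vsrc_closed[OF ab'(4)]
      L.vtrg_closed[OF ab'(4)] L.src_vsrc[OF ab'(1)] L.trg_vsrc[OF ab'(1)] L.src_vsrc[OF ab'(4)]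
      L.trg_vsrc[OF ab'(4)] unfolding ab' by simp_all
  have ab: "b \<star>\<^bsub>L\<^esub> a \<in> hom2 L (g \<odot>\<^bsub>L\<^esub> f) (g' \<odot>\<^bsub>L\<^esub> f')" "a \<in> Cells2 L" "b \<in> Cells2 L" "vsrc L a = f"
      "vtrg L a = f'" "vsrc L b = g" "vtrg L b = g'"
    using * st by (auto simp: hom2_iff)
  have fg: "f \<in> hom1 L (src L f) (trg L f)" "g \<in> hom1 L (trg L f) (trg L g)"
    "f' \<in> hom1 L (src L f) (trg L f)" "g' \<in> hom1 L (trg L f) (trg L g)"
    using st *(3) by (simp_all add: hom1_iff)
  have b1: "M.mates (act1 H (g' \<odot>\<^bsub>L\<^esub> f')) (R (g' \<odot>\<^bsub>L\<^esub> f')) (\<epsilon> (g' \<odot>\<^bsub>L\<^esub> f'))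
     (act1 H f \<odot> act1 H g) (R (g \<odot>\<^bsub>L\<^esub> f)) (\<epsilon> (g \<odot>\<^bsub>L\<^esub> f)) (act2 H a \<star> act2 H b) (Rmap (b \<star>\<^bsub>L\<^esub> a))"
    using mates_Rmap[OF ab(1)] st *(3) ab(2-) by simp
  have b2: "M.mates (act1 H f' \<odot> act1 H g') (R g' \<odot> R f') (\<epsilon>2 g' f')
     (act1 H f \<odot> act1 H g) (R g \<odot> R f) (\<epsilon>2 g f) (act2 H a \<star> act2 H b) (Rmap b \<star> Rmap a)"
    using M.mates_hcomp[OF mates_Rmap[OF *(2)] mates_Rmap[OF *(1)]] st *(3) by (simp add: \<epsilon>2_def)
  have 1: "M.mates (act1 H (g' \<odot>\<^bsub>L\<^esub> f')) (R (g' \<odot>\<^bsub>L\<^esub> f')) (\<epsilon> (g' \<odot>\<^bsub>L\<^esub> f'))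
     (act1 H f \<odot> act1 H g) (R g \<odot> R f) (\<epsilon>2 g f) (act2 H a \<star> act2 H b)
     (Rmap (b \<star>\<^bsub>L\<^esub> a) \<bullet> Rcomp g f)"
    using M.mates_vcomp[OF b1 mates_Rcomp[OF fg(1,2)]] st *(3) ab(2-) by simp
  have 2: "M.mates (act1 H (g' \<odot>\<^bsub>L\<^esub> f')) (R (g' \<odot>\<^bsub>L\<^esub> f')) (\<epsilon> (g' \<odot>\<^bsub>L\<^esub> f'))
     (act1 H f \<odot> act1 H g) (R g \<odot> R f) (\<epsilon>2 g f) (act2 H a \<star> act2 H b)
     (Rcomp g' f' \<bullet> (Rmap b \<star> Rmap a))"
    using M.mates_vcomp[OF mates_Rcomp[OF fg(3,4)] b2] st *(3) ab(2-) by simp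
  have gf': "g' \<odot>\<^bsub>L\<^esub> f' \<in> Cells1 L" using st *(3) by simp
  show "act2 Rps (b \<star>\<^bsub>L\<^esub> a) \<bullet> pcomp Rps g f = pcomp Rps g' f' \<bullet> (act2 Rps b \<star> act2 Rps a)"
    unfolding Rps_def pseudo_map.select_convs two_map.select_convs
    by (rule M.mates_unique[OF adj[OF gf'] 1 2])
next
  fix a b :: 'c and f g h
  assume *: "a \<in> hom2 L f g" "b \<in> hom2 L g h"
  then have ba: "b \<bullet>\<^bsub>L\<^esub> a \<in> hom2 L f h" "h \<in> Cells1 L" by (auto simp: hom2_iff)
  show "act2 Rps (b \<bullet>\<^bsub>L\<^esub> a) = act2 Rps b \<bullet> act2 Rps a"
    using M.mates_unique[OF adj[OF ba(2)] mates_Rmap[OF ba(1)], of "Rmap b \<bullet> Rmap a"]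
      M.mates_vcomp[OF mates_Rmap[OF *(2)] mates_Rmap[OF *(1)]] * by (auto simp: Rps_def hom2_iff)
next
  fix f assume f: "f \<in> Cells1 L"
  then have "id2 L f \<in> hom2 L f f" by (simp add: hom2_iff)
  then show "act2 Rps (id2 L f) = id2 M (act1 Rps f)"
    using M.mates_unique[OF adj[OF f] mates_Rmap, of "id2 L f" f "id2 M (R f)"]
      M.mates_id2[OF adj[OF f]] f by (simp add: Rps_def)
next
  fix a f g assume "a \<in> hom2 L f g"
  then show "act2 Rps a \<in> hom2 M (act1 Rps f) (act1 Rps g)"
    using mates_Rmap[of a f g] by (auto simp: Rps_def hom2_iff dest: M.matesD)
next
  fix f g p q r assume "f \<in> hom1 L p q" "g \<in> hom1 L q r"
  then show "pcomp Rps g f \<in> hom2 M (act1 Rps g \<odot> act1 Rps f) (act1 Rps (g \<odot>\<^bsub>L\<^esub> f))"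
    "invertible2 M (pcomp Rps g f)"
    using M.matesD[OF mates_Rcomp] invertible_Rcomp by (simp_all add: Rps_def hom2_iff)
next
  fix p assume "p \<in> Cells0 L"
  then show "punit Rps p \<in> hom2 M (id1 M (act0 Rps p)) (act1 Rps (id1 L p))"
    "invertible2 M (punit Rps p)"
    using M.matesD[OF mates_Runit] invertible_Runit by (simp_all add: Rps_def hom2_iff)
qed (auto simp: Rps_def hom1_iff)

end


section \<open>The 2-category with freely adjoined right adjoints\<close>

context two_category
begin

section \<open>Composition of zigzags in normal form\<close>

lemma ztrg_closed [simp]: "zigzag_in K w \<Longrightarrow> ztrg K w \<in> Cells0 K"
  by (cases w) auto

lemma zsrc_closed [simp]: "zigzag_in K w \<Longrightarrow> zsrc K w \<in> Cells0 K"
  by (induction w) auto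

lemma zprefix_simps [simp]:
  assumes "m \<in> Cells1 K" "zigzag_in K w" "src K m = ztrg K w"
  shows "zigzag_in K (zprefix K m w)" "zsrc K (zprefix K m w) = zsrc K w"
    "ztrg K (zprefix K m w) = trg K m"
  using assms by (cases w; auto)+

lemma zcomp_simps [simp]:
  assumes "zigzag_in K w" "zigzag_in K v" "zsrc K w = ztrg K v"
  shows "zigzag_in K (zcomp K w v)" "zsrc K (zcomp K w v) = zsrc K v"
    "ztrg K (zcomp K w v) = ztrg K w"
  using assms by (induction w) auto

lemma zprefix_zprefix:
  "\<lbrakk>m \<in> Cells1 K; n \<in> Cells1 K; zigzag_in K w; src K n = ztrg K w; src K m = trg K n\<rbrakk>
   \<Longrightarrow> zprefix K (m \<odot> n) w = zprefix K m (zprefix K n w)"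
  by (cases w) auto

lemma zcomp_zprefix:
  "\<lbrakk>m \<in> Cells1 K; zigzag_in K w; zigzag_in K v; src K m = ztrg K w; zsrc K w = ztrg K v\<rbrakk>
   \<Longrightarrow> zcomp K (zprefix K m w) v = zprefix K m (zcomp K w v)"
  by (cases w) (auto simp: zprefix_zprefix)

lemma zcomp_zcomp [simp]:
  "\<lbrakk>zigzag_in K w; zigzag_in K v; zigzag_in K u; zsrc K w = ztrg K v; zsrc K v = ztrg K u\<rbrakk>
   \<Longrightarrow> zcomp K (zcomp K w v) u = zcomp K w (zcomp K v u)"
  by (induction w) (auto simp: zcomp_zprefix)

lemma zcomp_id1 [simp]:
  "zigzag_in K w \<Longrightarrow> ztrg K w = p \<Longrightarrow> zcomp K (Base (id1 K p)) w = w"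
  "zigzag_in K w \<Longrightarrow> zsrc K w = p \<Longrightarrow> zcomp K w (Base (id1 K p)) = w"
  by (cases w; auto) (induction w; auto)

lemma zprefix_id1 [simp]: "zigzag_in K w \<Longrightarrow> ztrg K w = p \<Longrightarrow> zprefix K (id1 K p) w = w"
  by (cases w) auto

lemma dagger_simps [simp]:
  assumes "m \<in> Cells1 K"
  shows "zigzag_in K (dagger K m)" "zsrc K (dagger K m) = trg K m" "ztrg K (dagger K m) = src K m"
  using assms by (simp_all add: dagger_def)

text \<open>\<open>HComp\<close> checks composability on sources only, so the induction has to carry
  along that the source and the target of an expression are parallel.\<close>

lemma cexpr_in_boundary:
  assumes "cexpr_in K e"
  shows "zigzag_in K (esrc K e) \<and> zigzag_in K (etrg K e) \<and> zsrc K (etrg K e) = zsrc K (esrc K e) \<and>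
    ztrg K (etrg K e) = ztrg K (esrc K e)"
  using assms by (induction e) auto

lemma cexpr_in_simps [simp]:
  assumes "cexpr_in K e"
  shows "zigzag_in K (esrc K e)" "zigzag_in K (etrg K e)" "zsrc K (etrg K e) = zsrc K (esrc K e)"
    "ztrg K (etrg K e) = ztrg K (esrc K e)"
  using cexpr_in_boundary[OF assms] by auto

text \<open>Equivalent expressions have the same boundary, so the source and target of a class can
  be read off any representative.\<close>

lemma cexpr_eq_boundary:
  "cexpr_eq K e d \<Longrightarrow>
    cexpr_in K e \<and> cexpr_in K d \<and> esrc K d = esrc K e \<and> etrg K d = etrg K e"
proof (induction rule: cexpr_eq.induct)
  case (Emb_hcomp a b)
  then show ?case by (auto simp: zcomp.simps)
next
  case (triangle_left m)
  then show ?case by (auto simp: zcomp_zprefix dagger_def)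
next
  case (triangle_right m)
  then show ?case by (auto simp: dagger_def)
qed auto

end

lemma cell_class_eq_iff:
  assumes "cexpr_in L e"
  shows "cell_class L e = cell_class L d \<longleftrightarrow> cexpr_eq L e d"
  using assms cexpr_eq.sym[of L] cexpr_eq.trans[of L] cexpr_eq.refl[of L]
  unfolding cell_class_def by (smt (verit, best) Collect_cong mem_Collect_eq)

lemma cexpr_eq_cell_rep:
  assumes "cexpr_in L e" shows "cexpr_eq L e (cell_rep (cell_class L e))"
  using someI[of "\<lambda>d. d \<in> cell_class L e" e] cexpr_eq.refl[OF assms]
  by (simp add: cell_rep_def cell_class_def)

lemma adjoin_simps [simp]:
  "Cells0 (adjoin L) = Cells0 L" "Cells1 (adjoin L) = {w. zigzag_in L w}"
  "Cells2 (adjoin L) = cell_class L ` {e. cexpr_in L e}"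
  "src (adjoin L) = zsrc L" "trg (adjoin L) = ztrg L" "id1 (adjoin L) p = Base (id1 L p)"
  "id2 (adjoin L) w = cell_class L (Ident w)" "comp1 (adjoin L) = zcomp L"
  by (simp_all add: adjoin_def)

context two_category
begin

section \<open>Composition of classes of formal 2-cells\<close>

lemma cell_rep_simps:
  assumes "cexpr_in K e"
  shows "cexpr_in K (cell_rep (cell_class K e))" "esrc K (cell_rep (cell_class K e)) = esrc K e"
    "etrg K (cell_rep (cell_class K e)) = etrg K e"
  using cexpr_eq_boundary[OF cexpr_eq_cell_rep[OF assms]] by auto

lemma vsrc_adjoin [simp]: "cexpr_in K e \<Longrightarrow> vsrc (adjoin K) (cell_class K e) = esrc K e"
  and vtrg_adjoin [simp]: "cexpr_in K e \<Longrightarrow> vtrg (adjoin K) (cell_class K e) = etrg K e"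
  by (simp_all add: adjoin_def cell_rep_simps)

lemma cell_class_eqI: "cexpr_eq K e d \<Longrightarrow> cell_class K e = cell_class K d"
  using cell_class_eq_iff cexpr_eq_boundary by blast

text \<open>The operations of \<open>adjoin\<close> work on chosen representatives; the congruence
  rules of \<open>cexpr_eq\<close> make the result independent of the choice.\<close>

lemma vcomp_adjoin [simp]:
  assumes "cexpr_in K e" "cexpr_in K d" "esrc K e = etrg K d"
  shows "cell_class K e \<bullet>\<^bsub>adjoin K\<^esub> cell_class K d = cell_class K (VComp e d)"
  unfolding adjoin_def two_cat.select_convs
  by (rule cell_class_eqI, rule cexpr_eq.sym, rule cexpr_eq.VComp_cong)
    (use assms in \<open>auto intro: cexpr_eq_cell_rep\<close>)

lemma hcomp_adjoin [simp]:
  assumes "cexpr_in K e" "cexpr_in K d" "zsrc K (esrc K e) = ztrg K (esrc K d)"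
  shows "cell_class K e \<star>\<^bsub>adjoin K\<^esub> cell_class K d = cell_class K (HComp e d)"
  unfolding adjoin_def two_cat.select_convs
  by (rule cell_class_eqI, rule cexpr_eq.sym, rule cexpr_eq.HComp_cong)
    (use assms in \<open>auto intro: cexpr_eq_cell_rep\<close>)

lemmas cell_class_laws =
  cexpr_eq.VComp_assoc[THEN cell_class_eqI] cexpr_eq.HComp_assoc[THEN cell_class_eqI]
  cexpr_eq.VComp_Ident_left[THEN cell_class_eqI] cexpr_eq.VComp_Ident_right[THEN cell_class_eqI]
  cexpr_eq.HComp_Ident_left[THEN cell_class_eqI] cexpr_eq.HComp_Ident_right[THEN cell_class_eqI]
  cexpr_eq.HComp_Ident[THEN cell_class_eqI] cexpr_eq.interchange[THEN cell_class_eqI]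

text \<open>Once 2-cells are written as classes of expressions, each equation between them is a
  generating relation of the congruence.\<close>

lemma two_category_adjoin: "two_category (adjoin K)"
proof
  fix a b c assume "a \<in> Cells2 (adjoin K)" "b \<in> Cells2 (adjoin K)" "c \<in> Cells2 (adjoin K)"
    "src (adjoin K) (vsrc (adjoin K) b) = trg (adjoin K) (vsrc (adjoin K) a)"
    "src (adjoin K) (vsrc (adjoin K) c) = trg (adjoin K) (vsrc (adjoin K) b)"
  then show "(c \<star>\<^bsub>adjoin K\<^esub> b) \<star>\<^bsub>adjoin K\<^esub> a = c \<star>\<^bsub>adjoin K\<^esub> (b \<star>\<^bsub>adjoin K\<^esub> a)"
    by (auto simp: cell_class_laws)
next
  fix a b c f g h k
  assume "a \<in> hom2 (adjoin K) f g" "b \<in> hom2 (adjoin K) g h" "c \<in> hom2 (adjoin K) h k"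
  then show "(c \<bullet>\<^bsub>adjoin K\<^esub> b) \<bullet>\<^bsub>adjoin K\<^esub> a = c \<bullet>\<^bsub>adjoin K\<^esub> (b \<bullet>\<^bsub>adjoin K\<^esub> a)"
    by (auto simp: hom2_iff cell_class_laws)
next
  fix a a' b b' f f' f'' g g' g''
  assume "a \<in> hom2 (adjoin K) f f'" "a' \<in> hom2 (adjoin K) f' f''"
    "b \<in> hom2 (adjoin K) g g'" "b' \<in> hom2 (adjoin K) g' g''"
    "src (adjoin K) g = trg (adjoin K) f"
  then obtain d d' e e' where *: "cexpr_in K d" "cexpr_in K d'" "cexpr_in K e" "cexpr_in K e'"
    "a = cell_class K d" "a' = cell_class K d'" "b = cell_class K e" "b' = cell_class K e'"
    "esrc K d' = etrg K d" "esrc K e' = etrg K e" "zsrc K (esrc K e) = ztrg K (esrc K d)"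
    by (auto simp: hom2_iff)
  then have "zsrc K (esrc K e') = ztrg K (esrc K d')" by simp
  with * show "(b' \<bullet>\<^bsub>adjoin K\<^esub> b) \<star>\<^bsub>adjoin K\<^esub> (a' \<bullet>\<^bsub>adjoin K\<^esub> a) =
      (b' \<star>\<^bsub>adjoin K\<^esub> a') \<bullet>\<^bsub>adjoin K\<^esub> (b \<star>\<^bsub>adjoin K\<^esub> a)"
    by (auto simp: cell_class_laws)
next
  fix f g p q r assume "f \<in> hom1 (adjoin K) p q" "g \<in> hom1 (adjoin K) q r"
  then show "id2 (adjoin K) g \<star>\<^bsub>adjoin K\<^esub> id2 (adjoin K) f = id2 (adjoin K) (g \<odot>\<^bsub>adjoin K\<^esub> f)"
    by (auto simp: hom1_iff cell_class_laws)
next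
  fix a q assume "a \<in> Cells2 (adjoin K)" "trg (adjoin K) (vsrc (adjoin K) a) = q"
  then show "id2 (adjoin K) (id1 (adjoin K) q) \<star>\<^bsub>adjoin K\<^esub> a = a"
    by (auto simp: cell_class_laws)
next
  fix a p assume "a \<in> Cells2 (adjoin K)" "src (adjoin K) (vsrc (adjoin K) a) = p"
  then show "a \<star>\<^bsub>adjoin K\<^esub> id2 (adjoin K) (id1 (adjoin K) p) = a"
    by (auto simp: cell_class_laws)
next
  fix a f g assume "a \<in> hom2 (adjoin K) f g"
  then show "id2 (adjoin K) g \<bullet>\<^bsub>adjoin K\<^esub> a = a" "a \<bullet>\<^bsub>adjoin K\<^esub> id2 (adjoin K) f = a"
    by (auto simp: hom2_iff cell_class_laws)
next
  fix a b f f' g g' p q r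
  assume "f \<in> hom1 (adjoin K) p q" "f' \<in> hom1 (adjoin K) p q" "a \<in> hom2 (adjoin K) f f'"
    "g \<in> hom1 (adjoin K) q r" "g' \<in> hom1 (adjoin K) q r" "b \<in> hom2 (adjoin K) g g'"
  then show "b \<star>\<^bsub>adjoin K\<^esub> a \<in> hom2 (adjoin K) (g \<odot>\<^bsub>adjoin K\<^esub> f) (g' \<odot>\<^bsub>adjoin K\<^esub> f')"
    by (auto simp: hom1_iff hom2_iff)
qed (auto simp: hom1_iff hom2_iff)

end

context local_right_adjoints
begin

text \<open>The interpretation is to be a 2-functor on \<open>coop (adjoin L)\<close>, hence the
  reversed order of composition: \<open>m \<odot> n\<^sup>\<dagger> \<odot> w\<close> goes to the
  value of \<open>w\<close> after \<open>R n\<close> after \<open>act1 H m\<close>.\<close>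

primrec zmap :: "'a zigzag \<Rightarrow> 'b" where
  "zmap (Base m) = act1 H m"
| "zmap (Zig m n w) = zmap w \<odot> R n \<odot> act1 H m"

text \<open>Units and counits trade places because \<open>coop\<close> reverses 2-cells: the formal
  unit \<open>1 \<Rightarrow> m\<^sup>\<dagger> \<odot> m\<close> becomes a 2-cell
  \<open>act1 H m \<odot> R m \<Rightarrow> 1\<close>.\<close>

primrec emap :: "('a, 'c) cexpr \<Rightarrow> 'd" where
  "emap (Emb a) = act2 H a"
| "emap (Unit m) = \<epsilon> m"
| "emap (Counit m) = \<eta> m"
| "emap (Ident w) = id2 M (zmap w)"
| "emap (VComp e d) = emap d \<bullet> emap e"
| "emap (HComp e d) = emap d \<star> emap e"

lemma zmap_simps [simp]:
  assumes "zigzag_in L w"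
  shows "zmap w \<in> Cells1 M" "src M (zmap w) = act0 H (ztrg L w)" "trg M (zmap w) = act0 H (zsrc L w)"
  using assms by (induction w) auto

lemma zmap_zprefix [simp]:
  "\<lbrakk>m \<in> Cells1 L; zigzag_in L w; src L m = ztrg L w\<rbrakk>
   \<Longrightarrow> zmap (zprefix L m w) = zmap w \<odot> act1 H m"
  by (cases w) auto

lemma zmap_zcomp [simp]:
  "\<lbrakk>zigzag_in L w; zigzag_in L v; zsrc L w = ztrg L v\<rbrakk>
   \<Longrightarrow> zmap (zcomp L w v) = zmap v \<odot> zmap w"
  by (induction w) auto

lemma zmap_dagger [simp]: "m \<in> Cells1 L \<Longrightarrow> zmap (dagger L m) = R m"
  by (simp add: dagger_def)

lemma emap_simps [simp]:
  assumes "cexpr_in L e"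
  shows "emap e \<in> Cells2 M" "vsrc M (emap e) = zmap (etrg L e)" "vtrg M (emap e) = zmap (esrc L e)"
proof -
  have "emap e \<in> Cells2 M \<and> vsrc M (emap e) = zmap (etrg L e) \<and> vtrg M (emap e) = zmap (esrc L e)"
    using assms
  proof (induction e)
    case (HComp e d)
    then show ?case by (auto simp: L.cexpr_in_simps(4)[of d] L.cexpr_in_simps(3)[of e])
  qed auto
  then show "emap e \<in> Cells2 M" "vsrc M (emap e) = zmap (etrg L e)" "vtrg M (emap e) = zmap (esrc L e)"
    by auto
qed

text \<open>The structural relations are axioms of \<open>M\<close>, those for \<open>Emb\<close>
  say that \<open>H\<close> is a 2-functor, and the formal triangles become the triangle identities
  of the chosen adjunctions. As both kinds of composition are reversed, \<open>triangle_left\<close>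
  gives the identity for \<open>act1 H m\<close> and \<open>triangle_right\<close> the one for
  \<open>R m\<close>.\<close>

lemma emap_cong: "cexpr_eq L e d \<Longrightarrow> emap e = emap d"
proof (induction rule: cexpr_eq.induct)
  case (interchange e' e d' d)
  then show ?case by (auto simp: M.hcomp_vcomp)
next
  case (triangle_left m)
  then show ?case using M.adjunctionD(11)[OF adj, of m] by (auto simp: lwhisk_def rwhisk_def)
next
  case (triangle_right m)
  then show ?case using M.adjunctionD(12)[OF adj, of m] by (auto simp: lwhisk_def rwhisk_def)
qed auto

definition extension :: "('o, 'a zigzag, ('a, 'c) cexpr set, 'p, 'b, 'd) two_map" where
  "extension = \<lparr>act0 = act0 H, act1 = zmap, act2 = (\<lambda>X. emap (cell_rep X))\<rparr>"

lemma extension_simps [simp]: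
  "act0 extension = act0 H" "act1 extension = zmap"
  "cexpr_in L e \<Longrightarrow> act2 extension (cell_class L e) = emap e"
  using emap_cong[OF cexpr_eq_cell_rep] by (simp_all add: extension_def)

lemma two_functor_extension: "two_functor (coop (adjoin L)) M extension"
proof -
  interpret A: two_category "coop (adjoin L)"
    by (rule two_category_coop[OF L.two_category_adjoin])
  show ?thesis
    by unfold_locales (auto simp: hom1_iff hom2_iff)
qed

end


section \<open>Adjunctions and limits in categories\<close>

text \<open>The arrows \<open>e\<close> are terminal objects of the comma categories of
  \<open>F\<close> over the objects \<open>y\<close>. A choice of them gives the right adjoint on
  objects; its action on arrows and the unit are transposes, and every equation between arrows into
  \<open>ro y\<close> is tested after applying \<open>F\<close> and composing with
  \<open>re y\<close>, which is what \<open>uniq\<close> permits.\<close>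

lemma adjunction_Cat_of_universal_arrows:
  fixes F :: "('o, 'm, 'o, 'm) functr"
  assumes F [simp]: "is_functor F" and dom [simp]: "fdom F = A" and cod [simp]: "fcod F = B"
    and univ: "\<And>y. y \<in> Obj B \<Longrightarrow> \<exists>x e. x \<in> Obj A \<and> e \<in> hom B (fobj F x) y \<and>
      (\<forall>a\<in>Obj A. \<forall>h\<in>hom B (fobj F a) y. \<exists>!g. g \<in> hom A a x \<and> e \<cdot>\<^bsub>B\<^esub> farr F g = h)"
  shows "\<exists>R \<eta> \<epsilon>. adjunction Cat F R \<eta> \<epsilon>"
proof -
  have [simp]: "category A" "category B" using functor_dom[OF F] functor_cod[OF F] by simp_all
  obtain ro re where ro [simp]: "\<And>y. y \<in> Obj B \<Longrightarrow> ro y \<in> Obj A"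
    and re: "\<And>y. y \<in> Obj B \<Longrightarrow> re y \<in> hom B (fobj F (ro y)) y"
    and ex1: "\<And>y a h. \<lbrakk>y \<in> Obj B; a \<in> Obj A; h \<in> hom B (fobj F a) y\<rbrakk> \<Longrightarrow>
        \<exists>!g. g \<in> hom A a (ro y) \<and> re y \<cdot>\<^bsub>B\<^esub> farr F g = h"
    using univ by metis
  have re_simps [simp]: "re y \<in> Arr B" "Dom B (re y) = fobj F (ro y)" "Cod B (re y) = y"
    if "y \<in> Obj B" for y using re[OF that] by (auto simp: hom_def)
  define tr where "tr a y h = (THE g. g \<in> hom A a (ro y) \<and> re y \<cdot>\<^bsub>B\<^esub> farr F g = h)" for a y h
  have tr: "tr a y h \<in> hom A a (ro y)" "re y \<cdot>\<^bsub>B\<^esub> farr F (tr a y h) = h"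
    if "y \<in> Obj B" "a \<in> Obj A" "h \<in> Arr B" "Dom B h = fobj F a" "Cod B h = y" for a y h
    using theI'[OF ex1[of y a h]] that unfolding tr_def by (auto simp: hom_def)
  have tr_simps [simp]: "tr a y h \<in> Arr A" "Dom A (tr a y h) = a" "Cod A (tr a y h) = ro y"
    if "y \<in> Obj B" "a \<in> Obj A" "h \<in> Arr B" "Dom B h = fobj F a" "Cod B h = y" for a y h
    using tr(1)[OF that] by (auto simp: hom_def)
  have uniq: "g = g'" if "g \<in> Arr A" "g' \<in> Arr A" "Dom A g = a" "Dom A g' = a"
    "Cod A g = ro y" "Cod A g' = ro y" "a \<in> Obj A" "y \<in> Obj B"
    "re y \<cdot>\<^bsub>B\<^esub> farr F g = re y \<cdot>\<^bsub>B\<^esub> farr F g'" for g g' a y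
  proof -
    have "re y \<cdot>\<^bsub>B\<^esub> farr F g \<in> hom B (fobj F a) y" using that by (intro homI) simp_all
    from ex1[OF that(8,7) this] obtain g0 where
      "\<And>g'. g' \<in> hom A a (ro y) \<and> re y \<cdot>\<^bsub>B\<^esub> farr F g' = re y \<cdot>\<^bsub>B\<^esub> farr F g \<Longrightarrow> g' = g0" by blast
    then have "g = g0" "g' = g0" using that(1-6,9) homI by metis+
    then show ?thesis by simp
  qed
  define R where "R = \<lparr>fdom = B, fcod = A, fobj = (\<lambda>y\<in>Obj B. ro y),
    farr = (\<lambda>k\<in>Arr B. tr (ro (Dom B k)) (Cod B k) (k \<cdot>\<^bsub>B\<^esub> re (Dom B k)))\<rparr>"
  have R_simps [simp]: "fdom R = B" "fcod R = A" "\<And>y. y \<in> Obj B \<Longrightarrow> fobj R y = ro y"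
    "\<And>k. k \<in> Arr B \<Longrightarrow> farr R k = tr (ro (Dom B k)) (Cod B k) (k \<cdot>\<^bsub>B\<^esub> re (Dom B k))"
    by (simp_all add: R_def)
  have reR: "re (Cod B k) \<cdot>\<^bsub>B\<^esub> farr F (tr (ro (Dom B k)) (Cod B k) (k \<cdot>\<^bsub>B\<^esub> re (Dom B k)))
      = k \<cdot>\<^bsub>B\<^esub> re (Dom B k)" if "k \<in> Arr B" for k
    by (rule tr(2)) (use that in simp_all)
  have R [simp]: "is_functor R"
  proof (rule is_functorI[of B A])
    show "farr R (Idn B y) = Idn A (fobj R y)" if "y \<in> Obj B" for y
      by (rule uniq[of _ _ "ro y" y]) (use that reR[of "Idn B y"] in simp_all)
    fix f g assume fg: "f \<in> Arr B" "g \<in> Arr B" "Dom B g = Cod B f"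
    have "(re (Cod B g) \<cdot>\<^bsub>B\<^esub> farr F (farr R g)) \<cdot>\<^bsub>B\<^esub> farr F (farr R f) =
        g \<cdot>\<^bsub>B\<^esub> re (Cod B f) \<cdot>\<^bsub>B\<^esub> farr F (farr R f)"
      using fg reR[of g] by simp
    also have "\<dots> = g \<cdot>\<^bsub>B\<^esub> f \<cdot>\<^bsub>B\<^esub> re (Dom B f)" using fg reR[of f] by simp
    finally have eq: "re (Cod B g) \<cdot>\<^bsub>B\<^esub> farr F (farr R g \<cdot>\<^bsub>A\<^esub> farr R f) = (g \<cdot>\<^bsub>B\<^esub> f) \<cdot>\<^bsub>B\<^esub> re (Dom B f)"
      using fg by simp
    show "farr R (g \<cdot>\<^bsub>B\<^esub> f) = farr R g \<cdot>\<^bsub>A\<^esub> farr R f"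
      by (rule uniq[of _ _ "ro (Dom B f)" "Cod B g"]) (use fg eq reR[of "g \<cdot>\<^bsub>B\<^esub> f"] in simp_all)
  qed (auto simp: hom_def, auto simp: R_def)
  define \<epsilon> where "\<epsilon> = \<lparr>ndom = functor_comp F R, ncod = functor_id B, ncmp = (\<lambda>y\<in>Obj B. re y)\<rparr>"
  define \<eta> where "\<eta> = \<lparr>ndom = functor_id A, ncod = functor_comp R F,
    ncmp = (\<lambda>a\<in>Obj A. tr a (fobj F a) (Idn B (fobj F a)))\<rparr>"
  have \<epsilon>_simps [simp]: "ndom \<epsilon> = functor_comp F R" "ncod \<epsilon> = functor_id B"
      "\<And>y. y \<in> Obj B \<Longrightarrow> ncmp \<epsilon> y = re y"
    and \<eta>_simps [simp]: "ndom \<eta> = functor_id A" "ncod \<eta> = functor_comp R F"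
      "\<And>a. a \<in> Obj A \<Longrightarrow> ncmp \<eta> a = tr a (fobj F a) (Idn B (fobj F a))"
    by (simp_all add: \<epsilon>_def \<eta>_def)
  have re\<eta>: "re (fobj F a) \<cdot>\<^bsub>B\<^esub> farr F (tr a (fobj F a) (Idn B (fobj F a))) = Idn B (fobj F a)"
    if "a \<in> Obj A" for a
    by (rule tr(2)) (use that in simp_all)
  have \<epsilon> [simp]: "is_ntrans \<epsilon>"
    by (rule is_ntransI[of "functor_comp F R" "functor_id B" _ B B])
      (use reR in \<open>auto simp: hom_def\<close>, simp add: \<epsilon>_def)
  have \<eta> [simp]: "is_ntrans \<eta>"
  proof (rule is_ntransI[of "functor_id A" "functor_comp R F" _ A A])
    fix f assume f: "f \<in> Arr A"
    let ?x = "Dom A f" and ?y = "Cod A f"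
    have "re (fobj F ?y) \<cdot>\<^bsub>B\<^esub> farr F (farr R (farr F f) \<cdot>\<^bsub>A\<^esub> ncmp \<eta> ?x) =
        (re (fobj F ?y) \<cdot>\<^bsub>B\<^esub> farr F (farr R (farr F f))) \<cdot>\<^bsub>B\<^esub> farr F (ncmp \<eta> ?x)"
      using f by simp
    also have "\<dots> = farr F f \<cdot>\<^bsub>B\<^esub> re (fobj F ?x) \<cdot>\<^bsub>B\<^esub> farr F (ncmp \<eta> ?x)"
      using f reR[of "farr F f"] by simp
    also have "\<dots> = (re (fobj F ?y) \<cdot>\<^bsub>B\<^esub> farr F (ncmp \<eta> ?y)) \<cdot>\<^bsub>B\<^esub> farr F f"
      using f re\<eta>[of ?x] re\<eta>[of ?y] by simp
    also have "\<dots> = re (fobj F ?y) \<cdot>\<^bsub>B\<^esub> farr F (ncmp \<eta> ?y \<cdot>\<^bsub>A\<^esub> f)" using f by simp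
    finally have eq: "re (fobj F ?y) \<cdot>\<^bsub>B\<^esub> farr F (farr R (farr F f) \<cdot>\<^bsub>A\<^esub> ncmp \<eta> ?x) = \<dots>" .
    show "farr (functor_comp R F) f \<cdot>\<^bsub>A\<^esub> ncmp \<eta> (Dom A f) = ncmp \<eta> (Cod A f) \<cdot>\<^bsub>A\<^esub> farr (functor_id A) f"
      by (rule uniq[of _ _ ?x "fobj F ?y"]) (use f eq in simp_all)
  qed (auto simp: hom_def, simp add: \<eta>_def)
  have "ntrans_vcomp (ntrans_hcomp \<epsilon> (ntrans_id F)) (ntrans_hcomp (ntrans_id F) \<eta>) = ntrans_id F"
    by (rule ntrans_eqI) (use re\<eta> in \<open>auto simp: functor_comp_assoc\<close>)
  moreover have
    "ntrans_vcomp (ntrans_hcomp (ntrans_id R) \<epsilon>) (ntrans_hcomp \<eta> (ntrans_id R)) = ntrans_id R"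
  proof (rule ntrans_eqI)
    fix y assume "y \<in> Obj (fdom (ndom (ntrans_id R)))"
    then have y: "y \<in> Obj B" by simp
    have "re y \<cdot>\<^bsub>B\<^esub> farr F (farr R (re y) \<cdot>\<^bsub>A\<^esub> ncmp \<eta> (ro y)) =
      (re y \<cdot>\<^bsub>B\<^esub> farr F (farr R (re y))) \<cdot>\<^bsub>B\<^esub> farr F (ncmp \<eta> (ro y))" using y by simp
    also have "\<dots> = re y \<cdot>\<^bsub>B\<^esub> re (fobj F (ro y)) \<cdot>\<^bsub>B\<^esub> farr F (ncmp \<eta> (ro y))"
      using y reR[of "re y"] by simp
    also have "\<dots> = re y" using y re\<eta>[of "ro y"] by simp
    finally have eq: "re y \<cdot>\<^bsub>B\<^esub> farr F (farr R (re y) \<cdot>\<^bsub>A\<^esub> ncmp \<eta> (ro y)) = re y" .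
    have "farr R (re y) \<cdot>\<^bsub>A\<^esub> ncmp \<eta> (ro y) = Idn A (ro y)"
      by (rule uniq[of _ _ "ro y" y]) (use y eq in simp_all)
    then show "ncmp (ntrans_vcomp (ntrans_hcomp (ntrans_id R) \<epsilon>) (ntrans_hcomp \<eta> (ntrans_id R))) y =
        ncmp (ntrans_id R) y"
      using y by simp
  qed (simp_all add: functor_comp_assoc)
  ultimately have "adjunction Cat F R \<eta> \<epsilon>"
    by (simp add: adjunction_def hom1_def hom2_def lwhisk_def rwhisk_def)
  then show ?thesis by blast
qed

text \<open>Cones over a graph with edges \<open>e\<close> from \<open>s e\<close> to
  \<open>t e\<close>. There are equations for the edges only, so giving a diagram involves no
  functoriality.\<close>

definition graph_cone where
  "graph_cone C I X E s t f x l \<longleftrightarrow> x \<in> Obj C \<and> (\<forall>i\<in>I. l i \<in> hom C x (X i)) \<and>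
    (\<forall>e\<in>E. f e \<cdot>\<^bsub>C\<^esub> l (s e) = l (t e))"

definition graph_limit where
  "graph_limit C I X E s t f x l \<longleftrightarrow> graph_cone C I X E s t f x l \<and>
    (\<forall>y k. graph_cone C I X E s t f y k \<longrightarrow>
      (\<exists>!h. h \<in> hom C y x \<and> (\<forall>i\<in>I. l i \<cdot>\<^bsub>C\<^esub> h = k i)))"

text \<open>An equation for \<open>g \<cdot> f\<close> in the form in which it applies inside
  composites nested to the right.\<close>

lemma (in category) Cmp_eq_Cmp:
  "\<lbrakk>g \<cdot> f = k; h \<in> Arr C; f \<in> Arr C; g \<in> Arr C; Dom C f = Cod C h; Dom C g = Cod C f\<rbrakk>
   \<Longrightarrow> g \<cdot> f \<cdot> h = k \<cdot> h"
  by (auto simp flip: Cmp_Cmp)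

text \<open>The projections of a limit are jointly monic: composed with \<open>h\<close> they form a
  cone, through which both \<open>h\<close> and \<open>h'\<close> factor.\<close>

lemma graph_limit_unique:
  assumes lim: "graph_limit C I X E s t f x l" and C [simp]: "category C"
    and st: "\<And>e. e \<in> E \<Longrightarrow> s e \<in> I" "\<And>e. e \<in> E \<Longrightarrow> t e \<in> I"
    and f: "\<And>e. e \<in> E \<Longrightarrow> f e \<in> hom C (X (s e)) (X (t e))"
    and h: "h \<in> Arr C" "Dom C h = y" "Cod C h = x" "h' \<in> Arr C" "Dom C h' = y" "Cod C h' = x"
    and eq: "\<And>i. i \<in> I \<Longrightarrow> l i \<cdot>\<^bsub>C\<^esub> h = l i \<cdot>\<^bsub>C\<^esub> h'"
  shows "h = h'"
proof -
  have l: "l i \<in> Arr C" "Dom C (l i) = x" "Cod C (l i) = X i" if "i \<in> I" for i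
    using lim that by (auto simp: graph_limit_def graph_cone_def hom_def)
  have fl: "f e \<cdot>\<^bsub>C\<^esub> l (s e) \<cdot>\<^bsub>C\<^esub> h = l (t e) \<cdot>\<^bsub>C\<^esub> h" if "e \<in> E" for e
  proof (rule category.Cmp_eq_Cmp)
    show "f e \<cdot>\<^bsub>C\<^esub> l (s e) = l (t e)"
      using lim that by (auto simp: graph_limit_def graph_cone_def)
  qed (use l st f that h in \<open>auto simp: hom_def\<close>)
  have "graph_cone C I X E s t f y (\<lambda>i. l i \<cdot>\<^bsub>C\<^esub> h)"
    unfolding graph_cone_def
    using l fl h category.Dom_closed[OF C h(1)] by (auto simp: hom_def)
  then have "\<exists>!g. g \<in> hom C y x \<and> (\<forall>i\<in>I. l i \<cdot>\<^bsub>C\<^esub> g = l i \<cdot>\<^bsub>C\<^esub> h)"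
    using lim unfolding graph_limit_def by blast
  then obtain g where "\<And>g'. g' \<in> hom C y x \<and> (\<forall>i\<in>I. l i \<cdot>\<^bsub>C\<^esub> g' = l i \<cdot>\<^bsub>C\<^esub> h) \<Longrightarrow> g' = g"
    by blast
  then have "h = g" "h' = g" using h eq homI by metis+
  then show ?thesis by simp
qed

lemma Inl_Inr_in_Plus [simp]: "Inl x \<in> A <+> B \<longleftrightarrow> x \<in> A" "Inr y \<in> A <+> B \<longleftrightarrow> y \<in> B"
  by auto

text \<open>
  A diagram on a graph is turned into a diagram on the category with one object per node and per
  edge, where an edge \<open>e\<close> is replaced by the cospan \<open>s e \<rightarrow> e \<leftarrow> t e\<close>; no two non-identity
  arrows of that category are composable, so unlike in the free category on the graph no further
  arrows arise.  Objects are identified with their identities and everything is encoded by \<open>\<phi>\<close>.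
\<close>

locale graph_shape =
  fixes I :: "'i set" and E :: "'e set" and s t :: "'e \<Rightarrow> 'i"
    and \<phi> :: "('i + 'e) + 'e \<times> bool \<Rightarrow> 'k"
  assumes s [simp]: "e \<in> E \<Longrightarrow> s e \<in> I" and t [simp]: "e \<in> E \<Longrightarrow> t e \<in> I"
    and inj: "inj_on \<phi> ((I <+> E) <+> E \<times> UNIV)"
begin

abbreviation U where "U \<equiv> (I <+> E) <+> E \<times> (UNIV :: bool set)"

definition \<psi> where "\<psi> = inv_into U \<phi>"

lemma \<psi>\<phi> [simp]: "u \<in> U \<Longrightarrow> \<psi> (\<phi> u) = u"
  unfolding \<psi>_def by (rule inv_into_f_f[OF inj])

lemma \<phi>_eq [simp]: "u \<in> U \<Longrightarrow> v \<in> U \<Longrightarrow> \<phi> u = \<phi> v \<longleftrightarrow> u = v"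
  using inj by (auto simp: inj_on_def)

fun dm :: "('i + 'e) + 'e \<times> bool \<Rightarrow> ('i + 'e) + 'e \<times> bool" where
  "dm (Inl v) = Inl v" | "dm (Inr (e, True)) = Inl (Inl (s e))" | "dm (Inr (e, False)) = Inl (Inl (t e))"

fun cm :: "('i + 'e) + 'e \<times> bool \<Rightarrow> ('i + 'e) + 'e \<times> bool" where
  "cm (Inl v) = Inl v" | "cm (Inr (e, b)) = Inl (Inr e)"

lemma dm_U [simp]: "u \<in> U \<Longrightarrow> dm u \<in> Inl ` (I <+> E)"
  and cm_U [simp]: "u \<in> U \<Longrightarrow> cm u \<in> Inl ` (I <+> E)"
  by (cases u rule: dm.cases; auto)+

text \<open>Of two composable arrows one is always an identity, so their composite is simply the
  other one.\<close>

definition J :: "('k, 'k) cat" where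
  "J = \<lparr>Obj = \<phi> ` Inl ` (I <+> E), Arr = \<phi> ` U, Dom = \<phi> \<circ> dm \<circ> \<psi>, Cod = \<phi> \<circ> cm \<circ> \<psi>,
    Idn = (\<lambda>x. x), Cmp = (\<lambda>g f. if g \<in> \<phi> ` Inl ` (I <+> E) then f else g)\<rparr>"

lemma Arr_JE: assumes "a \<in> Arr J" obtains u where "u \<in> U" "a = \<phi> u"
  using assms unfolding J_def by (simp only: cat.select_convs) blast

lemma category_J: "category J"
proof -
  have sub: "\<phi> ` Inl ` (I <+> E) \<subseteq> \<phi> ` U" by auto
  \<comment> \<open>A leg starts at a node and ends at an edge object, so whatever can be followed
    by a leg \<open>g\<close> is the identity of a node.\<close>
  have *: "f \<in> \<phi> ` Inl ` (I <+> E) \<and> f = \<phi> (dm (\<psi> g))"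
    if that': "f \<in> \<phi> ` U" "g \<in> \<phi> ` U" "g \<notin> \<phi> ` Inl ` (I <+> E)" "\<phi> (dm (\<psi> g)) = \<phi> (cm (\<psi> f))" for f g
  proof -
    obtain u v where u: "u \<in> U" "f = \<phi> u" and v: "v \<in> U" "g = \<phi> v" using that'(1,2) by blast
    then show ?thesis using that'
      by (cases u rule: dm.cases; cases v rule: dm.cases) (auto simp: image_iff Bex_def)
  qed
  have id: "\<phi> (dm (\<psi> x)) = x" "\<phi> (cm (\<psi> x)) = x" if "x \<in> \<phi> ` Inl ` (I <+> E)" for x
    using that by auto
  show ?thesis
  proof
    fix f x y assume "f \<in> hom J x y"
    then show "f \<cdot>\<^bsub>J\<^esub> Idn J x = f" "Idn J y \<cdot>\<^bsub>J\<^esub> f = f"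
      using id by (auto simp: J_def hom_def)
  next
    fix f g x y z assume "f \<in> hom J x y" "g \<in> hom J y z"
    then show "g \<cdot>\<^bsub>J\<^esub> f \<in> hom J x z"
      using *[of f g] id by (auto simp: J_def hom_def)
  qed (use sub id in \<open>auto simp: J_def hom_def\<close>)
qed

text \<open>The object of an edge \<open>e\<close> receives the value at \<open>t e\<close>. The leg
  from \<open>t e\<close> then carries an identity and equates two components of a cone, while the
  leg from \<open>s e\<close> carries \<open>f e\<close> and imposes the equation of the
  edge.\<close>

fun vob where "vob X (Inl i) = X i" | "vob X (Inr e) = X (t e)"

fun var where "var C X f (Inl v) = Idn C (vob X v)" | "var C X f (Inr (e, True)) = f e"
| "var C X f (Inr (e, False)) = Idn C (X (t e))"

definition diagram :: "('o, 'm) cat \<Rightarrow> ('i \<Rightarrow> 'o) \<Rightarrow> ('e \<Rightarrow> 'm) \<Rightarrow> ('k, 'k, 'o, 'm) functr" where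
  "diagram C X f = \<lparr>fdom = J, fcod = C, fobj = (\<lambda>x\<in>Obj J. vob X (projl (\<psi> x))),
     farr = (\<lambda>a\<in>Arr J. var C X f (\<psi> a))\<rparr>"

context
  fixes C :: "('o, 'm) cat" and X f
  assumes C [simp]: "category C" and X [simp]: "\<And>i. i \<in> I \<Longrightarrow> X i \<in> Obj C"
    and f: "\<And>e. e \<in> E \<Longrightarrow> f e \<in> hom C (X (s e)) (X (t e))"
begin

lemma is_functor_diagram: "is_functor (diagram C X f)"
proof (rule is_functorI[of J C])
  fix a assume "a \<in> Arr J"
  then obtain u where u: "u \<in> U" "a = \<phi> u" by (rule Arr_JE)
  then show "farr (diagram C X f) a \<in>
      hom C (fobj (diagram C X f) (Dom J a)) (fobj (diagram C X f) (Cod J a))"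
    using f by (cases u rule: dm.cases) (auto simp: diagram_def J_def hom_def)
next
  fix a b assume ab: "a \<in> Arr J" "b \<in> Arr J" and ba: "Dom J b = Cod J a"
  obtain u v where u: "u \<in> U" "a = \<phi> u" "v \<in> U" "b = \<phi> v"
    using Arr_JE[OF ab(1)] Arr_JE[OF ab(2)] by metis
  then show "farr (diagram C X f) (b \<cdot>\<^bsub>J\<^esub> a) = farr (diagram C X f) b \<cdot>\<^bsub>C\<^esub> farr (diagram C X f) a"
    using f ba
    by (cases u rule: dm.cases; cases v rule: dm.cases) (auto simp: diagram_def J_def hom_def image_iff)
qed (use category_J in \<open>auto simp: diagram_def\<close>, auto simp: J_def)

lemma cone_diagramI:
  assumes "graph_cone C I X E s t f x l"
  shows "is_cone (diagram C X f) x (\<lambda>j. vob l (projl (\<psi> j)))"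
  unfolding is_cone_def
proof (intro conjI ballI)
  show "x \<in> Obj (fcod (diagram C X f))" using assms by (simp add: graph_cone_def diagram_def)
  fix j assume "j \<in> Obj (fdom (diagram C X f))"
  then obtain v where "v \<in> I <+> E" "j = \<phi> (Inl v)" by (auto simp: J_def diagram_def)
  then show "vob l (projl (\<psi> j)) \<in> hom (fcod (diagram C X f)) x (fobj (diagram C X f) j)"
    using assms by (cases v) (auto simp: diagram_def J_def graph_cone_def)
next
  fix a assume "a \<in> Arr (fdom (diagram C X f))"
  then have "a \<in> Arr J" by (simp add: diagram_def)
  then obtain u where u: "u \<in> U" "a = \<phi> u" by (rule Arr_JE)
  have l: "l i \<in> Arr C" "Dom C (l i) = x" "Cod C (l i) = X i" if "i \<in> I" for i
    using assms that by (auto simp: graph_cone_def hom_def)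
  show "farr (diagram C X f) a \<cdot>\<^bsub>fcod (diagram C X f)\<^esub>
      vob l (projl (\<psi> (Dom (fdom (diagram C X f)) a))) =
    vob l (projl (\<psi> (Cod (fdom (diagram C X f)) a)))"
    using u assms l by (cases u rule: dm.cases) (auto simp: diagram_def J_def graph_cone_def)
qed

text \<open>The component at an edge object is forced by the identity on the leg from
  \<open>t e\<close>; a cone on \<open>J\<close> thus carries the same information as a cone on the
  graph.\<close>

lemma cone_diagramD:
  assumes "is_cone (diagram C X f) x l"
  shows "graph_cone C I X E s t f x (\<lambda>i. l (\<phi> (Inl (Inl i))))"
    and "e \<in> E \<Longrightarrow> l (\<phi> (Inl (Inr e))) = l (\<phi> (Inl (Inl (t e))))"
proof -
  have l: "l (\<phi> (Inl v)) \<in> hom C x (vob X v)" if "v \<in> I <+> E" for v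
    using assms that by (auto simp: is_cone_def diagram_def J_def)
  have eq: "farr (diagram C X f) (\<phi> u) \<cdot>\<^bsub>C\<^esub> l (Dom J (\<phi> u)) = l (Cod J (\<phi> u))" if "u \<in> U" for u
    using assms that by (auto simp: is_cone_def diagram_def J_def)
  have e: "l (\<phi> (Inl (Inr e))) = l (\<phi> (Inl (Inl (t e))))" if "e \<in> E" for e
    using eq[of "Inr (e, False)"] l[of "Inl (t e)"] that by (auto simp: diagram_def J_def hom_def)
  then show "e \<in> E \<Longrightarrow> l (\<phi> (Inl (Inr e))) = l (\<phi> (Inl (Inl (t e))))" .
  show "graph_cone C I X E s t f x (\<lambda>i. l (\<phi> (Inl (Inl i))))"
    unfolding graph_cone_def
  proof (intro conjI ballI)
    show "x \<in> Obj C" using assms by (simp add: is_cone_def diagram_def)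
    show "l (\<phi> (Inl (Inl i))) \<in> hom C x (X i)" if "i \<in> I" for i using l[of "Inl i"] that by auto
    show "f e \<cdot>\<^bsub>C\<^esub> l (\<phi> (Inl (Inl (s e)))) = l (\<phi> (Inl (Inl (t e))))" if "e \<in> E" for e
      using eq[of "Inr (e, True)"] e[OF that] that by (auto simp: diagram_def J_def)
  qed
qed

lemma graph_limit_of_limit:
  assumes "is_limit (diagram C X f) x l"
  shows "graph_limit C I X E s t f x (\<lambda>i. l (\<phi> (Inl (Inl i))))"
  unfolding graph_limit_def
proof (intro conjI allI impI)
  have cone: "is_cone (diagram C X f) x l" using assms by (simp add: is_limit_def)
  note cD = cone_diagramD[OF cone]
  show "graph_cone C I X E s t f x (\<lambda>i. l (\<phi> (Inl (Inl i))))" by (rule cD)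
  fix y k assume k: "graph_cone C I X E s t f y k"
  \<comment> \<open>The conditions at edge objects repeat those at their targets, so the two unique
    factorisations concern the same arrows \<open>h\<close>.\<close>
  have iff: "(\<forall>j\<in>Obj J. l j \<cdot>\<^bsub>C\<^esub> h = vob k (projl (\<psi> j))) \<longleftrightarrow>
      (\<forall>i\<in>I. l (\<phi> (Inl (Inl i))) \<cdot>\<^bsub>C\<^esub> h = k i)" for h
    using cD(2) by (auto simp: J_def)
  show "\<exists>!h. h \<in> hom C y x \<and> (\<forall>i\<in>I. l (\<phi> (Inl (Inl i))) \<cdot>\<^bsub>C\<^esub> h = k i)"
    using assms cone_diagramI[OF k] unfolding is_limit_def iff[symmetric]
    by (auto simp: diagram_def)
qed

end

text \<open>Preservation of limits speaks of the composite of \<open>F\<close> with a diagram; this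
  rewrites the composite as the diagram of the image graph, so that
  \<open>graph_limit_of_limit\<close> applies to it.\<close>

lemma functor_comp_diagram:
  assumes F [simp]: "is_functor F" "fdom F = C" and [simp]: "category C" "\<And>i. i \<in> I \<Longrightarrow> X i \<in> Obj C"
    and "\<And>e. e \<in> E \<Longrightarrow> f e \<in> hom C (X (s e)) (X (t e))"
  shows "functor_comp F (diagram C X f) = diagram (fcod F) (\<lambda>i. fobj F (X i)) (\<lambda>e. farr F (f e))"
proof (rule functor_eqI)
  have [simp]: "category (fcod F)" using functor_cod[OF F(1)] .
  note D = is_functor_diagram[of C X f, OF assms(3,4,5)]
  show "is_functor (functor_comp F (diagram C X f))"
  proof (rule functor_comp_functor[OF D F(1)])
    show "fcod (diagram C X f) = fdom F" unfolding diagram_def F(2) by simp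
  qed
  show "is_functor (diagram (fcod F) (\<lambda>i. fobj F (X i)) (\<lambda>e. farr F (f e)))"
    by (rule is_functor_diagram) (use assms in \<open>auto simp: hom_def\<close>)
  fix a assume "a \<in> Arr (fdom (diagram (fcod F) (\<lambda>i. fobj F (X i)) (\<lambda>e. farr F (f e))))"
  then have "a \<in> Arr J" by (simp add: diagram_def)
  then obtain u where u: "u \<in> U" "a = \<phi> u" by (rule Arr_JE)
  then have "farr (functor_comp F (diagram C X f)) a = farr F (var C X f u)"
    by (auto simp: functor_comp_def compose_def diagram_def J_def)
  also have "\<dots> = var (fcod F) (\<lambda>i. fobj F (X i)) (\<lambda>e. farr F (f e)) u"
    using u(1) by (cases "(C, X, f, u)" rule: var.cases) (auto elim!: PlusE)
  finally show "farr (functor_comp F (diagram C X f)) a =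
      farr (diagram (fcod F) (\<lambda>i. fobj F (X i)) (\<lambda>e. farr F (f e))) a"
    using u by (auto simp: diagram_def J_def)
qed (auto simp: diagram_def functor_comp_def compose_def J_def)

end

text \<open>The product is compared with the sum, which avoids asking which factor is larger: an
  infinite \<open>A <+> B\<close> dominates \<open>A \<times> B\<close>, and a finite one leaves the
  product finite.\<close>

lemma card_of_Times_ordLess_Cinfinite:
  assumes r: "Cinfinite r" and A: "|A| <o r" and B: "|B| <o r"
  shows "|A \<times> B| <o r"
proof -
  have fin: "\<not> finite (Field r)" "Card_order r" using r by (auto simp: cinfinite_def)
  have D: "|A <+> B| <o r" by (rule card_of_Plus_ordLess_infinite_Field[OF fin A B])
  show ?thesis
  proof (cases "finite (A <+> B)")
    case True
    then have "finite (A \<times> B)" by (simp add: finite_Plus_iff)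
    then show ?thesis
      using finite_iff_ordLess_natLeq natLeq_ordLeq_cinfinite[OF r] ordLess_ordLeq_trans by blast
  next
    case False
    have "|A \<times> B| \<le>o |A <+> B|"
      by (rule card_of_Times_ordLeq_infinite_Field)
        (use False card_of_Plus1 card_of_Plus2 card_of_Card_order in \<open>auto simp: Field_card_of\<close>)
    then show ?thesis using D ordLeq_ordLess_trans by blast
  qed
qed

text \<open>One cone serves for existence and for preservation by every \<open>F\<close>, because
  later a single limit object has to be compared with all of its images.\<close>

lemma ex_graph_limit:
  fixes k :: "'k rel" and C :: "('o, 'm) cat" and I :: "'i set" and E :: "'e set"
  assumes k: "Cinfinite k" and I: "|I| <o k" and E: "|E| <o k"
    and C: "category C" "has_small_limits k C"
    and X: "\<And>i. i \<in> I \<Longrightarrow> X i \<in> Obj C"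
    and st: "\<And>e. e \<in> E \<Longrightarrow> s e \<in> I" "\<And>e. e \<in> E \<Longrightarrow> t e \<in> I"
    and f: "\<And>e. e \<in> E \<Longrightarrow> f e \<in> hom C (X (s e)) (X (t e))"
  obtains x l where "graph_limit C I X E s t f x l"
    and "\<And>F :: ('o, 'm, 'p, 'n) functr. \<lbrakk>is_functor F; fdom F = C; preserves_small_limits k F\<rbrakk> \<Longrightarrow>
      graph_limit (fcod F) I (\<lambda>i. fobj F (X i)) E s t (\<lambda>e. farr F (f e)) (fobj F x) (\<lambda>i. farr F (l i))"
proof -
  have fin: "\<not> finite (Field k)" "Card_order k" using k by (auto simp: cinfinite_def)
  let ?U = "(I <+> E) <+> E \<times> (UNIV :: bool set)"
  have bool: "|UNIV :: bool set| <o k"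
    using finite_iff_ordLess_natLeq[of "UNIV :: bool set"] natLeq_ordLeq_cinfinite[OF k]
      ordLess_ordLeq_trans by auto
  have IE: "|I <+> E| <o k" by (rule card_of_Plus_ordLess_infinite_Field[OF fin I E])
  have U: "|?U| <o k"
    by (rule card_of_Plus_ordLess_infinite_Field[OF fin IE card_of_Times_ordLess_Cinfinite[OF k E bool]])
  \<comment> \<open>The shape has fewer than \<open>k\<close> arrows and so can be encoded
    injectively in the element type of \<open>k\<close>, where \<open>has_small_limits\<close>
    expects its diagrams.\<close>
  have "|?U| \<le>o |UNIV :: 'k set|"
    by (rule ordLeq_transitive[OF ordLeq_ordIso_trans[OF ordLess_imp_ordLeq[OF U]
            ordIso_symmetric[OF card_of_Field_ordIso[OF fin(2)]]] card_of_mono1[OF subset_UNIV]])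
  then obtain \<phi> :: "('i + 'e) + 'e \<times> bool \<Rightarrow> 'k" where "inj_on \<phi> ?U"
    using card_of_ordLeq[of ?U "UNIV :: 'k set"] by auto
  then interpret graph_shape I E s t \<phi> using st by unfold_locales auto
  have small: "small_diagram k (diagram C X f)"
    unfolding small_diagram_def
  proof (intro conjI)
    show "is_functor (diagram C X f)" by (rule is_functor_diagram) (use C X f in auto)
    have "|\<phi> ` Inl ` (I <+> E)| \<le>o |I <+> E|" by (metis card_of_image image_image)
    then show "|Obj (fdom (diagram C X f))| <o k"
      using ordLeq_ordLess_trans[OF _ IE] by (simp add: diagram_def J_def)
    show "|Arr (fdom (diagram C X f))| <o k"
      using ordLeq_ordLess_trans[OF card_of_image[of \<phi> ?U] U] by (simp add: diagram_def J_def)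
  qed
  moreover have "fcod (diagram C X f) = C" by (simp add: diagram_def)
  ultimately obtain x l where lim: "is_limit (diagram C X f) x l"
    using C(2) unfolding has_small_limits_def by blast
  show ?thesis
  proof (rule that)
    show "graph_limit C I X E s t f x (\<lambda>i. l (\<phi> (Inl (Inl i))))"
      by (rule graph_limit_of_limit) (use C X f lim in auto)
    fix F :: "('o, 'm, 'p, 'n) functr"
    assume F: "is_functor F" "fdom F = C" "preserves_small_limits k F"
    then have "is_limit (functor_comp F (diagram C X f)) (fobj F x) (\<lambda>j. farr F (l j))"
      using small lim \<open>fcod (diagram C X f) = C\<close> unfolding preserves_small_limits_def by blast
    then have lim': "is_limit (diagram (fcod F) (\<lambda>i. fobj F (X i)) (\<lambda>e. farr F (f e))) (fobj F x)
        (\<lambda>j. farr F (l j))"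
      using functor_comp_diagram[of F C X f] F C X f by simp
    show "graph_limit (fcod F) I (\<lambda>i. fobj F (X i)) E s t (\<lambda>e. farr F (f e)) (fobj F x)
        (\<lambda>i. farr F (l (\<phi> (Inl (Inl i)))))"
      by (rule graph_limit_of_limit[OF _ _ _ lim'])
        (use functor_cod[OF F(1)] F X f in \<open>auto simp: hom_def\<close>)
  qed
qed


section \<open>Pseudofunctors into categories\<close>

lemma (in category) inverse_arr_simps:
  assumes f: "f \<in> Arr C" and g: "g \<in> Arr C" "Dom C g = Cod C f" "Cod C g = Dom C f"
    "g \<cdot> f = Idn C (Dom C f)" "f \<cdot> g = Idn C (Cod C f)"
  shows "inverse_arr C f = g"
  unfolding inverse_arr_def
proof (rule the_equality)
  show "g \<in> hom C (Cod C f) (Dom C f) \<and> g \<cdot> f = Idn C (Dom C f) \<and> f \<cdot> g = Idn C (Cod C f)"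
    using g by (simp add: hom_def)
  fix h assume "h \<in> hom C (Cod C f) (Dom C f) \<and> h \<cdot> f = Idn C (Dom C f) \<and> f \<cdot> h = Idn C (Cod C f)"
  then have h: "h \<in> Arr C" "Dom C h = Cod C f" "Cod C h = Dom C f" "h \<cdot> f = Idn C (Dom C f)"
    by (simp_all add: hom_def)
  have "h = h \<cdot> f \<cdot> g" using h g(5) Cmp_Idn by simp
  also have "\<dots> = (h \<cdot> f) \<cdot> g" by (rule Cmp_Cmp[symmetric]) (use h f g in simp_all)
  finally show "h = g" using g(1-3) h(4) Idn_Cmp by simp
qed

text \<open>Breaks the inverse of a 2-cell of \<open>Cat\<close> into inverses of single components,
  the form in which the unit and comparison isomorphisms of \<open>C\<close> are used.\<close>

lemma invertible2_Cat_component: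
  assumes "invertible2 Cat a" and x: "x \<in> Obj (fdom (ndom a))" and D: "fcod (ndom a) = D"
  obtains g where "g \<in> Arr D" "Dom D g = fobj (ncod a) x" "Cod D g = fobj (ndom a) x"
    "g \<cdot>\<^bsub>D\<^esub> ncmp a x = Idn D (fobj (ndom a) x)" "ncmp a x \<cdot>\<^bsub>D\<^esub> g = Idn D (fobj (ncod a) x)"
proof -
  obtain b where b: "is_ntrans a" "is_ntrans b" "ndom b = ncod a" "ncod b = ndom a"
    "ntrans_vcomp b a = ntrans_id (ndom a)" "ntrans_vcomp a b = ntrans_id (ncod a)"
    using assms by (auto simp: invertible2_def hom2_def)
  have [simp]: "fdom (ncod a) = fdom (ndom a)" "fcod (ncod a) = D"
    using ntrans_fdom ntrans_fcod b(1) D by auto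
  have "ncmp b x \<cdot>\<^bsub>D\<^esub> ncmp a x = ncmp (ntrans_vcomp b a) x"
    "ncmp a x \<cdot>\<^bsub>D\<^esub> ncmp b x = ncmp (ntrans_vcomp a b) x"
    using b(1-4) x D by simp_all
  then show ?thesis
    by (intro that[of "ncmp b x"]) (use b x D in simp_all)
qed

locale cat_pseudofunctor =
  fixes L :: "('o, 'a, 'c) two_cat" (structure) and C :: "('o, 'a, 'c, 'x, 'y) cat_valued"
  assumes pseudofunctor_C: "pseudofunctor L Cat C"
begin

sublocale L: two_category L
  using pseudofunctor_C by (simp add: pseudofunctor_def)

interpretation C: pseudofunctor L Cat C by (rule pseudofunctor_C)

abbreviation "CC \<equiv> act0 C"
abbreviation CC_comp :: "'y \<Rightarrow> 'o \<Rightarrow> 'y \<Rightarrow> 'y"  (\<open>_ \<cdot>[_] _\<close> [71, 0, 70] 70) where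
  "g \<cdot>[p] f \<equiv> g \<cdot>\<^bsub>CC p\<^esub> f"
abbreviation "T m \<equiv> fobj (act1 C m)"
abbreviation "TA m \<equiv> farr (act1 C m)"
abbreviation "TT a \<equiv> ncmp (act2 C a)"
abbreviation "PC g f \<equiv> ncmp (pcomp C g f)"
abbreviation "U p \<equiv> ncmp (punit C p)"

text \<open>The same inverse as in \<open>hat_nat\<close>, named so that the components there can be
  calculated with.\<close>

definition V where "V p x = inverse_arr (CC p) (U p x)"

lemma category_CC [simp]: "p \<in> Cells0 L \<Longrightarrow> category (CC p)"
  using C.act0_closed by simp

lemma act1_C [simp]:
  assumes "m \<in> Cells1 L"
  shows "is_functor (act1 C m)" "fdom (act1 C m) = CC (src L m)" "fcod (act1 C m) = CC (trg L m)"
  using C.act1_hom1[of m "src L m" "trg L m"] assms by (auto simp: hom1_iff)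

lemma act2_C [simp]:
  assumes "a \<in> Cells2 L"
  shows "is_ntrans (act2 C a)" "ndom (act2 C a) = act1 C (vsrc L a)"
    "ncod (act2 C a) = act1 C (vtrg L a)"
  using C.act2_hom2[of a "vsrc L a" "vtrg L a"] assms by (auto simp: hom2_iff)

lemma pcomp_C [simp]:
  assumes "f \<in> Cells1 L" "g \<in> Cells1 L" "src L g = trg L f"
  shows "is_ntrans (pcomp C g f)" "ndom (pcomp C g f) = functor_comp (act1 C g) (act1 C f)"
    "ncod (pcomp C g f) = act1 C (g \<odot> f)"
  using C.pcomp_hom2[of f "src L f" "trg L f" g "trg L g"] assms by (auto simp: hom2_iff hom1_iff)

lemma punit_C [simp]:
  assumes "p \<in> Cells0 L"
  shows "is_ntrans (punit C p)" "ndom (punit C p) = functor_id (CC p)"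
    "ncod (punit C p) = act1 C (id1 L p)"
  using C.punit_hom2[of p] assms by (auto simp: hom2_iff)

section \<open>The laws of the pseudofunctor in components\<close>

lemma TT_id2 [simp]:
  "\<lbrakk>m \<in> Cells1 L; x \<in> Obj (CC (src L m))\<rbrakk> \<Longrightarrow> TT (id2 L m) x = Idn (CC (trg L m)) (T m x)"
  using C.act2_id2[of m] by simp

lemma TT_natural:
  assumes "a \<in> Cells2 L" "vsrc L a = m" "vtrg L a = m'" "src L m = p" "trg L m = q"
    "k \<in> Arr (CC p)" "Dom (CC p) k = x" "Cod (CC p) k = y"
  shows "TA m' k \<cdot>[q] TT a x = TT a y \<cdot>[q] TA m k"
  using assms L.vsrc_closed[of a] by (intro ncmp_natural[where C = "CC p"]) auto

lemma PC_natural: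
  assumes "f \<in> Cells1 L" "g \<in> Cells1 L" "src L g = trg L f" "src L f = p" "trg L g = q"
    "k \<in> Arr (CC p)" "Dom (CC p) k = x" "Cod (CC p) k = y"
  shows "TA (g \<odot> f) k \<cdot>[q] PC g f x = PC g f y \<cdot>[q] TA g (TA f k)"
  using ncmp_natural[of "pcomp C g f" "functor_comp (act1 C g) (act1 C f)" "act1 C (g \<odot> f)"
      "CC p" "CC q" k x y] assms by simp

lemma U_natural:
  assumes "p \<in> Cells0 L" "k \<in> Arr (CC p)" "Dom (CC p) k = x" "Cod (CC p) k = y"
  shows "TA (id1 L p) k \<cdot>[p] U p x = U p y \<cdot>[p] k"
  using ncmp_natural[of "punit C p" "functor_id (CC p)" "act1 C (id1 L p)" "CC p" "CC p" k x y] assms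
  by simp

lemma V_simps [simp]:
  assumes "p \<in> Cells0 L" "x \<in> Obj (CC p)"
  shows "V p x \<in> Arr (CC p)" "Dom (CC p) (V p x) = T (id1 L p) x" "Cod (CC p) (V p x) = x"
    "V p x \<cdot>[p] U p x = Idn (CC p) x" "U p x \<cdot>[p] V p x = Idn (CC p) (T (id1 L p) x)"
proof -
  obtain g where g: "g \<in> Arr (CC p)" "Dom (CC p) g = T (id1 L p) x" "Cod (CC p) g = x"
      "g \<cdot>[p] U p x = Idn (CC p) x" "U p x \<cdot>[p] g = Idn (CC p) (T (id1 L p) x)"
    using invertible2_Cat_component[OF C.punit_invertible[OF assms(1)], of x "CC p"] assms by auto
  have "V p x = g"
    unfolding V_def
    by (rule category.inverse_arr_simps) (use g assms in simp_all)
  with g show "V p x \<in> Arr (CC p)" "Dom (CC p) (V p x) = T (id1 L p) x" "Cod (CC p) (V p x) = x"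
    "V p x \<cdot>[p] U p x = Idn (CC p) x" "U p x \<cdot>[p] V p x = Idn (CC p) (T (id1 L p) x)"
    by auto
qed

lemma PC_invertible:
  assumes "f \<in> Cells1 L" "g \<in> Cells1 L" "src L g = trg L f" "src L f = p" "trg L g = q" "x \<in> Obj (CC p)"
  obtains h where "h \<in> Arr (CC q)" "Dom (CC q) h = T (g \<odot> f) x" "Cod (CC q) h = T g (T f x)"
    "h \<cdot>[q] PC g f x = Idn (CC q) (T g (T f x))"
    "PC g f x \<cdot>[q] h = Idn (CC q) (T (g \<odot> f) x)"
  using invertible2_Cat_component[OF C.pcomp_invertible[of f p "trg L f" g q], of x "CC q"] assms
  by (auto simp: hom1_iff)

lemma PC_hcomp:
  assumes "a \<in> Cells2 L" "b \<in> Cells2 L" "vsrc L a = f" "vtrg L a = f'" "vsrc L b = g" "vtrg L b = g'"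
    "src L g = trg L f" "src L f = p" "trg L g = q" "x \<in> Obj (CC p)"
  shows "TT (b \<star> a) x \<cdot>[q] PC g f x =
    PC g' f' x \<cdot>[q] TT b (T f' x) \<cdot>[q] TA g (TT a x)"
proof -
  have st: "f \<in> Cells1 L" "f' \<in> Cells1 L" "g \<in> Cells1 L" "g' \<in> Cells1 L" "src L f' = src L f"
    "trg L f' = trg L f" "src L g' = src L g" "trg L g' = trg L g"
    using assms L.vsrc_closed L.vtrg_closed L.src_vsrc L.trg_vsrc by metis+
  then show ?thesis
    using arg_cong[OF C.pcomp_natural[of a f f' b g g'], of "\<lambda>t. ncmp t x"] assms
    by (simp add: hom2_iff)
qed

lemma PC_rwhisk:
  assumes "b \<in> Cells2 L" "f \<in> Cells1 L" "vsrc L b = g" "vtrg L b = g'"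
    "src L g = trg L f" "src L f = p" "trg L g = q" "x \<in> Obj (CC p)"
  shows "TT (b \<rhd> f) x \<cdot>[q] PC g f x = PC g' f x \<cdot>[q] TT b (T f x)"
proof -
  have st: "g \<in> Cells1 L" "g' \<in> Cells1 L" "src L g' = src L g" "trg L g' = trg L g"
    using assms L.vsrc_closed L.vtrg_closed L.src_vsrc L.trg_vsrc by metis+
  then show ?thesis
    using PC_hcomp[of "id2 L f" b f f g g' p q x] assms L.src_closed[of f] L.trg_closed[of g] by (simp add: rwhisk_def)
qed

lemma PC_lwhisk:
  assumes "a \<in> Cells2 L" "g \<in> Cells1 L" "vsrc L a = f" "vtrg L a = f'"
    "src L g = trg L f" "src L f = p" "trg L g = q" "x \<in> Obj (CC p)"
  shows "TT (g \<lhd> a) x \<cdot>[q] PC g f x = PC g f' x \<cdot>[q] TA g (TT a x)"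
proof -
  have st: "f \<in> Cells1 L" "f' \<in> Cells1 L" "src L f' = src L f" "trg L f' = trg L f"
    using assms L.vsrc_closed L.vtrg_closed L.src_vsrc L.trg_vsrc by metis+
  then show ?thesis
    using PC_hcomp[of a "id2 L g" f f' g g p q x] assms L.src_closed[of f] L.trg_closed[of g] by (simp add: lwhisk_def)
qed

lemma PC_assoc:
  assumes "f \<in> Cells1 L" "g \<in> Cells1 L" "h \<in> Cells1 L" "src L g = trg L f" "src L h = trg L g"
    "src L f = p" "trg L h = q" "x \<in> Obj (CC p)"
  shows "PC h (g \<odot> f) x \<cdot>[q] TA h (PC g f x) = PC (h \<odot> g) f x \<cdot>[q] PC h g (T f x)"
  using arg_cong[OF C.pcomp_assoc[of f p "src L g" g "src L h" h q], of "\<lambda>t. ncmp t x"] assms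
    L.src_closed[of f] L.trg_closed[of h]
  by (simp add: hom1_iff lwhisk_def rwhisk_def)

lemma PC_id1_left:
  assumes "f \<in> Cells1 L" "src L f = p" "trg L f = q" "x \<in> Obj (CC p)"
  shows "PC (id1 L q) f x \<cdot>[q] U q (T f x) = Idn (CC q) (T f x)"
  using arg_cong[OF C.pcomp_punit_left[of f p q], of "\<lambda>t. ncmp t x"] assms L.trg_closed[of f]
  by (simp add: hom1_iff rwhisk_def)

lemma PC_id1_right:
  assumes "f \<in> Cells1 L" "src L f = p" "trg L f = q" "x \<in> Obj (CC p)"
  shows "PC f (id1 L p) x \<cdot>[q] TA f (U p x) = Idn (CC q) (T f x)"
  using arg_cong[OF C.pcomp_punit_right[of f p q], of "\<lambda>t. ncmp t x"] assms L.src_closed[of f]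
    L.trg_closed[of f]
  by (simp add: hom1_iff lwhisk_def)

end


section \<open>The 2-functor underlying the co-dextrification\<close>

lemma Cells_hat_cat [simp]:
  "G \<in> Obj (hat_cat L C r) \<longleftrightarrow> is_hat_obj L C r G" "\<theta> \<in> Arr (hat_cat L C r) \<longleftrightarrow> is_hat_arr L C r \<theta>"
  "Dom (hat_cat L C r) = hsrc" "Cod (hat_cat L C r) = htrg"
  by (simp_all add: hat_cat_def)

lemma Idn_hat_cat [simp]:
  "hsrc (Idn (hat_cat L C r) G) = G" "htrg (Idn (hat_cat L C r) G) = G"
  "m \<in> into L r \<Longrightarrow> hcmp (Idn (hat_cat L C r) G) m = Idn (act0 C (src L m)) (hob G m)"
  by (simp_all add: hat_cat_def)

lemma Cmp_hat_cat [simp]: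
  "hsrc (\<theta> \<cdot>\<^bsub>hat_cat L C r\<^esub> \<zeta>) = hsrc \<zeta>" "htrg (\<theta> \<cdot>\<^bsub>hat_cat L C r\<^esub> \<zeta>) = htrg \<theta>"
  "m \<in> into L r \<Longrightarrow> hcmp (\<theta> \<cdot>\<^bsub>hat_cat L C r\<^esub> \<zeta>) m = hcmp \<theta> m \<cdot>\<^bsub>act0 C (src L m)\<^esub> hcmp \<zeta> m"
  by (simp_all add: hat_cat_def)

lemma into_iff [simp]: "m \<in> into L r \<longleftrightarrow> m \<in> Cells1 L \<and> trg L m = r"
  by (auto simp: into_def)

lemma decomps_iff [simp]:
  "(a, n, s) \<in> decomps L r \<longleftrightarrow> a \<in> Cells2 L \<and> n \<in> Cells1 L \<and> trg L n = r \<and> s \<in> Cells1 L \<and>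
    trg L s = src L n \<and> vtrg L a = n \<odot>\<^bsub>L\<^esub> s"
  by (auto simp: decomps_def)

lemma hat_arr_eqI:
  assumes "is_hat_arr L C r \<theta>" "is_hat_arr L C r \<zeta>" "hsrc \<theta> = hsrc \<zeta>" "htrg \<theta> = htrg \<zeta>"
    and "\<And>m. m \<in> Cells1 L \<Longrightarrow> trg L m = r \<Longrightarrow> hcmp \<theta> m = hcmp \<zeta> m"
  shows "\<theta> = \<zeta>"
proof (rule hat_arr.equality)
  show "hcmp \<theta> = hcmp \<zeta>"
    by (rule extensionalityI[of _ "into L r"]) (use assms in \<open>auto simp: is_hat_arr_def\<close>)
qed (use assms in auto)

lemma hat_obj_eqI:
  assumes "is_hat_obj L C r G" "is_hat_obj L C r D"
    and "\<And>m. m \<in> Cells1 L \<Longrightarrow> trg L m = r \<Longrightarrow> hob G m = hob D m"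
    and "\<And>a n s. (a, n, s) \<in> decomps L r \<Longrightarrow> hmor G (a, n, s) = hmor D (a, n, s)"
  shows "G = D"
proof (rule hat_obj.equality)
  show "hob G = hob D"
    by (rule extensionalityI[of _ "into L r"]) (use assms in \<open>auto simp: is_hat_obj_def\<close>)
  show "hmor G = hmor D"
    by (rule extensionalityI[of _ "decomps L r"])
      (use assms(1,2,4) in \<open>auto simp: is_hat_obj_def simp del: decomps_iff\<close>)
qed auto

context cat_pseudofunctor
begin

text \<open>By the right unit law \<open>PC f 1\<close> is a one-sided inverse of the isomorphism
  \<open>TA f (U p x)\<close>, whose inverse is also \<open>TA f (V p x)\<close>. With its left
  counterpart \<open>V_T\<close> this turns inverse units into comparison arrows, which the
  composition axiom of an object can absorb.\<close>

lemma TA_V: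
  assumes "f \<in> Cells1 L" "src L f = p" "trg L f = q" "x \<in> Obj (CC p)"
  shows "TA f (V p x) = PC f (id1 L p) x"
proof -
  note [simp] = assms
  have [simp]: "p \<in> Cells0 L" "q \<in> Cells0 L" using assms L.src_closed[of f] L.trg_closed[of f] by auto
  have "TA f (V p x) = (PC f (id1 L p) x \<cdot>[q] TA f (U p x)) \<cdot>[q] TA f (V p x)"
    using PC_id1_right[OF assms] by simp
  also have "\<dots> = PC f (id1 L p) x \<cdot>[q] TA f (U p x \<cdot>[p] V p x)"
    by (simp del: V_simps(4-))
  also have "\<dots> = PC f (id1 L p) x" by simp
  finally show ?thesis .
qed

lemma V_T:
  assumes "f \<in> Cells1 L" "src L f = p" "trg L f = q" "x \<in> Obj (CC p)"
  shows "V q (T f x) = PC (id1 L q) f x"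
proof -
  note [simp] = assms
  have [simp]: "p \<in> Cells0 L" "q \<in> Cells0 L" using assms L.src_closed[of f] L.trg_closed[of f] by auto
  have "PC (id1 L q) f x = PC (id1 L q) f x \<cdot>[q] U q (T f x) \<cdot>[q] V q (T f x)" by simp
  also have "\<dots> = (PC (id1 L q) f x \<cdot>[q] U q (T f x)) \<cdot>[q] V q (T f x)"
    by (simp del: V_simps(4-))
  also have "\<dots> = V q (T f x)" using PC_id1_left[OF assms] by simp
  finally show ?thesis by simp
qed

lemma V_natural:
  assumes "p \<in> Cells0 L" "k \<in> Arr (CC p)" "Dom (CC p) k = x" "Cod (CC p) k = y"
  shows "V p y \<cdot>[p] TA (id1 L p) k = k \<cdot>[p] V p x"
proof -
  note [simp] = assms
  have [simp]: "x \<in> Obj (CC p)" "y \<in> Obj (CC p)"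
    using assms category.Dom_closed category.Cod_closed category_CC by metis+
  have "V p y \<cdot>[p] TA (id1 L p) k = V p y \<cdot>[p] TA (id1 L p) k \<cdot>[p] U p x \<cdot>[p] V p x"
    by simp
  also have "\<dots> = V p y \<cdot>[p] (TA (id1 L p) k \<cdot>[p] U p x) \<cdot>[p] V p x"
    by (simp del: V_simps(4-))
  also have "\<dots> = (V p y \<cdot>[p] U p y) \<cdot>[p] k \<cdot>[p] V p x"
    unfolding U_natural[OF assms] by (simp del: V_simps(4-))
  finally show ?thesis by simp
qed

section \<open>The categories of the co-dextrification\<close>

lemma hob_Obj [simp]:
  "\<lbrakk>m \<in> Cells1 L; trg L m = r; src L m = p; is_hat_obj L C r G\<rbrakk> \<Longrightarrow> hob G m \<in> Obj (CC p)"
  by (auto simp: is_hat_obj_def)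

lemma hmor_simps [simp]:
  assumes "a \<in> Cells2 L" "n \<in> Cells1 L" "s \<in> Cells1 L" "trg L s = src L n"
    "trg L n = r" "vtrg L a = n \<odot> s" "src L n = q"
    "is_hat_obj L C r G"
  shows "hmor G (a, n, s) \<in> Arr (CC q)" "Dom (CC q) (hmor G (a, n, s)) = hob G n"
    "Cod (CC q) (hmor G (a, n, s)) = T s (hob G (vsrc L a))"
proof -
  have "(a, n, s) \<in> decomps L r" using assms by simp
  then have "hmor G (a, n, s) \<in> hom (CC q) (hob G n) (T s (hob G (vsrc L a)))"
    using assms(7,8) unfolding is_hat_obj_def by blast
  then show "hmor G (a, n, s) \<in> Arr (CC q)" "Dom (CC q) (hmor G (a, n, s)) = hob G n"
    "Cod (CC q) (hmor G (a, n, s)) = T s (hob G (vsrc L a))"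
    by (auto simp: hom_def)
qed

lemma hmor_id2:
  assumes "is_hat_obj L C r G" "m \<in> Cells1 L" "trg L m = r" "src L m = p"
  shows "hmor G (id2 L m, m, id1 L p) = U p (hob G m)"
  using assms by (auto simp: is_hat_obj_def)

lemma hmor_hmor:
  assumes "is_hat_obj L C r G" "a \<in> Cells2 L" "n \<in> Cells1 L" "s \<in> Cells1 L" "trg L s = src L n"
    "trg L n = r" "vtrg L a = n \<odot> s" "vsrc L a = m"
    "b \<in> Cells2 L" "w \<in> Cells1 L" "t \<in> Cells1 L" "trg L t = src L w"
    "trg L w = r" "vtrg L b = w \<odot> t" "vsrc L b = n" "src L w = q"
  shows "PC t s (hob G m) \<cdot>[q] TA t (hmor G (a, n, s)) \<cdot>[q] hmor G (b, w, t) =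
    hmor G ((b \<rhd> s) \<bullet> a, w, t \<odot> s)"
proof -
  have "(a, n, s) \<in> decomps L r" "(b, w, t) \<in> decomps L r" using assms by simp_all
  then show ?thesis using assms(1,8,15,16) unfolding is_hat_obj_def by blast
qed

lemma TT_hmor:
  assumes "is_hat_obj L C r G" "a \<in> Cells2 L" "n \<in> Cells1 L" "s \<in> Cells1 L" "trg L s = src L n"
    "trg L n = r" "vtrg L a = n \<odot> s" "vsrc L a = m" "src L n = q" "b \<in> Cells2 L" "vsrc L b = s"
    "vtrg L b = t"
  shows "TT b (hob G m) \<cdot>[q] hmor G (a, n, s) = hmor G ((n \<lhd> b) \<bullet> a, n, t)"
proof -
  have "(a, n, s) \<in> decomps L r" using assms by simp
  then show ?thesis using assms(1,8-12) unfolding is_hat_obj_def by blast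
qed

lemma hsrc_obj [simp]: "is_hat_arr L C r \<theta> \<Longrightarrow> is_hat_obj L C r (hsrc \<theta>)"
  and htrg_obj [simp]: "is_hat_arr L C r \<theta> \<Longrightarrow> is_hat_obj L C r (htrg \<theta>)"
  by (auto simp: is_hat_arr_def)

lemma hcmp_simps [simp]:
  assumes "m \<in> Cells1 L" "trg L m = r" "src L m = p" "is_hat_arr L C r \<theta>"
  shows "hcmp \<theta> m \<in> Arr (CC p)" "Dom (CC p) (hcmp \<theta> m) = hob (hsrc \<theta>) m"
    "Cod (CC p) (hcmp \<theta> m) = hob (htrg \<theta>) m"
proof -
  have "m \<in> into L r" using assms by simp
  then have "hcmp \<theta> m \<in> hom (CC p) (hob (hsrc \<theta>) m) (hob (htrg \<theta>) m)"
    using assms(3,4) unfolding is_hat_arr_def by blast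
  then show "hcmp \<theta> m \<in> Arr (CC p)" "Dom (CC p) (hcmp \<theta> m) = hob (hsrc \<theta>) m"
    "Cod (CC p) (hcmp \<theta> m) = hob (htrg \<theta>) m"
    by (auto simp: hom_def)
qed

lemma hcmp_hmor:
  assumes "is_hat_arr L C r \<theta>" "a \<in> Cells2 L" "n \<in> Cells1 L" "s \<in> Cells1 L" "trg L s = src L n"
    "trg L n = r" "vtrg L a = n \<odot> s" "vsrc L a = m" "src L n = q"
  shows "TA s (hcmp \<theta> m) \<cdot>[q] hmor (hsrc \<theta>) (a, n, s) =
    hmor (htrg \<theta>) (a, n, s) \<cdot>[q] hcmp \<theta> n"
proof -
  have "(a, n, s) \<in> decomps L r" using assms by simp
  then show ?thesis using assms(1,8-9) unfolding is_hat_arr_def by blast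
qed

lemma vsrc_decomp:
  assumes "a \<in> Cells2 L" "n \<in> Cells1 L" "s \<in> Cells1 L" "trg L s = src L n" "vtrg L a = n \<odot> s"
  shows "vsrc L a \<in> Cells1 L" "src L (vsrc L a) = src L s" "trg L (vsrc L a) = trg L n"
  using assms L.src_vsrc[of a] L.trg_vsrc[of a] by simp_all

lemma is_hat_objI:
  assumes "hob G \<in> extensional (into L r)" "hmor G \<in> extensional (decomps L r)"
    and "\<And>m. m \<in> Cells1 L \<Longrightarrow> trg L m = r \<Longrightarrow> hob G m \<in> Obj (CC (src L m))"
    and "\<And>a n s. \<lbrakk>a \<in> Cells2 L; n \<in> Cells1 L; s \<in> Cells1 L; trg L s = src L n; trg L n = r;
        vtrg L a = n \<odot> s\<rbrakk> \<Longrightarrow>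
      hmor G (a, n, s) \<in> hom (CC (src L n)) (hob G n) (T s (hob G (vsrc L a)))"
    and "\<And>m. m \<in> Cells1 L \<Longrightarrow> trg L m = r \<Longrightarrow>
      hmor G (id2 L m, m, id1 L (src L m)) = U (src L m) (hob G m)"
    and "\<And>a n s b w t. \<lbrakk>a \<in> Cells2 L; n \<in> Cells1 L; s \<in> Cells1 L; trg L s = src L n; trg L n = r;
        vtrg L a = n \<odot> s; b \<in> Cells2 L; w \<in> Cells1 L; t \<in> Cells1 L; trg L t = src L w; trg L w = r;
        vtrg L b = w \<odot> t; vsrc L b = n; src L n = trg L s; trg L t = src L w\<rbrakk> \<Longrightarrow>
      PC t s (hob G (vsrc L a)) \<cdot>[src L w] TA t (hmor G (a, n, s)) \<cdot>[src L w] hmor G (b, w, t)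
       = hmor G ((b \<rhd> s) \<bullet> a, w, t \<odot> s)"
    and "\<And>a n s b. \<lbrakk>a \<in> Cells2 L; n \<in> Cells1 L; s \<in> Cells1 L; trg L s = src L n; trg L n = r;
        vtrg L a = n \<odot> s; b \<in> Cells2 L; vsrc L b = s\<rbrakk> \<Longrightarrow>
      TT b (hob G (vsrc L a)) \<cdot>[src L n] hmor G (a, n, s) = hmor G ((n \<lhd> b) \<bullet> a, n, vtrg L b)"
  shows "is_hat_obj L C r G"
  unfolding is_hat_obj_def
proof (intro conjI ballI)
  show "hmor G (id2 L m, m, id1 L (src L m)) = U (src L m) (hob G m)" "hob G m \<in> Obj (CC (src L m))"
    if "m \<in> into L r" for m
    using assms(3,5) that by auto
qed (use assms(1,2,4,6,7) in \<open>auto split: prod.splits\<close>)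

lemma is_hat_arrI:
  assumes "is_hat_obj L C r (hsrc \<theta>)" "is_hat_obj L C r (htrg \<theta>)" "hcmp \<theta> \<in> extensional (into L r)"
    and "\<And>m. m \<in> Cells1 L \<Longrightarrow> trg L m = r \<Longrightarrow>
      hcmp \<theta> m \<in> hom (CC (src L m)) (hob (hsrc \<theta>) m) (hob (htrg \<theta>) m)"
    and "\<And>a n s. \<lbrakk>a \<in> Cells2 L; n \<in> Cells1 L; s \<in> Cells1 L; trg L s = src L n; trg L n = r;
        vtrg L a = n \<odot> s\<rbrakk> \<Longrightarrow>
      TA s (hcmp \<theta> (vsrc L a)) \<cdot>[src L n] hmor (hsrc \<theta>) (a, n, s)
      = hmor (htrg \<theta>) (a, n, s) \<cdot>[src L n] hcmp \<theta> n"
  shows "is_hat_arr L C r \<theta>"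
  unfolding is_hat_arr_def
proof (intro conjI ballI)
  show "hcmp \<theta> m \<in> hom (CC (src L m)) (hob (hsrc \<theta>) m) (hob (htrg \<theta>) m)" if "m \<in> into L r" for m
    using assms(4) that by auto
qed (use assms(1-3,5) in auto)

lemma is_hat_arr_Idn:
  assumes G [simp]: "is_hat_obj L C r G"
  shows "is_hat_arr L C r (Idn (hat_cat L C r) G)"
proof (rule is_hat_arrI)
  fix a n s
  assume *: "a \<in> Cells2 L" "n \<in> Cells1 L" "s \<in> Cells1 L" "trg L s = src L n" "trg L n = r"
    "vtrg L a = n \<odot> s"
  then show "TA s (hcmp (Idn (hat_cat L C r) G) (vsrc L a)) \<cdot>[src L n]
      hmor (hsrc (Idn (hat_cat L C r) G)) (a, n, s) =
    hmor (htrg (Idn (hat_cat L C r) G)) (a, n, s) \<cdot>[src L n] hcmp (Idn (hat_cat L C r) G) n"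
    by (simp add: vsrc_decomp[OF *(1-4,6)])
qed (auto simp: hom_def, simp add: hat_cat_def)

lemma is_hat_arr_Cmp:
  assumes f [simp]: "is_hat_arr L C r f" and g [simp]: "is_hat_arr L C r g" and gf: "hsrc g = htrg f"
  shows "is_hat_arr L C r (g \<cdot>\<^bsub>hat_cat L C r\<^esub> f)"
proof (rule is_hat_arrI)
  fix a n s
  assume *: "a \<in> Cells2 L" "n \<in> Cells1 L" "s \<in> Cells1 L" "trg L s = src L n" "trg L n = r"
    "vtrg L a = n \<odot> s"
  note [simp] = * gf vsrc_decomp[OF *(1-4,6)]
  let ?q = "src L n" and ?m = "vsrc L a"
  have [simp]: "is_hat_obj L C r (htrg f)" by simp
  have "TA s (hcmp g ?m \<cdot>[src L s] hcmp f ?m) \<cdot>[?q] hmor (hsrc f) (a, n, s) =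
      TA s (hcmp g ?m) \<cdot>[?q] (TA s (hcmp f ?m) \<cdot>[?q] hmor (hsrc f) (a, n, s))"
    by simp
  also have "\<dots> = (TA s (hcmp g ?m) \<cdot>[?q] hmor (hsrc g) (a, n, s)) \<cdot>[?q] hcmp f n"
    using hcmp_hmor[OF f *(1-6)] by simp
  also have "\<dots> = hmor (htrg g) (a, n, s) \<cdot>[?q] hcmp g n \<cdot>[?q] hcmp f n"
    using hcmp_hmor[OF g *(1-6)] by simp
  finally show "TA s (hcmp (g \<cdot>\<^bsub>hat_cat L C r\<^esub> f) (vsrc L a)) \<cdot>[src L n]
      hmor (hsrc (g \<cdot>\<^bsub>hat_cat L C r\<^esub> f)) (a, n, s) =
    hmor (htrg (g \<cdot>\<^bsub>hat_cat L C r\<^esub> f)) (a, n, s) \<cdot>[src L n] hcmp (g \<cdot>\<^bsub>hat_cat L C r\<^esub> f) n"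
    by simp
qed (use gf in \<open>auto simp: hom_def\<close>, simp add: hat_cat_def)

lemma category_hat [simp]: "category (hat_cat L C r)"
proof
  fix f x y assume "f \<in> hom (hat_cat L C r) x y"
  then have *: "is_hat_arr L C r f" "hsrc f = x" "htrg f = y" by (auto simp: hom_def)
  then have [simp]: "is_hat_obj L C r x" "is_hat_obj L C r y" by auto
  show "Idn (hat_cat L C r) y \<cdot>\<^bsub>hat_cat L C r\<^esub> f = f"
    by (rule hat_arr_eqI[of L C r]) (use * in \<open>simp_all add: is_hat_arr_Cmp is_hat_arr_Idn\<close>)
  show "f \<cdot>\<^bsub>hat_cat L C r\<^esub> Idn (hat_cat L C r) x = f"
    by (rule hat_arr_eqI[of L C r]) (use * in \<open>simp_all add: is_hat_arr_Cmp is_hat_arr_Idn\<close>)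
next
  fix f g h w x y z
  assume "f \<in> hom (hat_cat L C r) w x" "g \<in> hom (hat_cat L C r) x y" "h \<in> hom (hat_cat L C r) y z"
  then have *: "is_hat_arr L C r f" "hsrc f = w" "htrg f = x" "is_hat_arr L C r g" "hsrc g = x"
    "htrg g = y" "is_hat_arr L C r h" "hsrc h = y" "htrg h = z" by (auto simp: hom_def)
  show "(h \<cdot>\<^bsub>hat_cat L C r\<^esub> g) \<cdot>\<^bsub>hat_cat L C r\<^esub> f = h \<cdot>\<^bsub>hat_cat L C r\<^esub> g \<cdot>\<^bsub>hat_cat L C r\<^esub> f"
    by (rule hat_arr_eqI[of L C r]) (use * in \<open>simp_all add: is_hat_arr_Cmp\<close>)
qed (auto simp: hom_def is_hat_arr_Idn is_hat_arr_Cmp)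

text \<open>The contravariant action of \<open>G\<close> on 2-cells: the structure arrow for the
  trivial decomposition \<open>vtrg c \<odot> 1\<close>, followed by the inverse unit. The
  components of \<open>hat_nat\<close> have this form.\<close>

definition hst where
  "hst G c = V (src L (vsrc L c)) (hob G (vsrc L c)) \<cdot>[src L (vsrc L c)]
     hmor G (c, vtrg L c, id1 L (src L (vsrc L c)))"

lemma hst_simps [simp]:
  assumes "c \<in> Cells2 L" "trg L (vsrc L c) = r" "src L (vsrc L c) = p" "is_hat_obj L C r G"
  shows "hst G c \<in> Arr (CC p)" "Dom (CC p) (hst G c) = hob G (vtrg L c)"
    "Cod (CC p) (hst G c) = hob G (vsrc L c)"
proof -
  have [simp]: "p \<in> Cells0 L" using assms(1,3) L.src_closed[of "vsrc L c"] by auto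
  show "hst G c \<in> Arr (CC p)" "Dom (CC p) (hst G c) = hob G (vtrg L c)"
    "Cod (CC p) (hst G c) = hob G (vsrc L c)"
    using assms by (simp_all add: hst_def)
qed

lemma hst_id2:
  assumes "is_hat_obj L C r G" "m \<in> Cells1 L" "trg L m = r" "src L m = p"
  shows "hst G (id2 L m) = Idn (CC p) (hob G m)"
  using assms hmor_id2[OF assms] L.src_closed[of m] by (auto simp: hst_def)

text \<open>Changes the index 2-cell on its source side. By \<open>TA_V\<close> the inverse unit
  becomes \<open>PC s 1\<close>, and the composite is then an instance of the composition axiom
  \<open>hmor_hmor\<close>.\<close>

lemma TA_hst_hmor:
  assumes G: "is_hat_obj L C r G" and a: "a \<in> Cells2 L" "n \<in> Cells1 L" "s \<in> Cells1 L" "trg L s = src L n"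
    "trg L n = r" "vtrg L a = n \<odot> s" "vsrc L a = m" and q: "src L n = q"
    and c: "c \<in> Cells2 L" "vtrg L c = m"
  shows "TA s (hst G c) \<cdot>[q] hmor G (a, n, s) = hmor G (a \<bullet> c, n, s)"
proof -
  have m: "m \<in> Cells1 L" "src L m = src L s" "trg L m = r"
    using vsrc_decomp[OF a(1-4,6)] a by auto
  have m': "vsrc L c \<in> Cells1 L" "src L (vsrc L c) = src L s" "trg L (vsrc L c) = r"
    using m c L.src_vsrc[of c] L.trg_vsrc[of c] by auto
  have [simp]: "q \<in> Cells0 L" using q a L.src_closed[of n] by auto
  note [simp] = G a q c m m'
  have "TA s (hst G c) \<cdot>[q] hmor G (a, n, s) =
      TA s (V (src L s) (hob G (vsrc L c))) \<cdot>[q]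
        TA s (hmor G (c, m, id1 L (src L s))) \<cdot>[q] hmor G (a, n, s)"
    by (simp add: hst_def)
  also have "\<dots> = hmor G ((a \<rhd> id1 L (src L s)) \<bullet> c, n, s \<odot> id1 L (src L s))"
    using hmor_hmor[OF G, of c m "id1 L (src L s)" "vsrc L c" a n s q] by (simp add: TA_V)
  finally show ?thesis by simp
qed

text \<open>Changes the factor \<open>w\<close> of the decomposition. The inverse unit slides past
  \<open>hmor G (b, w, t)\<close> by naturality and becomes \<open>PC 1 t\<close> by
  \<open>V_T\<close>, after which \<open>hmor_hmor\<close> applies.\<close>

lemma hmor_hst:
  assumes G: "is_hat_obj L C r G" and b: "b \<in> Cells2 L" "w \<in> Cells1 L" "t \<in> Cells1 L" "trg L t = src L w"
    "trg L w = r" "vtrg L b = w \<odot> t" and q: "src L w = q"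
    and d: "d \<in> Cells2 L" "vsrc L d = w" "vtrg L d = w'"
  shows "hmor G (b, w, t) \<cdot>[q] hst G d = hmor G ((d \<rhd> t) \<bullet> b, w', t)"
proof -
  have m: "vsrc L b \<in> Cells1 L" "src L (vsrc L b) = src L t" "trg L (vsrc L b) = r"
    using vsrc_decomp[OF b(1-4,6)] b by auto
  have w': "w' \<in> Cells1 L" "src L w' = q" "trg L w' = r"
    using d q b L.src_vsrc[OF d(1)] L.trg_vsrc[OF d(1)] L.vtrg_closed[OF d(1)] by auto
  have [simp]: "q \<in> Cells0 L" using q b L.src_closed[of w] by auto
  note [simp] = G b q d w' m
  have "hmor G (b, w, t) \<cdot>[q] hst G d =
      (hmor G (b, w, t) \<cdot>[q] V q (hob G w)) \<cdot>[q] hmor G (d, w', id1 L q)"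
    by (simp add: hst_def)
  also have "hmor G (b, w, t) \<cdot>[q] V q (hob G w) =
      V q (T t (hob G (vsrc L b))) \<cdot>[q] TA (id1 L q) (hmor G (b, w, t))"
    by (rule V_natural[symmetric]) simp_all
  also have "(V q (T t (hob G (vsrc L b))) \<cdot>[q] TA (id1 L q) (hmor G (b, w, t))) \<cdot>[q]
        hmor G (d, w', id1 L q) =
      PC (id1 L q) t (hob G (vsrc L b)) \<cdot>[q] TA (id1 L q) (hmor G (b, w, t)) \<cdot>[q]
        hmor G (d, w', id1 L q)"
    by (simp add: V_T)
  also have "\<dots> = hmor G ((d \<rhd> t) \<bullet> b, w', id1 L q \<odot> t)"
    using hmor_hmor[OF G, of b w t "vsrc L b" d w' "id1 L q" q] by simp
  finally show ?thesis by simp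
qed

text \<open>The case of \<open>hmor_hst\<close> in which the second factor of the decomposition is
  an identity.\<close>

lemma hst_vcomp:
  assumes G: "is_hat_obj L C r G" and c: "c \<in> Cells2 L" "d \<in> Cells2 L" "vsrc L d = vtrg L c"
    "trg L (vsrc L c) = r" "src L (vsrc L c) = p"
  shows "hst G (d \<bullet> c) = hst G c \<cdot>[p] hst G d"
proof -
  have [simp]: "p \<in> Cells0 L" using c(1,5) L.src_closed[of "vsrc L c"] by auto
  have n: "vtrg L c \<in> Cells1 L" "src L (vtrg L c) = p" "trg L (vtrg L c) = r"
    using c by auto
  have d: "vtrg L d \<in> Cells1 L" "src L (vtrg L d) = p" "trg L (vtrg L d) = r"
    using c by auto
  have "hst G c \<cdot>[p] hst G d =
      V p (hob G (vsrc L c)) \<cdot>[p] hmor G (c, vtrg L c, id1 L p) \<cdot>[p] hst G d"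
    using G c n d by (simp add: hst_def[of G c])
  also have "hmor G (c, vtrg L c, id1 L p) \<cdot>[p] hst G d =
      hmor G ((d \<rhd> id1 L p) \<bullet> c, vtrg L d, id1 L p)"
    by (rule hmor_hst[OF G]) (use c n in simp_all)
  also have "(d \<rhd> id1 L p) = d" using c by simp
  also have "V p (hob G (vsrc L c)) \<cdot>[p] hmor G (d \<bullet> c, vtrg L d, id1 L p) = hst G (d \<bullet> c)"
    using c by (simp add: hst_def[of G "d \<bullet> c"])
  finally show ?thesis by (rule HOL.sym)
qed

lemma hst_natural:
  assumes \<theta>: "is_hat_arr L C r \<theta>" and c: "c \<in> Cells2 L" "vsrc L c = m" "vtrg L c = n"
    "trg L m = r" "src L m = p"
  shows "hst (htrg \<theta>) c \<cdot>[p] hcmp \<theta> n = hcmp \<theta> m \<cdot>[p] hst (hsrc \<theta>) c"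
proof -
  have m: "m \<in> Cells1 L" "n \<in> Cells1 L" "src L n = p" "trg L n = r"
    using c L.vsrc_closed[OF c(1)] L.vtrg_closed[OF c(1)] L.src_vsrc[OF c(1)] L.trg_vsrc[OF c(1)]
    by auto
  have [simp]: "p \<in> Cells0 L" using c(5) m L.src_closed[of m] by auto
  have obj [simp]: "is_hat_obj L C r (hsrc \<theta>)" "is_hat_obj L C r (htrg \<theta>)" using \<theta> by simp_all
  note [simp] = \<theta> c m
  have "hst (htrg \<theta>) c \<cdot>[p] hcmp \<theta> n =
     V p (hob (htrg \<theta>) m) \<cdot>[p] (hmor (htrg \<theta>) (c, n, id1 L p) \<cdot>[p] hcmp \<theta> n)"
    by (simp add: hst_def)
  also have "hmor (htrg \<theta>) (c, n, id1 L p) \<cdot>[p] hcmp \<theta> n =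
      TA (id1 L p) (hcmp \<theta> m) \<cdot>[p] hmor (hsrc \<theta>) (c, n, id1 L p)"
    by (rule hcmp_hmor[OF \<theta>, symmetric]) simp_all
  also have "V p (hob (htrg \<theta>) m) \<cdot>[p] TA (id1 L p) (hcmp \<theta> m) \<cdot>[p]
        hmor (hsrc \<theta>) (c, n, id1 L p) =
      (V p (hob (htrg \<theta>) m) \<cdot>[p] TA (id1 L p) (hcmp \<theta> m)) \<cdot>[p] hmor (hsrc \<theta>) (c, n, id1 L p)"
    by simp
  also have "V p (hob (htrg \<theta>) m) \<cdot>[p] TA (id1 L p) (hcmp \<theta> m) =
      hcmp \<theta> m \<cdot>[p] V p (hob (hsrc \<theta>) m)"
    by (rule V_natural) simp_all
  finally show ?thesis by (simp add: hst_def)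
qed

section \<open>Restriction along a 1-cell\<close>

lemma hat_fun_simps [simp]:
  "fdom (hat_fun L C m) = hat_cat L C (trg L m)" "fcod (hat_fun L C m) = hat_cat L C (src L m)"
  by (simp_all add: hat_fun_def Let_def)

lemma hob_hat_fun [simp]:
  "\<lbrakk>n \<in> Cells1 L; trg L n = src L m; is_hat_obj L C (trg L m) G\<rbrakk> \<Longrightarrow>
   hob (fobj (hat_fun L C m) G) n = hob G (m \<odot> n)"
  by (simp add: hat_fun_def)

lemma hmor_hat_fun [simp]:
  "\<lbrakk>a \<in> Cells2 L; n \<in> Cells1 L; s \<in> Cells1 L; trg L s = src L n; trg L n = src L m;
    vtrg L a = n \<odot> s; is_hat_obj L C (trg L m) G\<rbrakk> \<Longrightarrow>
   hmor (fobj (hat_fun L C m) G) (a, n, s) = hmor G (m \<lhd> a, m \<odot> n, s)"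
  by (simp add: hat_fun_def)

lemma farr_hat_fun [simp]:
  assumes "is_hat_arr L C (trg L m) \<theta>"
  shows "hsrc (farr (hat_fun L C m) \<theta>) = fobj (hat_fun L C m) (hsrc \<theta>)"
    "htrg (farr (hat_fun L C m) \<theta>) = fobj (hat_fun L C m) (htrg \<theta>)"
    "\<lbrakk>n \<in> Cells1 L; trg L n = src L m\<rbrakk> \<Longrightarrow> hcmp (farr (hat_fun L C m) \<theta>) n = hcmp \<theta> (m \<odot> n)"
  using assms hsrc_obj[OF assms] htrg_obj[OF assms] by (simp_all add: hat_fun_def)

text \<open>Whiskering by \<open>m\<close> is strictly functorial, so every axiom at
  \<open>a\<close> and \<open>b\<close> is the axiom of \<open>G\<close> at
  \<open>m \<lhd> a\<close> and \<open>m \<lhd> b\<close>, or at \<open>m \<lhd> a\<close> and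
  \<open>b\<close> where \<open>b\<close> acts on the factor \<open>s\<close>.\<close>

lemma is_hat_obj_hat_fun [simp]:
  assumes m: "m \<in> Cells1 L" and p: "src L m = p" and G: "is_hat_obj L C (trg L m) G"
  shows "is_hat_obj L C p (fobj (hat_fun L C m) G)"
proof (rule is_hat_objI)
  note [simp] = m G p
  have "p \<in> Cells0 L" using L.src_closed[OF m] p by simp
  show "hob (fobj (hat_fun L C m) G) \<in> extensional (into L p)"
    "hmor (fobj (hat_fun L C m) G) \<in> extensional (decomps L p)"
    by (simp_all add: hat_fun_def)
  fix n assume n: "n \<in> Cells1 L" "trg L n = p"
  then show "hob (fobj (hat_fun L C m) G) n \<in> Obj (CC (src L n))" by simp
  show "hmor (fobj (hat_fun L C m) G) (id2 L n, n, id1 L (src L n)) =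
      U (src L n) (hob (fobj (hat_fun L C m) G) n)"
    using hmor_id2[OF G, of "m \<odot> n" "src L n"] n by simp
next
  note [simp] = m G p
  fix a n s
  assume a: "a \<in> Cells2 L" "n \<in> Cells1 L" "s \<in> Cells1 L" "trg L s = src L n" "trg L n = p"
    "vtrg L a = n \<odot> s"
  note [simp] = a vsrc_decomp[OF a(1-4,6)]
  show "hmor (fobj (hat_fun L C m) G) (a, n, s) \<in> hom (CC (src L n)) (hob (fobj (hat_fun L C m) G) n)
      (T s (hob (fobj (hat_fun L C m) G) (vsrc L a)))"
    by (simp add: hom_iff)
  show "TT b (hob (fobj (hat_fun L C m) G) (vsrc L a)) \<cdot>[src L n]
      hmor (fobj (hat_fun L C m) G) (a, n, s) =
    hmor (fobj (hat_fun L C m) G) ((n \<lhd> b) \<bullet> a, n, vtrg L b)"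
    if b: "b \<in> Cells2 L" "vsrc L b = s" for b
  proof -
    have [simp]: "trg L (vtrg L b) = src L n" using b L.trg_vsrc[OF b(1)] by simp
    show ?thesis
      using TT_hmor[OF G, of "m \<lhd> a" "m \<odot> n" s "m \<odot> vsrc L a" "src L n" b "vtrg L b"] b by simp
  qed
  show "PC t s (hob (fobj (hat_fun L C m) G) (vsrc L a)) \<cdot>[src L w]
      TA t (hmor (fobj (hat_fun L C m) G) (a, n, s)) \<cdot>[src L w]
      hmor (fobj (hat_fun L C m) G) (b, w, t) =
    hmor (fobj (hat_fun L C m) G) ((b \<rhd> s) \<bullet> a, w, t \<odot> s)"
    if b: "b \<in> Cells2 L" "w \<in> Cells1 L" "t \<in> Cells1 L" "trg L t = src L w" "trg L w = p"
      "vtrg L b = w \<odot> t" "vsrc L b = n" for b w t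
  proof -
    have [simp]: "src L t = src L n" using vsrc_decomp[OF b(1-4,6)] b by simp
    show ?thesis
      using hmor_hmor[OF G, of "m \<lhd> a" "m \<odot> n" s "m \<odot> vsrc L a" "m \<lhd> b" "m \<odot> w" t "src L w"] b
      by simp
  qed
qed

lemma is_hat_arr_hat_fun [simp]:
  assumes m: "m \<in> Cells1 L" and p: "src L m = p" and \<theta>: "is_hat_arr L C (trg L m) \<theta>"
  shows "is_hat_arr L C p (farr (hat_fun L C m) \<theta>)"
proof (rule is_hat_arrI)
  note [simp] = m \<theta> p hsrc_obj[OF \<theta>] htrg_obj[OF \<theta>]
  show "is_hat_obj L C p (hsrc (farr (hat_fun L C m) \<theta>))" "is_hat_obj L C p (htrg (farr (hat_fun L C m) \<theta>))"
    by simp_all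
  show "hcmp (farr (hat_fun L C m) \<theta>) \<in> extensional (into L p)" by (simp add: hat_fun_def)
  show "hcmp (farr (hat_fun L C m) \<theta>) n \<in> hom (CC (src L n)) (hob (hsrc (farr (hat_fun L C m) \<theta>)) n)
      (hob (htrg (farr (hat_fun L C m) \<theta>)) n)" if "n \<in> Cells1 L" "trg L n = p" for n
    using that by (simp add: hom_iff)
  fix a n s
  assume a: "a \<in> Cells2 L" "n \<in> Cells1 L" "s \<in> Cells1 L" "trg L s = src L n" "trg L n = p"
    "vtrg L a = n \<odot> s"
  note [simp] = a vsrc_decomp[OF a(1-4,6)]
  show "TA s (hcmp (farr (hat_fun L C m) \<theta>) (vsrc L a)) \<cdot>[src L n]
      hmor (hsrc (farr (hat_fun L C m) \<theta>)) (a, n, s) =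
    hmor (htrg (farr (hat_fun L C m) \<theta>)) (a, n, s) \<cdot>[src L n] hcmp (farr (hat_fun L C m) \<theta>) n"
    using hcmp_hmor[OF \<theta>, of "m \<lhd> a" "m \<odot> n" s "m \<odot> vsrc L a" "src L n"] by simp
qed

lemma is_functor_hat_fun [simp]:
  assumes m: "m \<in> Cells1 L"
  shows "is_functor (hat_fun L C m)"
proof (rule is_functorI[of "hat_cat L C (trg L m)" "hat_cat L C (src L m)"])
  fix f assume "f \<in> Arr (hat_cat L C (trg L m))"
  then show "farr (hat_fun L C m) f \<in> hom (hat_cat L C (src L m))
      (fobj (hat_fun L C m) (Dom (hat_cat L C (trg L m)) f))
      (fobj (hat_fun L C m) (Cod (hat_cat L C (trg L m)) f))"
    using m by (simp add: hom_iff)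
next
  fix G assume "G \<in> Obj (hat_cat L C (trg L m))"
  then show "farr (hat_fun L C m) (Idn (hat_cat L C (trg L m)) G) =
      Idn (hat_cat L C (src L m)) (fobj (hat_fun L C m) G)"
    using m by (intro hat_arr_eqI[of L C "src L m"]) (simp_all add: is_hat_arr_Idn)
next
  fix f g assume "f \<in> Arr (hat_cat L C (trg L m))" "g \<in> Arr (hat_cat L C (trg L m))"
    "Dom (hat_cat L C (trg L m)) g = Cod (hat_cat L C (trg L m)) f"
  then show "farr (hat_fun L C m) (g \<cdot>\<^bsub>hat_cat L C (trg L m)\<^esub> f) =
      farr (hat_fun L C m) g \<cdot>\<^bsub>hat_cat L C (src L m)\<^esub> farr (hat_fun L C m) f"
    using m by (intro hat_arr_eqI[of L C "src L m"]) (simp_all add: is_hat_arr_Cmp)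
next
  show "fobj (hat_fun L C m) \<in> extensional (Obj (hat_cat L C (trg L m)))"
    "farr (hat_fun L C m) \<in> extensional (Arr (hat_cat L C (trg L m)))"
    by (simp_all add: hat_fun_def del: Cells_hat_cat)
qed (use m in auto)

section \<open>Transformations between restrictions induced by 2-cells\<close>

lemma hat_nat_simps [simp]:
  "ndom (hat_nat L C b) = hat_fun L C (vtrg L b)" "ncod (hat_nat L C b) = hat_fun L C (vsrc L b)"
  by (simp_all add: hat_nat_def Let_def)

lemma ncmp_hat_nat [simp]:
  assumes "is_hat_obj L C (trg L (vsrc L b)) G"
  shows "hsrc (ncmp (hat_nat L C b) G) = fobj (hat_fun L C (vtrg L b)) G"
    "htrg (ncmp (hat_nat L C b) G) = fobj (hat_fun L C (vsrc L b)) G"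
    "\<lbrakk>b \<in> Cells2 L; s \<in> Cells1 L; trg L s = src L (vsrc L b)\<rbrakk> \<Longrightarrow>
      hcmp (ncmp (hat_nat L C b) G) s = hst G (b \<rhd> s)"
  using assms by (simp_all add: hat_nat_def Let_def hst_def V_def)

lemma hst_hat_fun [simp]:
  assumes "c \<in> Cells2 L" "m \<in> Cells1 L" "trg L (vsrc L c) = src L m" "is_hat_obj L C (trg L m) G"
  shows "hst (fobj (hat_fun L C m) G) c = hst G (m \<lhd> c)"
  using assms by (simp add: hst_def)

text \<open>Both composites are the structure arrow of \<open>G\<close> at the horizontal composite
  of \<open>b\<close> and \<open>a\<close>, which the two sides decompose into whiskerings in
  opposite orders.\<close>

lemma is_hat_arr_hat_nat [simp]:
  assumes b: "b \<in> Cells2 L" and p: "src L (vsrc L b) = p" and G: "is_hat_obj L C (trg L (vsrc L b)) G"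
  shows "is_hat_arr L C p (ncmp (hat_nat L C b) G)"
proof (rule is_hat_arrI)
  define m m' where "m = vsrc L b" and "m' = vtrg L b"
  have m: "m \<in> Cells1 L" "m' \<in> Cells1 L" "src L m = p" "src L m' = p" "trg L m' = trg L m"
    "vsrc L b = m" "vtrg L b = m'"
    using b p by (simp_all add: m_def m'_def)
  have G' [simp]: "is_hat_obj L C (trg L m) G" using G by (simp add: m)
  note [simp] = b m
  show "is_hat_obj L C p (hsrc (ncmp (hat_nat L C b) G))" "is_hat_obj L C p (htrg (ncmp (hat_nat L C b) G))"
    by simp_all
  show "hcmp (ncmp (hat_nat L C b) G) \<in> extensional (into L p)"
    by (simp add: hat_nat_def Let_def)
  show "hcmp (ncmp (hat_nat L C b) G) s \<in> hom (CC (src L s)) (hob (hsrc (ncmp (hat_nat L C b) G)) s)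
      (hob (htrg (ncmp (hat_nat L C b) G)) s)" if "s \<in> Cells1 L" "trg L s = p" for s
    using that by (simp add: hom_iff)
  fix a n s
  assume a: "a \<in> Cells2 L" "n \<in> Cells1 L" "s \<in> Cells1 L" "trg L s = src L n" "trg L n = p"
    "vtrg L a = n \<odot> s"
  note [simp] = a vsrc_decomp[OF a(1-4,6)]
  let ?q = "src L n"
  have "TA s (hst G (b \<rhd> vsrc L a)) \<cdot>[?q] hmor G (m' \<lhd> a, m' \<odot> n, s) =
      hmor G ((m' \<lhd> a) \<bullet> (b \<rhd> vsrc L a), m' \<odot> n, s)"
    by (rule TA_hst_hmor[OF G', where m = "m' \<odot> vsrc L a"]) simp_all
  also have "(m' \<lhd> a) \<bullet> (b \<rhd> vsrc L a) = (b \<rhd> (n \<odot> s)) \<bullet> (m \<lhd> a)"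
    using L.whisk_exchange[of a b "vsrc L a" "n \<odot> s" m m'] by simp
  finally show "TA s (hcmp (ncmp (hat_nat L C b) G) (vsrc L a)) \<cdot>[src L n]
      hmor (hsrc (ncmp (hat_nat L C b) G)) (a, n, s) =
    hmor (htrg (ncmp (hat_nat L C b) G)) (a, n, s) \<cdot>[src L n] hcmp (ncmp (hat_nat L C b) G) n"
    using hmor_hst[OF G', of "m \<lhd> a" "m \<odot> n" s ?q "b \<rhd> n" "m' \<odot> n"] by simp
qed

lemma is_ntrans_hat_nat [simp]:
  assumes b: "b \<in> Cells2 L"
  shows "is_ntrans (hat_nat L C b)"
proof (rule is_ntransI[of "hat_fun L C (vtrg L b)" "hat_fun L C (vsrc L b)" _
      "hat_cat L C (trg L (vsrc L b))" "hat_cat L C (src L (vsrc L b))"])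
  show "ncmp (hat_nat L C b) \<in> extensional (Obj (hat_cat L C (trg L (vsrc L b))))"
    by (simp add: hat_nat_def Let_def del: Cells_hat_cat)
  show "ncmp (hat_nat L C b) G \<in> hom (hat_cat L C (src L (vsrc L b)))
      (fobj (hat_fun L C (vtrg L b)) G) (fobj (hat_fun L C (vsrc L b)) G)"
    if "G \<in> Obj (hat_cat L C (trg L (vsrc L b)))" for G
    using that b by (simp add: hom_iff)
  fix f assume "f \<in> Arr (hat_cat L C (trg L (vsrc L b)))"
  then have f: "is_hat_arr L C (trg L (vsrc L b)) f" by simp
  show "farr (hat_fun L C (vsrc L b)) f \<cdot>\<^bsub>hat_cat L C (src L (vsrc L b))\<^esub>
      ncmp (hat_nat L C b) (Dom (hat_cat L C (trg L (vsrc L b))) f) =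
    ncmp (hat_nat L C b) (Cod (hat_cat L C (trg L (vsrc L b))) f) \<cdot>\<^bsub>hat_cat L C (src L (vsrc L b))\<^esub>
      farr (hat_fun L C (vtrg L b)) f"
  proof (rule hat_arr_eqI[of L C "src L (vsrc L b)"])
    fix m assume "m \<in> Cells1 L" "trg L m = src L (vsrc L b)"
    then show "hcmp (farr (hat_fun L C (vsrc L b)) f \<cdot>\<^bsub>hat_cat L C (src L (vsrc L b))\<^esub>
        ncmp (hat_nat L C b) (Dom (hat_cat L C (trg L (vsrc L b))) f)) m =
      hcmp (ncmp (hat_nat L C b) (Cod (hat_cat L C (trg L (vsrc L b))) f) \<cdot>\<^bsub>hat_cat L C (src L (vsrc L b))\<^esub>
        farr (hat_fun L C (vtrg L b)) f) m"
      using hst_natural[OF f, of "b \<rhd> m" "vsrc L b \<odot> m" "vtrg L b \<odot> m" "src L m"] f b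
        hsrc_obj[OF f] htrg_obj[OF f] by simp
  qed (use f b hsrc_obj[OF f] htrg_obj[OF f] in \<open>simp_all add: is_hat_arr_Cmp\<close>)
qed (use b in simp_all)

lemma hat_simps [simp]:
  "act0 (hat L C) = hat_cat L C" "act1 (hat L C) = hat_fun L C" "act2 (hat L C) = hat_nat L C"
  by (simp_all add: hat_def)

lemma hat_fun_id1:
  assumes p: "p \<in> Cells0 L"
  shows "hat_fun L C (id1 L p) = functor_id (hat_cat L C p)"
proof -
  have obj: "fobj (hat_fun L C (id1 L p)) G = G" if G: "is_hat_obj L C p G" for G
  proof (rule hat_obj_eqI[of L C p])
    fix a n s assume "(a, n, s) \<in> decomps L p"
    then show "hmor (fobj (hat_fun L C (id1 L p)) G) (a, n, s) = hmor G (a, n, s)"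
      using p G vsrc_decomp(3)[of a n s] by simp
  qed (use p G in simp_all)
  show ?thesis
    by (rule functor_eqI) (use p obj in \<open>auto intro!: hat_arr_eqI[of L C p]\<close>)
qed

text \<open>Strictness is inherited from the associativity of composition in \<open>L\<close>: both
  sides evaluate \<open>G\<close> at \<open>g \<odot> f \<odot> n\<close>. Extensionality of the
  families turns this into an equality of objects and of functors.\<close>

lemma hat_fun_comp1:
  assumes "f \<in> Cells1 L" "g \<in> Cells1 L" "src L g = trg L f"
  shows "hat_fun L C (g \<odot> f) = functor_comp (hat_fun L C f) (hat_fun L C g)"
proof -
  have obj: "fobj (hat_fun L C (g \<odot> f)) G = fobj (hat_fun L C f) (fobj (hat_fun L C g) G)"
    if G: "is_hat_obj L C (trg L g) G" for G
  proof (rule hat_obj_eqI[of L C "src L f"])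
    fix a n s assume "(a, n, s) \<in> decomps L (src L f)"
    then show "hmor (fobj (hat_fun L C (g \<odot> f)) G) (a, n, s) =
        hmor (fobj (hat_fun L C f) (fobj (hat_fun L C g) G)) (a, n, s)"
      using assms G vsrc_decomp(3)[of a n s] by simp
  qed (use assms G in simp_all)
  show ?thesis
  proof (rule functor_eqI)
    fix h assume "h \<in> Arr (fdom (functor_comp (hat_fun L C f) (hat_fun L C g)))"
    then have h: "is_hat_arr L C (trg L g) h" by simp
    show "farr (hat_fun L C (g \<odot> f)) h = farr (functor_comp (hat_fun L C f) (hat_fun L C g)) h"
      by (rule hat_arr_eqI[of L C "src L f"]) (use assms h obj hsrc_obj[OF h] htrg_obj[OF h] in simp_all)
  qed (use assms obj in simp_all)
qed

text \<open>A vertical composite \<open>b \<bullet> a\<close> in \<open>coop L\<close> is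
  \<open>a \<bullet> b\<close> in \<open>L\<close>, which matches the contravariance of
  \<open>hst\<close>, so the laws for 2-cells come down to \<open>hst_id2\<close> and
  \<open>hst_vcomp\<close>.\<close>

lemma two_functor_hat: "two_functor (coop L) Cat (hat L C)"
proof -
  interpret A: two_category "coop L" by (rule two_category_coop) unfold_locales
  interpret M: two_category "Cat :: ((('a, 'c, 'x, 'y) hat_obj, ('a, 'c, 'x, 'y) hat_arr) cat, _, _) two_cat"
    by (rule two_category_Cat)
  show ?thesis
  proof
    fix f assume f: "f \<in> Cells1 (coop L)"
    show "act2 (hat L C) (id2 (coop L) f) = id2 Cat (act1 (hat L C) f)"
    proof (simp, rule ntrans_eqI)
      fix G assume "G \<in> Obj (fdom (ndom (ntrans_id (hat_fun L C f))))"
      then have G: "is_hat_obj L C (trg L f) G" by simp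
      show "ncmp (hat_nat L C (id2 L f)) G = ncmp (ntrans_id (hat_fun L C f)) G"
        by (rule hat_arr_eqI[of L C "src L f"]) (use f G hst_id2[OF G] in \<open>simp_all add: is_hat_arr_Idn\<close>)
    qed (use f in simp_all)
  next
    fix a b f g h assume "a \<in> hom2 (coop L) f g" "b \<in> hom2 (coop L) g h"
    then have ab: "a \<in> Cells2 L" "b \<in> Cells2 L" "vtrg L a = f" "vsrc L a = g" "vtrg L b = g" "vsrc L b = h"
      by (auto simp: hom2_iff)
    then have st: "g \<in> Cells1 L" "src L g = src L h" "trg L g = trg L h" "f \<in> Cells1 L"
        "src L f = src L h" "trg L f = trg L h"  "h \<in> Cells1 L"
      using L.src_vsrc[OF ab(1)] L.trg_vsrc[OF ab(1)] L.src_vsrc[OF ab(2)] L.trg_vsrc[OF ab(2)]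
        L.vsrc_closed[OF ab(1)] L.vtrg_closed[OF ab(1)] L.vsrc_closed[OF ab(2)]
      unfolding ab by simp_all
    show "act2 (hat L C) (b \<bullet>\<^bsub>coop L\<^esub> a) = act2 (hat L C) b \<bullet>\<^bsub>Cat\<^esub> act2 (hat L C) a"
    proof (simp, rule ntrans_eqI)
      fix G assume "G \<in> Obj (fdom (ndom (ntrans_vcomp (hat_nat L C b) (hat_nat L C a))))"
      then have G: "is_hat_obj L C (trg L h) G" using ab st by simp
      show "ncmp (hat_nat L C (a \<bullet> b)) G = ncmp (ntrans_vcomp (hat_nat L C b) (hat_nat L C a)) G"
        by (rule hat_arr_eqI[of L C "src L h"]) (use ab st G hst_vcomp[OF G] in \<open>simp_all add: is_hat_arr_Cmp\<close>)
    qed (use ab st in simp_all)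
  next
    fix a b assume "a \<in> Cells2 (coop L)" "b \<in> Cells2 (coop L)"
      "src (coop L) (vsrc (coop L) b) = trg (coop L) (vsrc (coop L) a)"
    then have ab: "a \<in> Cells2 L" "b \<in> Cells2 L" "src L (vsrc L a) = trg L (vsrc L b)" by simp_all
    define f f' g g' where "f = vsrc L a" and "f' = vtrg L a" and "g = vsrc L b" and "g' = vtrg L b"
    have ab': "vsrc L a = f" "vtrg L a = f'" "vsrc L b = g" "vtrg L b = g'"
      by (simp_all add: f_def f'_def g_def g'_def)
    have st: "f \<in> Cells1 L" "f' \<in> Cells1 L" "g \<in> Cells1 L" "g' \<in> Cells1 L" "src L f' = src L f"
        "trg L f' = trg L f" "src L g' = src L g" "trg L g' = trg L g" "src L f = trg L g"
      using ab by (simp_all add: f_def f'_def g_def g'_def)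
    show "act2 (hat L C) (b \<star>\<^bsub>coop L\<^esub> a) = act2 (hat L C) b \<star>\<^bsub>Cat\<^esub> act2 (hat L C) a"
    proof (simp, rule ntrans_eqI)
      fix G assume "G \<in> Obj (fdom (ndom (ntrans_hcomp (hat_nat L C b) (hat_nat L C a))))"
      then have G: "is_hat_obj L C (trg L f) G" using ab ab' st by simp
      show "ncmp (hat_nat L C (a \<star> b)) G = ncmp (ntrans_hcomp (hat_nat L C b) (hat_nat L C a)) G"
      proof (rule hat_arr_eqI[of L C "src L g"])
        fix s assume s: "s \<in> Cells1 L" "trg L s = src L g"
        \<comment> \<open>Splitting the horizontal composite into whiskerings makes it vertical, and
          \<open>hst\<close> turns vertical composition into composition of arrows.\<close>
        have "(a \<star> b) \<rhd> s = (a \<rhd> (g' \<odot> s)) \<bullet> (f \<lhd> (b \<rhd> s))"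
          using L.hcomp_eq_rl[of b a g g' f f'] ab(1,2) ab' st s by simp
        then show "hcmp (ncmp (hat_nat L C (a \<star> b)) G) s =
            hcmp (ncmp (ntrans_hcomp (hat_nat L C b) (hat_nat L C a)) G) s"
          using hst_vcomp[OF G, of "f \<lhd> (b \<rhd> s)" "a \<rhd> (g' \<odot> s)" "src L s"] ab(1,2) ab' st s G
          by simp
      qed (use ab(1,2) ab' st G in \<open>simp_all add: is_hat_arr_Cmp hat_fun_comp1\<close>)
    qed (use ab(1,2) ab' st in \<open>simp_all add: hat_fun_comp1\<close>)
  qed (auto simp: hom1_iff hom2_iff hat_fun_id1 hat_fun_comp1)
qed

end


section \<open>Right adjoints of restriction\<close>

context cat_pseudofunctor
begin

text \<open>Together with \<open>PC_lift\<close> this is how invertibility of the comparison cells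
  is used: equations between arrows into \<open>T g (T f x)\<close> are tested, and arrows into it
  are specified, in \<open>T (g \<odot> f) x\<close>, where the coherence laws can be
  applied.\<close>

lemma PC_cancel:
  assumes "f \<in> Cells1 L" "g \<in> Cells1 L" "src L g = trg L f" "src L f = p" "trg L g = q" "x \<in> Obj (CC p)"
    and a: "a \<in> Arr (CC q)" "Cod (CC q) a = T g (T f x)" and b: "b \<in> Arr (CC q)" "Cod (CC q) b = T g (T f x)"
    and eq: "PC g f x \<cdot>[q] a = PC g f x \<cdot>[q] b"
  shows "a = b"
proof -
  obtain h where h: "h \<in> Arr (CC q)" "Dom (CC q) h = T (g \<odot> f) x" "Cod (CC q) h = T g (T f x)"
    "h \<cdot>[q] PC g f x = Idn (CC q) (T g (T f x))"
    using PC_invertible[OF assms(1-6)] by blast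
  have [simp]: "q \<in> Cells0 L" using assms(2,5) L.trg_closed by auto
  have *: "h \<cdot>[q] PC g f x \<cdot>[q] y = y" if "y \<in> Arr (CC q)" "Cod (CC q) y = T g (T f x)" for y
    using category.Cmp_eq_Cmp[OF _ h(4), of y] that assms(1-6) h(1-3) by simp
  show ?thesis using *[OF a, unfolded eq] *[OF b] by (rule HOL.trans[OF HOL.sym])
qed

lemma PC_lift:
  assumes "f \<in> Cells1 L" "g \<in> Cells1 L" "src L g = trg L f" "src L f = p" "trg L g = q" "x \<in> Obj (CC p)"
    and k: "k \<in> hom (CC q) y (T (g \<odot> f) x)"
  obtains h where "h \<in> hom (CC q) y (T g (T f x))" "PC g f x \<cdot>[q] h = k"
proof -
  obtain h where h: "h \<in> Arr (CC q)" "Dom (CC q) h = T (g \<odot> f) x" "Cod (CC q) h = T g (T f x)"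
    "PC g f x \<cdot>[q] h = Idn (CC q) (T (g \<odot> f) x)"
    using PC_invertible[OF assms(1-6)] by blast
  have [simp]: "q \<in> Cells0 L" using assms(2,5) L.trg_closed by auto
  have "PC g f x \<cdot>[q] h \<cdot>[q] k = k"
    using category.Cmp_eq_Cmp[OF _ h(4), of k] k assms(1-6) h(1-3) by (simp add: hom_iff)
  then show ?thesis
    using that[of "h \<cdot>[q] k"] h k by (simp add: hom_iff)
qed

end

text \<open>Fixes one \<open>m\<close> and one object \<open>D\<close>; the outcome is a universal
  arrow from restriction along \<open>m\<close> to \<open>D\<close>.\<close>

locale coextension = cat_pseudofunctor L C
  for L :: "('o, 'a, 'c) two_cat" (structure) and C :: "('o, 'a, 'c, 'x, 'y) cat_valued" +
  fixes k :: "'k rel" and m :: 'a and D :: "('a, 'c, 'x, 'y) hat_obj"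
  assumes k: "Cinfinite k" and small: "small_two_cat k L"
    and limits: "p \<in> Cells0 L \<Longrightarrow> has_small_limits k (act0 C p)"
    and preserves: "n \<in> Cells1 L \<Longrightarrow> preserves_small_limits k (act1 C n)"
    and m [simp]: "m \<in> Cells1 L" and D [simp]: "is_hat_obj L C (src L m) D"
begin

text \<open>
  A 2-cell \<open>\<alpha> : m \<odot> \<rho> \<Rightarrow> \<nu> \<odot> \<sigma>\<close> sends a morphism \<open>\<theta>\<close> from the restriction of \<open>G\<close> along \<open>m\<close> to \<open>D\<close>
  to the arrow \<open>C \<sigma> (\<theta> \<rho>) \<cdot> G \<alpha> : G \<nu> \<rightarrow> C \<sigma> (D \<rho>)\<close>.
\<close>

definition node :: "'a \<Rightarrow> 'a \<Rightarrow> 'a \<Rightarrow> 'c \<Rightarrow> bool" where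
  "node \<nu> \<rho> \<sigma> \<alpha> \<longleftrightarrow> \<nu> \<in> Cells1 L \<and> \<rho> \<in> Cells1 L \<and> \<sigma> \<in> Cells1 L \<and> \<alpha> \<in> Cells2 L \<and> trg L \<nu> = trg L m \<and>
    trg L \<rho> = src L m \<and> src L \<sigma> = src L \<rho> \<and> trg L \<sigma> = src L \<nu> \<and>
    vsrc L \<alpha> = m \<odot> \<rho> \<and> vtrg L \<alpha> = \<nu> \<odot> \<sigma>"

lemma nodeD:
  assumes "node \<nu> \<rho> \<sigma> \<alpha>"
  shows "\<nu> \<in> Cells1 L" "\<rho> \<in> Cells1 L" "\<sigma> \<in> Cells1 L" "\<alpha> \<in> Cells2 L" "trg L \<nu> = trg L m"
    "trg L \<rho> = src L m" "src L \<sigma> = src L \<rho>" "trg L \<sigma> = src L \<nu>"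
    "vsrc L \<alpha> = m \<odot> \<rho>" "vtrg L \<alpha> = \<nu> \<odot> \<sigma>"
  using assms by (auto simp: node_def)

text \<open>The edges record what holds for all arrows
  \<open>C \<sigma> (\<theta> \<rho>) \<cdot> G \<alpha>\<close>. Those of the first kind express
  compatibility of \<open>\<theta>\<close> with the structure arrow of \<open>D\<close> at
  \<open>\<beta>\<close>, combined with the composition axiom of \<open>G\<close>; those of the
  second kind, \<open>edge2\<close>, express the action of 2-cells out of
  \<open>\<sigma>\<close>.\<close>

definition edge :: "'a \<Rightarrow> 'c \<Rightarrow> 'a \<Rightarrow> 'a \<Rightarrow> bool" where
  "edge \<rho> \<beta> \<tau> \<rho>' \<longleftrightarrow> \<beta> \<in> Cells2 L \<and> \<tau> \<in> Cells1 L \<and> \<rho>' \<in> Cells1 L \<and> trg L \<tau> = src L \<rho> \<and> vsrc L \<beta> = \<rho>' \<and>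
    vtrg L \<beta> = \<rho> \<odot> \<tau> \<and> src L \<rho>' = src L \<tau> \<and> trg L \<rho>' = trg L \<rho>"

lemma edgeD:
  assumes "edge \<rho> \<beta> \<tau> \<rho>'"
  shows "\<beta> \<in> Cells2 L" "\<tau> \<in> Cells1 L" "\<rho>' \<in> Cells1 L" "trg L \<tau> = src L \<rho>" "vsrc L \<beta> = \<rho>'"
    "vtrg L \<beta> = \<rho> \<odot> \<tau>" "src L \<rho>' = src L \<tau>" "trg L \<rho>' = trg L \<rho>"
  using assms by (auto simp: edge_def)

definition edge2 :: "'a \<Rightarrow> 'c \<Rightarrow> 'a \<Rightarrow> bool" where
  "edge2 \<sigma> \<gamma> \<sigma>' \<longleftrightarrow> \<gamma> \<in> Cells2 L \<and> \<sigma>' \<in> Cells1 L \<and> vsrc L \<gamma> = \<sigma> \<and> vtrg L \<gamma> = \<sigma>' \<and>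
    src L \<sigma>' = src L \<sigma> \<and> trg L \<sigma>' = trg L \<sigma>"

lemma edge2D:
  assumes "edge2 \<sigma> \<gamma> \<sigma>'"
  shows "\<gamma> \<in> Cells2 L" "\<sigma>' \<in> Cells1 L" "vsrc L \<gamma> = \<sigma>" "vtrg L \<gamma> = \<sigma>'"
    "src L \<sigma>' = src L \<sigma>" "trg L \<sigma>' = trg L \<sigma>"
  using assms by (auto simp: edge2_def)

lemma node_edge: "node \<nu> \<rho> \<sigma> \<alpha> \<Longrightarrow> edge \<rho> \<beta> \<tau> \<rho>' \<Longrightarrow>
    node \<nu> \<rho>' (\<sigma> \<odot> \<tau>) ((\<alpha> \<rhd> \<tau>) \<bullet> (m \<lhd> \<beta>))"
  by (simp add: node_def edge_def)

lemma node_edge2: "node \<nu> \<rho> \<sigma> \<alpha> \<Longrightarrow> edge2 \<sigma> \<gamma> \<sigma>' \<Longrightarrow> node \<nu> \<rho> \<sigma>' ((\<nu> \<lhd> \<gamma>) \<bullet> \<alpha>)"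
  by (simp add: node_def edge2_def)

text \<open>Pasting with \<open>a : \<mu> \<Rightarrow> n \<odot> s\<close> carries nodes of the
  diagram at \<open>\<mu>\<close> to nodes of the diagram at \<open>n\<close>. This is what induces
  the structure arrows of the right adjoint.\<close>

lemma node_decomp:
  "\<lbrakk>node \<mu> \<rho> \<sigma> \<alpha>; a \<in> Cells2 L; vsrc L a = \<mu>; n \<in> Cells1 L; s \<in> Cells1 L; trg L s = src L n;
    vtrg L a = n \<odot> s; trg L n = trg L m; src L s = src L \<mu>\<rbrakk> \<Longrightarrow>
   node n \<rho> (s \<odot> \<sigma>) ((a \<rhd> \<sigma>) \<bullet> \<alpha>)"
  by (simp add: node_def)

section \<open>The diagram at \<open>\<nu>\<close> and its limit\<close>

definition dgm :: "'a \<Rightarrow> 'a \<times> 'a \<times> 'c \<Rightarrow> 'x" where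
  "dgm \<nu> = (\<lambda>(\<rho>, \<sigma>, \<alpha>). T \<sigma> (hob D \<rho>))"

definition nodes :: "'a \<Rightarrow> ('a \<times> 'a \<times> 'c) set" where
  "nodes \<nu> = {(\<rho>, \<sigma>, \<alpha>). node \<nu> \<rho> \<sigma> \<alpha>}"

text \<open>An edge is stored as its source node with a label, the target being computed by
  \<open>edge_trg\<close>. The set of edges thus sits inside a product of sets of cells, which is
  how its size is bounded.\<close>

definition edges :: "'a \<Rightarrow> (('a \<times> 'a \<times> 'c) \<times> ('c \<times> 'a + 'c)) set" where
  "edges \<nu> = {((\<rho>, \<sigma>, \<alpha>), Inl (\<beta>, \<tau>)) | \<rho> \<sigma> \<alpha> \<beta> \<tau>. node \<nu> \<rho> \<sigma> \<alpha> \<and> edge \<rho> \<beta> \<tau> (vsrc L \<beta>)} \<union>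
    {((\<rho>, \<sigma>, \<alpha>), Inr \<gamma>) | \<rho> \<sigma> \<alpha> \<gamma>. node \<nu> \<rho> \<sigma> \<alpha> \<and> edge2 \<sigma> \<gamma> (vtrg L \<gamma>)}"

fun edge_trg :: "'a \<Rightarrow> ('a \<times> 'a \<times> 'c) \<times> ('c \<times> 'a + 'c) \<Rightarrow> 'a \<times> 'a \<times> 'c" where
  "edge_trg \<nu> ((\<rho>, \<sigma>, \<alpha>), Inl (\<beta>, \<tau>)) = (vsrc L \<beta>, \<sigma> \<odot> \<tau>, (\<alpha> \<rhd> \<tau>) \<bullet> (m \<lhd> \<beta>))"
| "edge_trg \<nu> ((\<rho>, \<sigma>, \<alpha>), Inr \<gamma>) = (\<rho>, vtrg L \<gamma>, (\<nu> \<lhd> \<gamma>) \<bullet> \<alpha>)"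

fun edge_arr :: "'a \<Rightarrow> ('a \<times> 'a \<times> 'c) \<times> ('c \<times> 'a + 'c) \<Rightarrow> 'y" where
  "edge_arr \<nu> ((\<rho>, \<sigma>, \<alpha>), Inl (\<beta>, \<tau>)) =
     PC \<sigma> \<tau> (hob D (vsrc L \<beta>)) \<cdot>[src L \<nu>] TA \<sigma> (hmor D (\<beta>, \<rho>, \<tau>))"
| "edge_arr \<nu> ((\<rho>, \<sigma>, \<alpha>), Inr \<gamma>) = TT \<gamma> (hob D \<rho>)"

lemma edgesE:
  assumes "e \<in> edges \<nu>"
  obtains \<rho> \<sigma> \<alpha> \<beta> \<tau> \<rho>' where "e = ((\<rho>, \<sigma>, \<alpha>), Inl (\<beta>, \<tau>))" "node \<nu> \<rho> \<sigma> \<alpha>" "edge \<rho> \<beta> \<tau> \<rho>'"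
      "vsrc L \<beta> = \<rho>'"
  | \<rho> \<sigma> \<alpha> \<gamma> \<sigma>' where "e = ((\<rho>, \<sigma>, \<alpha>), Inr \<gamma>)" "node \<nu> \<rho> \<sigma> \<alpha>" "edge2 \<sigma> \<gamma> \<sigma>'" "vtrg L \<gamma> = \<sigma>'"
  using assms unfolding edges_def by blast

lemma edges_fst: "e \<in> edges \<nu> \<Longrightarrow> fst e \<in> nodes \<nu>"
  by (erule edgesE) (simp_all add: nodes_def)

lemma edges_trg: "e \<in> edges \<nu> \<Longrightarrow> edge_trg \<nu> e \<in> nodes \<nu>"
  by (erule edgesE) (simp_all add: nodes_def node_edge node_edge2)

lemma dgm_Obj: "i \<in> nodes \<nu> \<Longrightarrow> dgm \<nu> i \<in> Obj (CC (src L \<nu>))"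
  by (auto simp: nodes_def dgm_def node_def)

lemma edge_arr_hom:
  assumes "e \<in> edges \<nu>"
  shows "edge_arr \<nu> e \<in> hom (CC (src L \<nu>)) (dgm \<nu> (fst e)) (dgm \<nu> (edge_trg \<nu> e))"
  using assms
proof (cases rule: edgesE)
  case (1 \<rho> \<sigma> \<alpha> \<beta> \<tau> \<rho>')
  note [simp] = nodeD[OF 1(2)] edgeD[OF 1(3)]
  show ?thesis by (simp add: 1(1) hom_iff dgm_def)
next
  case (2 \<rho> \<sigma> \<alpha> \<gamma> \<sigma>')
  note [simp] = nodeD[OF 2(2)] edge2D[OF 2(3)]
  show ?thesis by (simp add: 2(1) hom_iff dgm_def)
qed

text \<open>The limit is required together with its preservation by the functors
  \<open>C \<phi>\<close>, for the sake of arrows into \<open>C \<phi> (Rob \<nu>)\<close>. Both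
  parts must hold for one cone, since the cone is going to be picked by choice.\<close>

definition is_lim where
  "is_lim \<nu> x l \<longleftrightarrow> graph_limit (CC (src L \<nu>)) (nodes \<nu>) (dgm \<nu>) (edges \<nu>) fst (edge_trg \<nu>) (edge_arr \<nu>) x l \<and>
    (\<forall>\<phi>\<in>Cells1 L. src L \<phi> = src L \<nu> \<longrightarrow>
      graph_limit (CC (trg L \<phi>)) (nodes \<nu>) (\<lambda>i. T \<phi> (dgm \<nu> i)) (edges \<nu>) fst (edge_trg \<nu>)
        (\<lambda>e. TA \<phi> (edge_arr \<nu> e)) (T \<phi> x) (\<lambda>i. TA \<phi> (l i)))"

text \<open>Nodes are triples of cells and edges are labelled triples, so both sets are bounded by
  sums and products of cell sets of \<open>L\<close>, which stay below the infinite cardinal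
  \<open>k\<close>.\<close>

lemma ex_lim:
  assumes \<nu>: "\<nu> \<in> Cells1 L"
  shows "\<exists>x l. is_lim \<nu> x l"
proof -
  have fin: "\<not> finite (Field k)" "Card_order k" using k by (auto simp: cinfinite_def)
  have c: "|Cells1 L| <o k" "|Cells2 L| <o k" using small by (auto simp: small_two_cat_def)
  note prod = card_of_Times_ordLess_Cinfinite[OF k]
  have n: "|Cells1 L \<times> Cells1 L \<times> Cells2 L| <o k" by (intro prod c)
  have e: "|(Cells1 L \<times> Cells1 L \<times> Cells2 L) \<times> (Cells2 L \<times> Cells1 L <+> Cells2 L)| <o k"
    by (intro prod n card_of_Plus_ordLess_infinite_Field[OF fin] c)
  have "nodes \<nu> \<subseteq> Cells1 L \<times> Cells1 L \<times> Cells2 L" by (auto simp: nodes_def node_def)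
  then have 1: "|nodes \<nu>| <o k" using card_of_mono1 n ordLeq_ordLess_trans by blast
  have "edges \<nu> \<subseteq> (Cells1 L \<times> Cells1 L \<times> Cells2 L) \<times> (Cells2 L \<times> Cells1 L <+> Cells2 L)"
    by (auto simp: edges_def node_def edge_def edge2_def)
  then have 2: "|edges \<nu>| <o k" using card_of_mono1 e ordLeq_ordLess_trans by blast
  have cat: "category (CC (src L \<nu>))" "has_small_limits k (CC (src L \<nu>))"
    using \<nu> limits by simp_all
  obtain x l where *:
    "graph_limit (CC (src L \<nu>)) (nodes \<nu>) (dgm \<nu>) (edges \<nu>) fst (edge_trg \<nu>) (edge_arr \<nu>) x l"
    "\<And>F :: ('x, 'y, 'x, 'y) functr.
      \<lbrakk>is_functor F; fdom F = CC (src L \<nu>); preserves_small_limits k F\<rbrakk> \<Longrightarrow>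
      graph_limit (fcod F) (nodes \<nu>) (\<lambda>i. fobj F (dgm \<nu> i)) (edges \<nu>) fst (edge_trg \<nu>)
        (\<lambda>e. farr F (edge_arr \<nu> e)) (fobj F x) (\<lambda>i. farr F (l i))"
    by (rule ex_graph_limit[where 'p = 'x and 'n = 'y, OF k 1 2 cat, of "dgm \<nu>" fst "edge_trg \<nu>" "edge_arr \<nu>"])
      (blast intro: dgm_Obj edges_fst edges_trg edge_arr_hom)+
  have "is_lim \<nu> x l"
    unfolding is_lim_def
  proof (intro conjI ballI impI)
    fix \<phi> assume "\<phi> \<in> Cells1 L" "src L \<phi> = src L \<nu>"
    then show "graph_limit (CC (trg L \<phi>)) (nodes \<nu>) (\<lambda>i. T \<phi> (dgm \<nu> i)) (edges \<nu>) fst (edge_trg \<nu>)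
        (\<lambda>e. TA \<phi> (edge_arr \<nu> e)) (T \<phi> x) (\<lambda>i. TA \<phi> (l i))"
      using *(2)[of "act1 C \<phi>"] preserves by simp
  qed (rule *(1))
  then show ?thesis by blast
qed

definition Rob :: "'a \<Rightarrow> 'x" where "Rob \<nu> = (SOME x. \<exists>l. is_lim \<nu> x l)"

definition pr :: "'a \<Rightarrow> 'a \<Rightarrow> 'a \<Rightarrow> 'c \<Rightarrow> 'y" where
  "pr \<nu> \<rho> \<sigma> \<alpha> = (SOME l. is_lim \<nu> (Rob \<nu>) l) (\<rho>, \<sigma>, \<alpha>)"

text \<open>The projections are chosen for the object already chosen, so that \<open>Rob\<close> and
  \<open>pr\<close> belong to one limit cone.\<close>

lemma is_lim_pr:
  assumes "\<nu> \<in> Cells1 L"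
  shows "is_lim \<nu> (Rob \<nu>) (\<lambda>(\<rho>, \<sigma>, \<alpha>). pr \<nu> \<rho> \<sigma> \<alpha>)"
proof -
  have "\<exists>l. is_lim \<nu> (Rob \<nu>) l"
    unfolding Rob_def by (rule someI_ex) (rule ex_lim[OF assms])
  then have "is_lim \<nu> (Rob \<nu>) (SOME l. is_lim \<nu> (Rob \<nu>) l)" by (rule someI_ex)
  moreover have "(\<lambda>(\<rho>, \<sigma>, \<alpha>). pr \<nu> \<rho> \<sigma> \<alpha>) = (SOME l. is_lim \<nu> (Rob \<nu>) l)"
    by (auto simp: pr_def)
  ultimately show ?thesis by simp
qed

lemma graph_cone_pr:
  assumes "\<nu> \<in> Cells1 L"
  shows "graph_cone (CC (src L \<nu>)) (nodes \<nu>) (dgm \<nu>) (edges \<nu>) fst (edge_trg \<nu>) (edge_arr \<nu>) (Rob \<nu>)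
    (\<lambda>(\<rho>, \<sigma>, \<alpha>). pr \<nu> \<rho> \<sigma> \<alpha>)"
  using is_lim_pr[OF assms] by (simp add: is_lim_def graph_limit_def)

lemma Rob_Obj [simp]: "\<nu> \<in> Cells1 L \<Longrightarrow> src L \<nu> = p \<Longrightarrow> Rob \<nu> \<in> Obj (CC p)"
  using graph_cone_pr[of \<nu>] by (auto simp: graph_cone_def)

lemma pr_simps [simp]:
  assumes "node \<nu> \<rho> \<sigma> \<alpha>" "src L \<nu> = p"
  shows "pr \<nu> \<rho> \<sigma> \<alpha> \<in> Arr (CC p)" "Dom (CC p) (pr \<nu> \<rho> \<sigma> \<alpha>) = Rob \<nu>"
    "Cod (CC p) (pr \<nu> \<rho> \<sigma> \<alpha>) = T \<sigma> (hob D \<rho>)"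
  using graph_cone_pr[OF nodeD(1)[OF assms(1)]] assms
  by (auto simp: graph_cone_def nodes_def dgm_def hom_def)

lemma pr_edge:
  assumes n: "node \<nu> \<rho> \<sigma> \<alpha>" and e: "edge \<rho> \<beta> \<tau> \<rho>'" and p: "src L \<nu> = p"
  shows "PC \<sigma> \<tau> (hob D \<rho>') \<cdot>[p] TA \<sigma> (hmor D (\<beta>, \<rho>, \<tau>)) \<cdot>[p] pr \<nu> \<rho> \<sigma> \<alpha> =
    pr \<nu> \<rho>' (\<sigma> \<odot> \<tau>) ((\<alpha> \<rhd> \<tau>) \<bullet> (m \<lhd> \<beta>))"
proof -
  note [simp] = nodeD[OF n] edgeD[OF e] p
  have [simp]: "p \<in> Cells0 L" using L.src_closed[OF nodeD(1)[OF n]] by simp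
  have "((\<rho>, \<sigma>, \<alpha>), Inl (\<beta>, \<tau>)) \<in> edges \<nu>" using n e by (auto simp: edges_def)
  then have "edge_arr \<nu> ((\<rho>, \<sigma>, \<alpha>), Inl (\<beta>, \<tau>)) \<cdot>[p] pr \<nu> \<rho> \<sigma> \<alpha> =
      pr \<nu> \<rho>' (\<sigma> \<odot> \<tau>) ((\<alpha> \<rhd> \<tau>) \<bullet> (m \<lhd> \<beta>))"
    using graph_cone_pr[OF nodeD(1)[OF n]] unfolding graph_cone_def by fastforce
  then show ?thesis using n by simp
qed

lemma pr_edge2:
  assumes n: "node \<nu> \<rho> \<sigma> \<alpha>" and e: "edge2 \<sigma> \<gamma> \<sigma>'" and p: "src L \<nu> = p"
  shows "TT \<gamma> (hob D \<rho>) \<cdot>[p] pr \<nu> \<rho> \<sigma> \<alpha> = pr \<nu> \<rho> \<sigma>' ((\<nu> \<lhd> \<gamma>) \<bullet> \<alpha>)"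
proof -
  note [simp] = nodeD[OF n] edge2D[OF e] p
  have "((\<rho>, \<sigma>, \<alpha>), Inr \<gamma>) \<in> edges \<nu>" using n e by (auto simp: edges_def)
  then show ?thesis
    using graph_cone_pr[OF nodeD(1)[OF n]] unfolding graph_cone_def by fastforce
qed

lemma pr_unique:
  assumes \<nu>: "\<nu> \<in> Cells1 L" "src L \<nu> = p"
    and h: "h \<in> hom (CC p) x (Rob \<nu>)" "h' \<in> hom (CC p) x (Rob \<nu>)"
    and eq: "\<And>\<rho> \<sigma> \<alpha>. node \<nu> \<rho> \<sigma> \<alpha> \<Longrightarrow> pr \<nu> \<rho> \<sigma> \<alpha> \<cdot>[p] h = pr \<nu> \<rho> \<sigma> \<alpha> \<cdot>[p] h'"
  shows "h = h'"
proof (rule graph_limit_unique)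
  show "graph_limit (CC p) (nodes \<nu>) (dgm \<nu>) (edges \<nu>) fst (edge_trg \<nu>) (edge_arr \<nu>) (Rob \<nu>)
      (\<lambda>(\<rho>, \<sigma>, \<alpha>). pr \<nu> \<rho> \<sigma> \<alpha>)"
    using is_lim_pr[OF \<nu>(1)] \<nu>(2) by (simp add: is_lim_def)
qed (use \<nu> h eq edges_fst edges_trg edge_arr_hom L.src_closed[of \<nu>] in \<open>auto simp: hom_iff nodes_def\<close>)

text \<open>The projections stay jointly monic under \<open>C \<phi>\<close> because it preserves
  the limit. The comparison isomorphisms in front move the test into the values of
  \<open>C (\<phi> \<odot> \<sigma>)\<close>, where composites with structure arrows are
  known.\<close>

lemma TA_pr_unique:
  assumes \<nu>: "\<nu> \<in> Cells1 L" "\<phi> \<in> Cells1 L" "src L \<phi> = src L \<nu>" "trg L \<phi> = q" "trg L \<nu> = trg L m"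
    and h: "h \<in> hom (CC q) x (T \<phi> (Rob \<nu>))" "h' \<in> hom (CC q) x (T \<phi> (Rob \<nu>))"
    and eq: "\<And>\<rho> \<sigma> \<alpha>. node \<nu> \<rho> \<sigma> \<alpha> \<Longrightarrow>
      PC \<phi> \<sigma> (hob D \<rho>) \<cdot>[q] TA \<phi> (pr \<nu> \<rho> \<sigma> \<alpha>) \<cdot>[q] h =
      PC \<phi> \<sigma> (hob D \<rho>) \<cdot>[q] TA \<phi> (pr \<nu> \<rho> \<sigma> \<alpha>) \<cdot>[q] h'"
  shows "h = h'"
proof (rule graph_limit_unique)
  have q [simp]: "q \<in> Cells0 L" using \<nu> L.trg_closed[of \<phi>] by auto
  show "category (CC q)" by simp
  show "graph_limit (CC q) (nodes \<nu>) (\<lambda>i. T \<phi> (dgm \<nu> i)) (edges \<nu>) fst (edge_trg \<nu>)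
      (\<lambda>e. TA \<phi> (edge_arr \<nu> e)) (T \<phi> (Rob \<nu>)) (\<lambda>i. TA \<phi> ((\<lambda>(\<rho>, \<sigma>, \<alpha>). pr \<nu> \<rho> \<sigma> \<alpha>) i))"
    using conjunct2[OF is_lim_pr[OF \<nu>(1), unfolded is_lim_def], rule_format, OF \<nu>(2,3)]
    unfolding \<nu>(4) .
  fix i assume "i \<in> nodes \<nu>"
  then obtain \<rho> \<sigma> \<alpha> where i: "i = (\<rho>, \<sigma>, \<alpha>)" "node \<nu> \<rho> \<sigma> \<alpha>" by (auto simp: nodes_def)
  note [simp] = nodeD[OF i(2)] \<nu> h[unfolded hom_iff, THEN conjunct1]
    h[unfolded hom_iff, THEN conjunct2, THEN conjunct1] h[unfolded hom_iff, THEN conjunct2, THEN conjunct2]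
  have "TA \<phi> (pr \<nu> \<rho> \<sigma> \<alpha>) \<cdot>[q] h = TA \<phi> (pr \<nu> \<rho> \<sigma> \<alpha>) \<cdot>[q] h'"
  proof (rule PC_cancel[where f = \<sigma> and g = \<phi> and x = "hob D \<rho>" and p = "src L \<rho>"])
    have "TA \<phi> (pr \<nu> \<rho> \<sigma> \<alpha>) \<in> Arr (CC q)" "Dom (CC q) (TA \<phi> (pr \<nu> \<rho> \<sigma> \<alpha>)) = T \<phi> (Rob \<nu>)"
      "Cod (CC q) (TA \<phi> (pr \<nu> \<rho> \<sigma> \<alpha>)) = T \<phi> (T \<sigma> (hob D \<rho>))" using i(2) by simp_all
    then show "TA \<phi> (pr \<nu> \<rho> \<sigma> \<alpha>) \<cdot>[q] h \<in> Arr (CC q)" "TA \<phi> (pr \<nu> \<rho> \<sigma> \<alpha>) \<cdot>[q] h' \<in> Arr (CC q)"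
      "Cod (CC q) (TA \<phi> (pr \<nu> \<rho> \<sigma> \<alpha>) \<cdot>[q] h) = T \<phi> (T \<sigma> (hob D \<rho>))"
      "Cod (CC q) (TA \<phi> (pr \<nu> \<rho> \<sigma> \<alpha>) \<cdot>[q] h') = T \<phi> (T \<sigma> (hob D \<rho>))" by simp_all
  qed (use eq[OF i(2)] in simp_all)
  then show "TA \<phi> ((\<lambda>(\<rho>, \<sigma>, \<alpha>). pr \<nu> \<rho> \<sigma> \<alpha>) i) \<cdot>[q] h =
      TA \<phi> ((\<lambda>(\<rho>, \<sigma>, \<alpha>). pr \<nu> \<rho> \<sigma> \<alpha>) i) \<cdot>[q] h'" by (simp add: i(1))
next
  fix e assume "e \<in> edges \<nu>"
  then show "TA \<phi> (edge_arr \<nu> e) \<in> hom (CC q) (T \<phi> (dgm \<nu> (fst e))) (T \<phi> (dgm \<nu> (edge_trg \<nu> e)))"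
    using edge_arr_hom[of e \<nu>] \<nu> by (auto simp: hom_iff)
qed (use h edges_fst edges_trg in \<open>auto simp: hom_iff\<close>)

lemma pr_ex:
  assumes \<nu>: "\<nu> \<in> Cells1 L" "src L \<nu> = p" and x: "x \<in> Obj (CC p)"
    and l: "\<And>\<rho> \<sigma> \<alpha>. node \<nu> \<rho> \<sigma> \<alpha> \<Longrightarrow> l \<rho> \<sigma> \<alpha> \<in> hom (CC p) x (T \<sigma> (hob D \<rho>))"
    and l1: "\<And>\<rho> \<sigma> \<alpha> \<beta> \<tau> \<rho>'. node \<nu> \<rho> \<sigma> \<alpha> \<Longrightarrow> edge \<rho> \<beta> \<tau> \<rho>' \<Longrightarrow>
      PC \<sigma> \<tau> (hob D \<rho>') \<cdot>[p] TA \<sigma> (hmor D (\<beta>, \<rho>, \<tau>)) \<cdot>[p] l \<rho> \<sigma> \<alpha>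
      = l \<rho>' (\<sigma> \<odot> \<tau>) ((\<alpha> \<rhd> \<tau>) \<bullet> (m \<lhd> \<beta>))"
    and l2: "\<And>\<rho> \<sigma> \<alpha> \<gamma> \<sigma>'. node \<nu> \<rho> \<sigma> \<alpha> \<Longrightarrow> edge2 \<sigma> \<gamma> \<sigma>' \<Longrightarrow>
      TT \<gamma> (hob D \<rho>) \<cdot>[p] l \<rho> \<sigma> \<alpha> = l \<rho> \<sigma>' ((\<nu> \<lhd> \<gamma>) \<bullet> \<alpha>)"
  shows "\<exists>h. h \<in> hom (CC p) x (Rob \<nu>) \<and>
    (\<forall>\<rho> \<sigma> \<alpha>. node \<nu> \<rho> \<sigma> \<alpha> \<longrightarrow> pr \<nu> \<rho> \<sigma> \<alpha> \<cdot>[p] h = l \<rho> \<sigma> \<alpha>)"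
proof -
  have [simp]: "p \<in> Cells0 L" using \<nu> L.src_closed by auto
  have "graph_cone (CC p) (nodes \<nu>) (dgm \<nu>) (edges \<nu>) fst (edge_trg \<nu>) (edge_arr \<nu>) x
      (\<lambda>(\<rho>, \<sigma>, \<alpha>). l \<rho> \<sigma> \<alpha>)"
    unfolding graph_cone_def
  proof (intro conjI ballI)
    fix e assume "e \<in> edges \<nu>"
    then show "edge_arr \<nu> e \<cdot>[p] (case fst e of (\<rho>, \<sigma>, \<alpha>) \<Rightarrow> l \<rho> \<sigma> \<alpha>) =
      (case edge_trg \<nu> e of (\<rho>, \<sigma>, \<alpha>) \<Rightarrow> l \<rho> \<sigma> \<alpha>)"
    proof (cases rule: edgesE)
      case (1 \<rho> \<sigma> \<alpha> \<beta> \<tau> \<rho>')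
      have "l \<rho> \<sigma> \<alpha> \<in> Arr (CC p)" "Cod (CC p) (l \<rho> \<sigma> \<alpha>) = T \<sigma> (hob D \<rho>)"
        using l[OF 1(2)] by (auto simp: hom_iff)
      then show ?thesis
        using l1[OF 1(2,3)] \<nu> nodeD[OF 1(2)] edgeD[OF 1(3)] by (simp add: 1(1))
    next
      case (2 \<rho> \<sigma> \<alpha> \<gamma> \<sigma>')
      then show ?thesis using l2[OF 2(2,3)] by simp
    qed
  qed (use x l in \<open>auto simp: nodes_def dgm_def\<close>)
  then obtain h where "h \<in> hom (CC p) x (Rob \<nu>)"
    "\<forall>i\<in>nodes \<nu>. (case i of (\<rho>, \<sigma>, \<alpha>) \<Rightarrow> pr \<nu> \<rho> \<sigma> \<alpha>) \<cdot>[p] h = (case i of (\<rho>, \<sigma>, \<alpha>) \<Rightarrow> l \<rho> \<sigma> \<alpha>)"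
    using is_lim_pr[OF \<nu>(1)] unfolding is_lim_def graph_limit_def \<nu>(2) by blast
  then show ?thesis unfolding nodes_def by auto
qed

text \<open>The existence half of the preserved limit property, for legs in
  \<open>C (\<phi> \<odot> \<sigma>) (D \<rho>)\<close> instead of
  \<open>C \<phi> (C \<sigma> (D \<rho>))\<close>. The legs are lifted through the comparison
  isomorphisms, and the cone equations of the lifts are verified after composing with these
  again.\<close>

lemma TA_pr_ex:
  assumes \<nu>: "\<nu> \<in> Cells1 L" "\<phi> \<in> Cells1 L" "src L \<phi> = src L \<nu>" "trg L \<phi> = q" "trg L \<nu> = trg L m"
    and x: "x \<in> Obj (CC q)"
    and l: "\<And>\<rho> \<sigma> \<alpha>. node \<nu> \<rho> \<sigma> \<alpha> \<Longrightarrow> l \<rho> \<sigma> \<alpha> \<in> hom (CC q) x (T (\<phi> \<odot> \<sigma>) (hob D \<rho>))"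
    and l1: "\<And>\<rho> \<sigma> \<alpha> \<beta> \<tau> \<rho>'. node \<nu> \<rho> \<sigma> \<alpha> \<Longrightarrow> edge \<rho> \<beta> \<tau> \<rho>' \<Longrightarrow>
      PC (\<phi> \<odot> \<sigma>) \<tau> (hob D \<rho>') \<cdot>[q] TA (\<phi> \<odot> \<sigma>) (hmor D (\<beta>, \<rho>, \<tau>)) \<cdot>[q] l \<rho> \<sigma> \<alpha>
      = l \<rho>' (\<sigma> \<odot> \<tau>) ((\<alpha> \<rhd> \<tau>) \<bullet> (m \<lhd> \<beta>))"
    and l2: "\<And>\<rho> \<sigma> \<alpha> \<gamma> \<sigma>'. node \<nu> \<rho> \<sigma> \<alpha> \<Longrightarrow> edge2 \<sigma> \<gamma> \<sigma>' \<Longrightarrow>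
      TT (\<phi> \<lhd> \<gamma>) (hob D \<rho>) \<cdot>[q] l \<rho> \<sigma> \<alpha> = l \<rho> \<sigma>' ((\<nu> \<lhd> \<gamma>) \<bullet> \<alpha>)"
  shows "\<exists>h. h \<in> hom (CC q) x (T \<phi> (Rob \<nu>)) \<and>
    (\<forall>\<rho> \<sigma> \<alpha>. node \<nu> \<rho> \<sigma> \<alpha> \<longrightarrow> PC \<phi> \<sigma> (hob D \<rho>) \<cdot>[q] TA \<phi> (pr \<nu> \<rho> \<sigma> \<alpha>) \<cdot>[q] h = l \<rho> \<sigma> \<alpha>)"
proof -
  have [simp]: "q \<in> Cells0 L" using \<nu> L.trg_closed by auto
  note [simp] = \<nu>
  have "\<exists>h. h \<in> hom (CC q) x (T \<phi> (T \<sigma> (hob D \<rho>))) \<and> PC \<phi> \<sigma> (hob D \<rho>) \<cdot>[q] h = l \<rho> \<sigma> \<alpha>"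
    if n: "node \<nu> \<rho> \<sigma> \<alpha>" for \<rho> \<sigma> \<alpha>
    using PC_lift[OF _ _ _ _ _ _ l[OF n], of "src L \<sigma>"] nodeD[OF n] by (metis D \<nu> hob_Obj)
  then obtain l' where l': "\<And>\<rho> \<sigma> \<alpha>. node \<nu> \<rho> \<sigma> \<alpha> \<Longrightarrow>
        l' \<rho> \<sigma> \<alpha> \<in> hom (CC q) x (T \<phi> (T \<sigma> (hob D \<rho>)))"
      and PC_l': "\<And>\<rho> \<sigma> \<alpha>. node \<nu> \<rho> \<sigma> \<alpha> \<Longrightarrow> PC \<phi> \<sigma> (hob D \<rho>) \<cdot>[q] l' \<rho> \<sigma> \<alpha> = l \<rho> \<sigma> \<alpha>"
    by metis
  have l'_simps: "l' \<rho> \<sigma> \<alpha> \<in> Arr (CC q)" "Dom (CC q) (l' \<rho> \<sigma> \<alpha>) = x"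
    "Cod (CC q) (l' \<rho> \<sigma> \<alpha>) = T \<phi> (T \<sigma> (hob D \<rho>))" if "node \<nu> \<rho> \<sigma> \<alpha>" for \<rho> \<sigma> \<alpha>
    using l'[OF that] by (auto simp: hom_iff)
  have "graph_cone (CC q) (nodes \<nu>) (\<lambda>i. T \<phi> (dgm \<nu> i)) (edges \<nu>) fst (edge_trg \<nu>)
      (\<lambda>e. TA \<phi> (edge_arr \<nu> e)) x (\<lambda>(\<rho>, \<sigma>, \<alpha>). l' \<rho> \<sigma> \<alpha>)"
    unfolding graph_cone_def
  proof (intro conjI ballI)
    fix e assume "e \<in> edges \<nu>"
    then show "TA \<phi> (edge_arr \<nu> e) \<cdot>[q] (case fst e of (\<rho>, \<sigma>, \<alpha>) \<Rightarrow> l' \<rho> \<sigma> \<alpha>) =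
      (case edge_trg \<nu> e of (\<rho>, \<sigma>, \<alpha>) \<Rightarrow> l' \<rho> \<sigma> \<alpha>)"
    proof (cases rule: edgesE)
      case (1 \<rho> \<sigma> \<alpha> \<beta> \<tau> \<rho>')
      note n' = node_edge[OF 1(2,3)]
      note [simp] = nodeD[OF 1(2)] edgeD[OF 1(3)] l'_simps[OF 1(2)] l'_simps[OF n']
      let ?D = "hmor D (\<beta>, \<rho>, \<tau>)" and ?y = "hob D \<rho>'" and ?l = "l' \<rho> \<sigma> \<alpha>"
      \<comment> \<open>\<open>assoc\<close> and \<open>nat\<close> move the comparison for
        \<open>\<phi>\<close> and \<open>\<sigma> \<odot> \<tau>\<close> across the edge, where it
        arrives as the comparison for \<open>\<phi>\<close> and \<open>\<sigma>\<close> that turns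
        the lifted leg back into \<open>l\<close>.\<close>
      have nat: "TA (\<phi> \<odot> \<sigma>) ?D \<cdot>[q] PC \<phi> \<sigma> (hob D \<rho>) = PC \<phi> \<sigma> (T \<tau> ?y) \<cdot>[q] TA \<phi> (TA \<sigma> ?D)"
        by (rule PC_natural[where p = "src L \<rho>"]) simp_all
      have assoc: "PC \<phi> (\<sigma> \<odot> \<tau>) ?y \<cdot>[q] TA \<phi> (PC \<sigma> \<tau> ?y) = PC (\<phi> \<odot> \<sigma>) \<tau> ?y \<cdot>[q] PC \<phi> \<sigma> (T \<tau> ?y)"
        by (rule PC_assoc[where p = "src L \<tau>"]) simp_all
      have "TA \<phi> (edge_arr \<nu> e) \<cdot>[q] ?l = l' \<rho>' (\<sigma> \<odot> \<tau>) ((\<alpha> \<rhd> \<tau>) \<bullet> (m \<lhd> \<beta>))"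
      proof (rule PC_cancel[where f = "\<sigma> \<odot> \<tau>" and g = \<phi> and x = ?y and p = "src L \<tau>"])
        have "PC \<phi> (\<sigma> \<odot> \<tau>) ?y \<cdot>[q] TA \<phi> (edge_arr \<nu> e) \<cdot>[q] ?l =
            (PC \<phi> (\<sigma> \<odot> \<tau>) ?y \<cdot>[q] TA \<phi> (PC \<sigma> \<tau> ?y)) \<cdot>[q] TA \<phi> (TA \<sigma> ?D) \<cdot>[q] ?l"
          by (simp add: 1(1))
        also have "\<dots> = PC (\<phi> \<odot> \<sigma>) \<tau> ?y \<cdot>[q] (PC \<phi> \<sigma> (T \<tau> ?y) \<cdot>[q] TA \<phi> (TA \<sigma> ?D)) \<cdot>[q] ?l"
          unfolding assoc by simp
        also have "\<dots> = PC (\<phi> \<odot> \<sigma>) \<tau> ?y \<cdot>[q] TA (\<phi> \<odot> \<sigma>) ?D \<cdot>[q] PC \<phi> \<sigma> (hob D \<rho>) \<cdot>[q] ?l"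
          unfolding nat[symmetric] by simp
        also have "\<dots> = PC \<phi> (\<sigma> \<odot> \<tau>) ?y \<cdot>[q] l' \<rho>' (\<sigma> \<odot> \<tau>) ((\<alpha> \<rhd> \<tau>) \<bullet> (m \<lhd> \<beta>))"
          unfolding PC_l'[OF 1(2)] PC_l'[OF n'] l1[OF 1(2,3)] ..
        finally show "PC \<phi> (\<sigma> \<odot> \<tau>) ?y \<cdot>[q] TA \<phi> (edge_arr \<nu> e) \<cdot>[q] ?l =
          PC \<phi> (\<sigma> \<odot> \<tau>) ?y \<cdot>[q] l' \<rho>' (\<sigma> \<odot> \<tau>) ((\<alpha> \<rhd> \<tau>) \<bullet> (m \<lhd> \<beta>))" .
      qed (simp_all add: 1(1))
      then show ?thesis by (simp add: 1(1))
    next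
      case (2 \<rho> \<sigma> \<alpha> \<gamma> \<sigma>')
      note n' = node_edge2[OF 2(2,3)]
      note [simp] = nodeD[OF 2(2)] edge2D[OF 2(3)] l'_simps[OF 2(2)] l'_simps[OF n']
      have w: "TT (\<phi> \<lhd> \<gamma>) (hob D \<rho>) \<cdot>[q] PC \<phi> \<sigma> (hob D \<rho>) = PC \<phi> \<sigma>' (hob D \<rho>) \<cdot>[q] TA \<phi> (TT \<gamma> (hob D \<rho>))"
        by (rule PC_lwhisk[where p = "src L \<rho>"]) simp_all
      have "TA \<phi> (TT \<gamma> (hob D \<rho>)) \<cdot>[q] l' \<rho> \<sigma> \<alpha> = l' \<rho> \<sigma>' ((\<nu> \<lhd> \<gamma>) \<bullet> \<alpha>)"
      proof (rule PC_cancel[where f = \<sigma>' and g = \<phi> and x = "hob D \<rho>" and p = "src L \<rho>"])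
        have "PC \<phi> \<sigma>' (hob D \<rho>) \<cdot>[q] TA \<phi> (TT \<gamma> (hob D \<rho>)) \<cdot>[q] l' \<rho> \<sigma> \<alpha> =
            (PC \<phi> \<sigma>' (hob D \<rho>) \<cdot>[q] TA \<phi> (TT \<gamma> (hob D \<rho>))) \<cdot>[q] l' \<rho> \<sigma> \<alpha>" by simp
        also have "\<dots> = TT (\<phi> \<lhd> \<gamma>) (hob D \<rho>) \<cdot>[q] PC \<phi> \<sigma> (hob D \<rho>) \<cdot>[q] l' \<rho> \<sigma> \<alpha>"
          unfolding w[symmetric] by simp
        also have "\<dots> = PC \<phi> \<sigma>' (hob D \<rho>) \<cdot>[q] l' \<rho> \<sigma>' ((\<nu> \<lhd> \<gamma>) \<bullet> \<alpha>)"
          unfolding PC_l'[OF 2(2)] PC_l'[OF n'] l2[OF 2(2,3)] ..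
        finally show "PC \<phi> \<sigma>' (hob D \<rho>) \<cdot>[q] TA \<phi> (TT \<gamma> (hob D \<rho>)) \<cdot>[q] l' \<rho> \<sigma> \<alpha> =
          PC \<phi> \<sigma>' (hob D \<rho>) \<cdot>[q] l' \<rho> \<sigma>' ((\<nu> \<lhd> \<gamma>) \<bullet> \<alpha>)" .
      qed simp_all
      then show ?thesis by (simp add: 2(1))
    qed
  qed (use x l' in \<open>auto simp: nodes_def dgm_def\<close>)
  then obtain h where h: "h \<in> hom (CC q) x (T \<phi> (Rob \<nu>))"
    "\<forall>i\<in>nodes \<nu>. TA \<phi> (case i of (\<rho>, \<sigma>, \<alpha>) \<Rightarrow> pr \<nu> \<rho> \<sigma> \<alpha>) \<cdot>[q] h = (case i of (\<rho>, \<sigma>, \<alpha>) \<Rightarrow> l' \<rho> \<sigma> \<alpha>)"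
    using conjunct2[OF is_lim_pr[OF \<nu>(1), unfolded is_lim_def], rule_format, OF \<nu>(2,3)]
    unfolding graph_limit_def \<nu>(4) by blast
  have "TA \<phi> (pr \<nu> \<rho> \<sigma> \<alpha>) \<cdot>[q] h = l' \<rho> \<sigma> \<alpha>" if "node \<nu> \<rho> \<sigma> \<alpha>" for \<rho> \<sigma> \<alpha>
    using h(2) that by (auto simp: nodes_def)
  then show ?thesis using h(1) PC_l' by auto
qed

text \<open>A structure arrow of the right adjoint is prescribed by its composites with the
  projections of the limit at \<open>vsrc L a\<close>: these are the projections of the limit at
  \<open>n\<close> at the nodes of \<open>node_decomp\<close>.\<close>

definition is_Rmor where
  "is_Rmor a n s h \<longleftrightarrow> h \<in> hom (CC (src L n)) (Rob n) (T s (Rob (vsrc L a))) \<and>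
    (\<forall>\<rho> \<sigma> \<alpha>. node (vsrc L a) \<rho> \<sigma> \<alpha> \<longrightarrow>
      PC s \<sigma> (hob D \<rho>) \<cdot>[src L n] TA s (pr (vsrc L a) \<rho> \<sigma> \<alpha>) \<cdot>[src L n] h =
      pr n \<rho> (s \<odot> \<sigma>) ((a \<rhd> \<sigma>) \<bullet> \<alpha>))"

definition Rmor where "Rmor a n s = (SOME h. is_Rmor a n s h)"

definition Robj :: "('a, 'c, 'x, 'y) hat_obj" where
  "Robj = \<lparr>hob = (\<lambda>\<nu>\<in>into L (trg L m). Rob \<nu>),
     hmor = (\<lambda>x\<in>decomps L (trg L m). case x of (a, n, s) \<Rightarrow> Rmor a n s)\<rparr>"

text \<open>Pasting with \<open>a\<close> respects both kinds of edges, so the projections of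
  \<open>Rob n\<close> at the pasted nodes satisfy the cone equations that \<open>TA_pr_ex\<close>
  demands.\<close>

lemma is_Rmor_Rmor:
  assumes a: "a \<in> Cells2 L" "n \<in> Cells1 L" "s \<in> Cells1 L" "trg L s = src L n" "trg L n = trg L m"
    "vtrg L a = n \<odot> s"
  shows "is_Rmor a n s (Rmor a n s)"
proof -
  define \<mu> where "\<mu> = vsrc L a"
  have \<mu>: "\<mu> \<in> Cells1 L" "src L \<mu> = src L s" "trg L \<mu> = trg L m" "vsrc L a = \<mu>"
    using vsrc_decomp[OF a(1-4,6)] a(5) by (auto simp: \<mu>_def)
  note [simp] = a \<mu>
  let ?q = "src L n" and ?l = "\<lambda>\<rho> \<sigma> \<alpha>. pr n \<rho> (s \<odot> \<sigma>) ((a \<rhd> \<sigma>) \<bullet> \<alpha>)"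
  have "\<exists>h. h \<in> hom (CC ?q) (Rob n) (T s (Rob \<mu>)) \<and> (\<forall>\<rho> \<sigma> \<alpha>. node \<mu> \<rho> \<sigma> \<alpha> \<longrightarrow>
      PC s \<sigma> (hob D \<rho>) \<cdot>[?q] TA s (pr \<mu> \<rho> \<sigma> \<alpha>) \<cdot>[?q] h = ?l \<rho> \<sigma> \<alpha>)"
  proof (rule TA_pr_ex)
    fix \<rho> \<sigma> \<alpha> assume n: "node \<mu> \<rho> \<sigma> \<alpha>"
    note [simp] = nodeD[OF n]
    have n': "node n \<rho> (s \<odot> \<sigma>) ((a \<rhd> \<sigma>) \<bullet> \<alpha>)" by (rule node_decomp[OF n]) simp_all
    show "?l \<rho> \<sigma> \<alpha> \<in> hom (CC ?q) (Rob n) (T (s \<odot> \<sigma>) (hob D \<rho>))"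
      using n' by (simp add: hom_iff)
    show "PC (s \<odot> \<sigma>) \<tau> (hob D \<rho>') \<cdot>[?q] TA (s \<odot> \<sigma>) (hmor D (\<beta>, \<rho>, \<tau>)) \<cdot>[?q] ?l \<rho> \<sigma> \<alpha> =
      ?l \<rho>' (\<sigma> \<odot> \<tau>) ((\<alpha> \<rhd> \<tau>) \<bullet> (m \<lhd> \<beta>))" if e: "edge \<rho> \<beta> \<tau> \<rho>'" for \<beta> \<tau> \<rho>'
      using pr_edge[OF n' e] edgeD[OF e] by simp
    show "TT (s \<lhd> \<gamma>) (hob D \<rho>) \<cdot>[?q] ?l \<rho> \<sigma> \<alpha> = ?l \<rho> \<sigma>' ((\<mu> \<lhd> \<gamma>) \<bullet> \<alpha>)"
      if e: "edge2 \<sigma> \<gamma> \<sigma>'" for \<gamma> \<sigma>'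
    proof -
      note [simp] = edge2D[OF e]
      have e': "edge2 (s \<odot> \<sigma>) (s \<lhd> \<gamma>) (s \<odot> \<sigma>')" by (simp add: edge2_def)
      \<comment> \<open>Replacing \<open>\<sigma>\<close> along \<open>\<gamma>\<close> before or
        after pasting with \<open>a\<close> gives the same node, as both composites are the
        horizontal composite of \<open>a\<close> and \<open>\<gamma>\<close>.\<close>
      have "((n \<odot> s) \<lhd> \<gamma>) \<bullet> (a \<rhd> \<sigma>) = (a \<rhd> \<sigma>') \<bullet> (\<mu> \<lhd> \<gamma>)"
        using L.whisk_exchange[of \<gamma> a \<sigma> \<sigma>' \<mu> "n \<odot> s"] by simp
      then have "(((n \<odot> s) \<lhd> \<gamma>) \<bullet> (a \<rhd> \<sigma>)) \<bullet> \<alpha> = ((a \<rhd> \<sigma>') \<bullet> (\<mu> \<lhd> \<gamma>)) \<bullet> \<alpha>"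
        by simp
      then show ?thesis using pr_edge2[OF n' e'] by simp
    qed
  qed simp_all
  then have "\<exists>h. is_Rmor a n s h" unfolding is_Rmor_def \<mu>(4) .
  then show ?thesis unfolding Rmor_def by (rule someI_ex)
qed

context
  fixes a n s \<mu> q
  assumes a: "a \<in> Cells2 L" "n \<in> Cells1 L" "s \<in> Cells1 L" "trg L s = src L n" "trg L n = trg L m"
    "vtrg L a = n \<odot> s" "vsrc L a = \<mu>" "src L n = q"
begin

lemma Rmor_simps:
  "Rmor a n s \<in> Arr (CC q)" "Dom (CC q) (Rmor a n s) = Rob n" "Cod (CC q) (Rmor a n s) = T s (Rob \<mu>)"
  using is_Rmor_Rmor[OF a(1-6)] a(7,8) by (auto simp: is_Rmor_def hom_iff)

lemma pr_Rmor:
  "node \<mu> \<rho> \<sigma> \<alpha> \<Longrightarrow> PC s \<sigma> (hob D \<rho>) \<cdot>[q] TA s (pr \<mu> \<rho> \<sigma> \<alpha>) \<cdot>[q] Rmor a n s =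
    pr n \<rho> (s \<odot> \<sigma>) ((a \<rhd> \<sigma>) \<bullet> \<alpha>)"
  using is_Rmor_Rmor[OF a(1-6)] a(7,8) by (auto simp: is_Rmor_def)

end

section \<open>The value of the right adjoint at \<open>D\<close>\<close>

lemma Robj_simps [simp]:
  "\<nu> \<in> Cells1 L \<Longrightarrow> trg L \<nu> = trg L m \<Longrightarrow> hob Robj \<nu> = Rob \<nu>"
  "\<lbrakk>a \<in> Cells2 L; n \<in> Cells1 L; s \<in> Cells1 L; trg L s = src L n; trg L n = trg L m;
    vtrg L a = n \<odot> s\<rbrakk> \<Longrightarrow> hmor Robj (a, n, s) = Rmor a n s"
  by (simp_all add: Robj_def)

text \<open>Each equation is between arrows into some \<open>C \<phi> (Rob \<mu>)\<close>, so by
  \<open>TA_pr_unique\<close> it can be tested on projections. There both sides become one and the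
  same projection of the limit at their domain.\<close>

lemma is_hat_obj_Robj [simp]: "is_hat_obj L C (trg L m) Robj"
proof (rule is_hat_objI)
  show "hob Robj \<in> extensional (into L (trg L m))" "hmor Robj \<in> extensional (decomps L (trg L m))"
    by (simp_all add: Robj_def)
  fix \<mu> assume \<mu>: "\<mu> \<in> Cells1 L" "trg L \<mu> = trg L m"
  note [simp] = \<mu>
  let ?p = "src L \<mu>"
  show "hob Robj \<mu> \<in> Obj (CC ?p)" by simp
  note R [simp] = Rmor_simps[of "id2 L \<mu>" \<mu> "id1 L ?p" \<mu> ?p]
  have "Rmor (id2 L \<mu>) \<mu> (id1 L ?p) = U ?p (Rob \<mu>)"
  proof (rule TA_pr_unique[where \<phi> = "id1 L ?p" and \<nu> = \<mu> and q = ?p and x = "Rob \<mu>"])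
    fix \<rho> \<sigma> \<alpha> assume n: "node \<mu> \<rho> \<sigma> \<alpha>"
    note [simp] = nodeD[OF n]
    \<comment> \<open>The unit slides past the projection by naturality and is then cancelled by the
      left unit law.\<close>
    have "PC (id1 L ?p) \<sigma> (hob D \<rho>) \<cdot>[?p] TA (id1 L ?p) (pr \<mu> \<rho> \<sigma> \<alpha>) \<cdot>[?p] U ?p (Rob \<mu>) =
        PC (id1 L ?p) \<sigma> (hob D \<rho>) \<cdot>[?p] U ?p (T \<sigma> (hob D \<rho>)) \<cdot>[?p] pr \<mu> \<rho> \<sigma> \<alpha>"
      using U_natural[of ?p "pr \<mu> \<rho> \<sigma> \<alpha>" "Rob \<mu>" "T \<sigma> (hob D \<rho>)"] n by simp
    also have "\<dots> = (PC (id1 L ?p) \<sigma> (hob D \<rho>) \<cdot>[?p] U ?p (T \<sigma> (hob D \<rho>))) \<cdot>[?p] pr \<mu> \<rho> \<sigma> \<alpha>"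
      using n by simp
    also have "\<dots> = pr \<mu> \<rho> \<sigma> \<alpha>"
      using PC_id1_left[of \<sigma> "src L \<rho>" ?p "hob D \<rho>"] n by simp
    also have "\<dots> = PC (id1 L ?p) \<sigma> (hob D \<rho>) \<cdot>[?p] TA (id1 L ?p) (pr \<mu> \<rho> \<sigma> \<alpha>) \<cdot>[?p]
        Rmor (id2 L \<mu>) \<mu> (id1 L ?p)"
      using pr_Rmor[of "id2 L \<mu>" \<mu> "id1 L ?p" \<mu> ?p, OF _ _ _ _ _ _ _ _ n] by simp
    finally show "PC (id1 L ?p) \<sigma> (hob D \<rho>) \<cdot>[?p] TA (id1 L ?p) (pr \<mu> \<rho> \<sigma> \<alpha>) \<cdot>[?p]
        Rmor (id2 L \<mu>) \<mu> (id1 L ?p) =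
      PC (id1 L ?p) \<sigma> (hob D \<rho>) \<cdot>[?p] TA (id1 L ?p) (pr \<mu> \<rho> \<sigma> \<alpha>) \<cdot>[?p] U ?p (Rob \<mu>)" by (rule HOL.sym)
  qed (simp_all add: hom_iff)
  then show "hmor Robj (id2 L \<mu>, \<mu>, id1 L (src L \<mu>)) = U (src L \<mu>) (hob Robj \<mu>)" by simp
next
  fix a n s
  assume a: "a \<in> Cells2 L" "n \<in> Cells1 L" "s \<in> Cells1 L" "trg L s = src L n" "trg L n = trg L m"
    "vtrg L a = n \<odot> s"
  define \<mu> where "\<mu> = vsrc L a"
  have \<mu>: "\<mu> \<in> Cells1 L" "src L \<mu> = src L s" "trg L \<mu> = trg L m" "vsrc L a = \<mu>"
    using vsrc_decomp[OF a(1-4,6)] a(5) by (auto simp: \<mu>_def)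
  note [simp] = a \<mu> Rmor_simps[OF a \<mu>(4) HOL.refl]
  show "hmor Robj (a, n, s) \<in> hom (CC (src L n)) (hob Robj n) (T s (hob Robj (vsrc L a)))"
    by (simp add: hom_iff)
  note pr_a = pr_Rmor[OF a \<mu>(4) HOL.refl]
  show "PC t s (hob Robj (vsrc L a)) \<cdot>[src L w] TA t (hmor Robj (a, n, s)) \<cdot>[src L w]
      hmor Robj (b, w, t) = hmor Robj ((b \<rhd> s) \<bullet> a, w, t \<odot> s)"
    if b: "b \<in> Cells2 L" "w \<in> Cells1 L" "t \<in> Cells1 L" "trg L t = src L w" "trg L w = trg L m"
      "vtrg L b = w \<odot> t" "vsrc L b = n" for b w t
  proof -
    have t: "src L t = src L n" using vsrc_decomp[OF b(1-4,6)] b(7) by simp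
    let ?q = "src L w" and ?ba = "(b \<rhd> s) \<bullet> a"
    note [simp] = b t Rmor_simps[OF b HOL.refl]
    note [simp] = Rmor_simps[of ?ba w "t \<odot> s" \<mu> ?q]
    have "PC t s (Rob \<mu>) \<cdot>[?q] TA t (Rmor a n s) \<cdot>[?q] Rmor b w t = Rmor ?ba w (t \<odot> s)"
    proof (rule TA_pr_unique[where \<phi> = "t \<odot> s" and \<nu> = \<mu> and q = ?q and x = "Rob w"])
      fix \<rho> \<sigma> \<alpha> assume nd: "node \<mu> \<rho> \<sigma> \<alpha>"
      note [simp] = nodeD[OF nd]
      have n': "node n \<rho> (s \<odot> \<sigma>) ((a \<rhd> \<sigma>) \<bullet> \<alpha>)" by (rule node_decomp[OF nd]) simp_all
      let ?y = "hob D \<rho>" and ?pr = "pr \<mu> \<rho> \<sigma> \<alpha>"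
      have nat: "TA (t \<odot> s) ?pr \<cdot>[?q] PC t s (Rob \<mu>) = PC t s (T \<sigma> ?y) \<cdot>[?q] TA t (TA s ?pr)"
        by (rule PC_natural[where p = "src L s"]) (use nd in simp_all)
      have assoc: "PC t (s \<odot> \<sigma>) ?y \<cdot>[?q] TA t (PC s \<sigma> ?y) = PC (t \<odot> s) \<sigma> ?y \<cdot>[?q] PC t s (T \<sigma> ?y)"
        by (rule PC_assoc[where p = "src L \<sigma>"]) simp_all
      have "PC (t \<odot> s) \<sigma> ?y \<cdot>[?q] TA (t \<odot> s) ?pr \<cdot>[?q]
            PC t s (Rob \<mu>) \<cdot>[?q] TA t (Rmor a n s) \<cdot>[?q] Rmor b w t =
          PC (t \<odot> s) \<sigma> ?y \<cdot>[?q] (TA (t \<odot> s) ?pr \<cdot>[?q] PC t s (Rob \<mu>)) \<cdot>[?q]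
            TA t (Rmor a n s) \<cdot>[?q] Rmor b w t" using nd by simp
      also have "\<dots> = (PC (t \<odot> s) \<sigma> ?y \<cdot>[?q] PC t s (T \<sigma> ?y)) \<cdot>[?q] TA t (TA s ?pr) \<cdot>[?q]
            TA t (Rmor a n s) \<cdot>[?q] Rmor b w t" unfolding nat using nd by simp
      also have "\<dots> = PC t (s \<odot> \<sigma>) ?y \<cdot>[?q]
          TA t (PC s \<sigma> ?y \<cdot>[src L n] TA s ?pr \<cdot>[src L n] Rmor a n s) \<cdot>[?q] Rmor b w t"
        unfolding assoc[symmetric] using nd by simp
      also have "\<dots> = pr w \<rho> (t \<odot> s \<odot> \<sigma>) ((b \<rhd> (s \<odot> \<sigma>)) \<bullet> (a \<rhd> \<sigma>) \<bullet> \<alpha>)"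
        unfolding pr_a[OF nd] by (rule pr_Rmor[OF b HOL.refl n'])
      also have "\<dots> = PC (t \<odot> s) \<sigma> ?y \<cdot>[?q] TA (t \<odot> s) ?pr \<cdot>[?q] Rmor ?ba w (t \<odot> s)"
        using pr_Rmor[of ?ba w "t \<odot> s" \<mu> ?q, OF _ _ _ _ _ _ _ _ nd] by simp
      finally show "PC (t \<odot> s) \<sigma> ?y \<cdot>[?q] TA (t \<odot> s) ?pr \<cdot>[?q]
            PC t s (Rob \<mu>) \<cdot>[?q] TA t (Rmor a n s) \<cdot>[?q] Rmor b w t =
        PC (t \<odot> s) \<sigma> ?y \<cdot>[?q] TA (t \<odot> s) ?pr \<cdot>[?q] Rmor ?ba w (t \<odot> s)" .
    qed (simp_all add: hom_iff)
    then show ?thesis by simp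
  qed
  show "TT b (hob Robj (vsrc L a)) \<cdot>[src L n] hmor Robj (a, n, s) =
      hmor Robj ((n \<lhd> b) \<bullet> a, n, vtrg L b)"
    if b: "b \<in> Cells2 L" "vsrc L b = s" for b
  proof -
    define t where "t = vtrg L b"
    have t: "t \<in> Cells1 L" "src L t = src L s" "trg L t = src L n" "vtrg L b = t"
      using b by (auto simp: t_def)
    let ?q = "src L n" and ?ba = "(n \<lhd> b) \<bullet> a"
    note [simp] = b t
    note [simp] = Rmor_simps[of ?ba n t \<mu> ?q]
    have "TT b (Rob \<mu>) \<cdot>[?q] Rmor a n s = Rmor ?ba n t"
    proof (rule TA_pr_unique[where \<phi> = t and \<nu> = \<mu> and q = ?q and x = "Rob n"])
      fix \<rho> \<sigma> \<alpha> assume nd: "node \<mu> \<rho> \<sigma> \<alpha>"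
      note [simp] = nodeD[OF nd]
      have n': "node n \<rho> (s \<odot> \<sigma>) ((a \<rhd> \<sigma>) \<bullet> \<alpha>)" by (rule node_decomp[OF nd]) simp_all
      let ?y = "hob D \<rho>" and ?pr = "pr \<mu> \<rho> \<sigma> \<alpha>"
      have nat: "TA t ?pr \<cdot>[?q] TT b (Rob \<mu>) = TT b (T \<sigma> ?y) \<cdot>[?q] TA s ?pr"
        by (rule TT_natural[where p = "src L s"]) (use nd in simp_all)
      have w: "TT (b \<rhd> \<sigma>) ?y \<cdot>[?q] PC s \<sigma> ?y = PC t \<sigma> ?y \<cdot>[?q] TT b (T \<sigma> ?y)"
        by (rule PC_rwhisk[where p = "src L \<sigma>"]) simp_all
      \<comment> \<open>The axiom for a 2-cell \<open>b\<close> out of \<open>s\<close> becomes,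
        after projecting, an edge of the second kind in the diagram at \<open>n\<close>.\<close>
      have e: "edge2 (s \<odot> \<sigma>) (b \<rhd> \<sigma>) (t \<odot> \<sigma>)" by (simp add: edge2_def)
      have "PC t \<sigma> ?y \<cdot>[?q] TA t ?pr \<cdot>[?q] TT b (Rob \<mu>) \<cdot>[?q] Rmor a n s =
          PC t \<sigma> ?y \<cdot>[?q] (TA t ?pr \<cdot>[?q] TT b (Rob \<mu>)) \<cdot>[?q] Rmor a n s" using nd by simp
      also have "\<dots> = (PC t \<sigma> ?y \<cdot>[?q] TT b (T \<sigma> ?y)) \<cdot>[?q] TA s ?pr \<cdot>[?q] Rmor a n s"
        unfolding nat using nd by simp
      also have "\<dots> = TT (b \<rhd> \<sigma>) ?y \<cdot>[?q] (PC s \<sigma> ?y \<cdot>[?q] TA s ?pr \<cdot>[?q] Rmor a n s)"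
        unfolding w[symmetric] using nd by simp
      also have "\<dots> = pr n \<rho> (t \<odot> \<sigma>) ((n \<lhd> (b \<rhd> \<sigma>)) \<bullet> (a \<rhd> \<sigma>) \<bullet> \<alpha>)"
        unfolding pr_a[OF nd] by (rule pr_edge2[OF n' e HOL.refl])
      also have "\<dots> = PC t \<sigma> ?y \<cdot>[?q] TA t ?pr \<cdot>[?q] Rmor ?ba n t"
        using pr_Rmor[of ?ba n t \<mu> ?q, OF _ _ _ _ _ _ _ _ nd] by simp
      finally show "PC t \<sigma> ?y \<cdot>[?q] TA t ?pr \<cdot>[?q] TT b (Rob \<mu>) \<cdot>[?q] Rmor a n s =
          PC t \<sigma> ?y \<cdot>[?q] TA t ?pr \<cdot>[?q] Rmor ?ba n t" .
    qed (simp_all add: hom_iff)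
    then show ?thesis by simp
  qed
qed

text \<open>The projection at the identity
  \<open>m \<odot> \<rho> \<Rightarrow> (m \<odot> \<rho>) \<odot> 1\<close>. It lands in
  \<open>C 1 (D \<rho>)\<close>, whence the inverse unit.\<close>

definition ev :: "'a \<Rightarrow> 'y" where
  "ev \<rho> = V (src L \<rho>) (hob D \<rho>) \<cdot>[src L \<rho>]
    pr (m \<odot> \<rho>) \<rho> (id1 L (src L \<rho>)) (id2 L (m \<odot> \<rho>))"

section \<open>The counit at \<open>D\<close>\<close>

definition counit :: "('a, 'c, 'x, 'y) hat_arr" where
  "counit = \<lparr>hsrc = fobj (hat_fun L C m) Robj, htrg = D, hcmp = (\<lambda>\<rho>\<in>into L (src L m). ev \<rho>)\<rparr>"

lemma node_id2: "\<rho> \<in> Cells1 L \<Longrightarrow> trg L \<rho> = src L m \<Longrightarrow>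
    node (m \<odot> \<rho>) \<rho> (id1 L (src L \<rho>)) (id2 L (m \<odot> \<rho>))"
  by (simp add: node_def)

lemma ev_simps [simp]:
  assumes "\<rho> \<in> Cells1 L" "trg L \<rho> = src L m" "src L \<rho> = p"
  shows "ev \<rho> \<in> Arr (CC p)" "Dom (CC p) (ev \<rho>) = Rob (m \<odot> \<rho>)" "Cod (CC p) (ev \<rho>) = hob D \<rho>"
  using assms node_id2[OF assms(1,2)] L.src_closed[of \<rho>] by (auto simp: ev_def)

lemma counit_simps [simp]:
  "hsrc counit = fobj (hat_fun L C m) Robj" "htrg counit = D"
  "\<rho> \<in> Cells1 L \<Longrightarrow> trg L \<rho> = src L m \<Longrightarrow> hcmp counit \<rho> = ev \<rho>"
  by (simp_all add: counit_def)

text \<open>A Yoneda argument: every node arises from the identity node at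
  \<open>m \<odot> \<rho>\<close> by pasting, so every projection is recovered from
  \<open>ev\<close> and a structure arrow. Naturality of the counit and uniqueness of transposes
  both follow from this.\<close>

lemma TA_ev_Rmor:
  assumes n: "node n \<rho> s a" and q: "src L n = q"
  shows "TA s (ev \<rho>) \<cdot>[q] Rmor a n s = pr n \<rho> s a"
proof -
  note [simp] = nodeD[OF n] q
  note i = node_id2[OF nodeD(2,6)[OF n]]
  have [simp]: "q \<in> Cells0 L" using L.src_closed[OF nodeD(1)[OF n]] by simp
  let ?p = "src L \<rho>" and ?pr = "pr (m \<odot> \<rho>) \<rho> (id1 L (src L \<rho>)) (id2 L (m \<odot> \<rho>))"
  note [simp] = Rmor_simps[of a n s "m \<odot> \<rho>" q]
  have "TA s (ev \<rho>) \<cdot>[q] Rmor a n s =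
      TA s (V ?p (hob D \<rho>)) \<cdot>[q] TA s ?pr \<cdot>[q] Rmor a n s"
    using i by (simp add: ev_def)
  also have "\<dots> = PC s (id1 L ?p) (hob D \<rho>) \<cdot>[q] TA s ?pr \<cdot>[q] Rmor a n s"
    by (simp add: TA_V)
  also have "\<dots> = pr n \<rho> (s \<odot> id1 L ?p) ((a \<rhd> id1 L ?p) \<bullet> id2 L (m \<odot> \<rho>))"
    by (rule pr_Rmor[OF _ _ _ _ _ _ _ _ i]) simp_all
  finally show ?thesis by simp
qed

text \<open>Both sides are the projection of \<open>Rob (m \<odot> \<rho>)\<close> at
  \<open>m \<lhd> \<beta>\<close>: one is obtained by following the edge of \<open>\<beta>\<close>
  out of the identity node, the other by \<open>TA_ev_Rmor\<close>.\<close>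

lemma is_hat_arr_counit [simp]: "is_hat_arr L C (src L m) counit"
proof (rule is_hat_arrI)
  show "hcmp counit \<in> extensional (into L (src L m))" by (simp add: counit_def)
  fix \<beta> \<rho> \<tau>
  assume \<beta>: "\<beta> \<in> Cells2 L" "\<rho> \<in> Cells1 L" "\<tau> \<in> Cells1 L" "trg L \<tau> = src L \<rho>" "trg L \<rho> = src L m"
    "vtrg L \<beta> = \<rho> \<odot> \<tau>"
  define \<rho>' where "\<rho>' = vsrc L \<beta>"
  have \<rho>': "\<rho>' \<in> Cells1 L" "src L \<rho>' = src L \<tau>" "trg L \<rho>' = src L m" "vsrc L \<beta> = \<rho>'"
    using vsrc_decomp[OF \<beta>(1-4,6)] \<beta>(5) by (auto simp: \<rho>'_def)
  note [simp] = \<beta> \<rho>'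
  let ?q = "src L \<rho>" and ?i = "id1 L (src L \<rho>)" and ?pr = "pr (m \<odot> \<rho>) \<rho> (id1 L (src L \<rho>)) (id2 L (m \<odot> \<rho>))"
  have e: "edge \<rho> \<beta> \<tau> \<rho>'" by (simp add: edge_def)
  have n: "node (m \<odot> \<rho>) \<rho>' \<tau> (m \<lhd> \<beta>)" by (simp add: node_def)
  note i = node_id2[OF \<beta>(2,5)]
  have "hmor D (\<beta>, \<rho>, \<tau>) \<cdot>[?q] ev \<rho> =
      (hmor D (\<beta>, \<rho>, \<tau>) \<cdot>[?q] V ?q (hob D \<rho>)) \<cdot>[?q] ?pr"
    using i by (simp add: ev_def)
  also have "hmor D (\<beta>, \<rho>, \<tau>) \<cdot>[?q] V ?q (hob D \<rho>) =
      V ?q (T \<tau> (hob D \<rho>')) \<cdot>[?q] TA ?i (hmor D (\<beta>, \<rho>, \<tau>))"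
    by (rule V_natural[symmetric]) simp_all
  also have "(V ?q (T \<tau> (hob D \<rho>')) \<cdot>[?q] TA ?i (hmor D (\<beta>, \<rho>, \<tau>))) \<cdot>[?q] ?pr =
      PC ?i \<tau> (hob D \<rho>') \<cdot>[?q] TA ?i (hmor D (\<beta>, \<rho>, \<tau>)) \<cdot>[?q] ?pr"
    using i by (simp add: V_T)
  also have "\<dots> = pr (m \<odot> \<rho>) \<rho>' (?i \<odot> \<tau>) ((id2 L (m \<odot> \<rho>) \<rhd> \<tau>) \<bullet> (m \<lhd> \<beta>))"
    by (rule pr_edge[OF i e]) simp
  also have "\<dots> = TA \<tau> (ev \<rho>') \<cdot>[?q] Rmor (m \<lhd> \<beta>) (m \<odot> \<rho>) \<tau>"
    using TA_ev_Rmor[OF n, of ?q] by simp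
  finally show "TA \<tau> (hcmp counit (vsrc L \<beta>)) \<cdot>[src L \<rho>] hmor (hsrc counit) (\<beta>, \<rho>, \<tau>) =
      hmor (htrg counit) (\<beta>, \<rho>, \<tau>) \<cdot>[src L \<rho>] hcmp counit \<rho>"
    by simp
qed (simp_all add: hom_iff)

section \<open>Transposition of a morphism into \<open>D\<close>\<close>

context
  fixes G \<theta>
  assumes G [simp]: "is_hat_obj L C (trg L m) G" and \<theta> [simp]: "is_hat_arr L C (src L m) \<theta>"
    and hsrc_\<theta> [simp]: "hsrc \<theta> = fobj (hat_fun L C m) G" and htrg_\<theta> [simp]: "htrg \<theta> = D"
begin

definition leg where "leg \<nu> \<rho> \<sigma> \<alpha> = TA \<sigma> (hcmp \<theta> \<rho>) \<cdot>[src L \<nu>] hmor G (\<alpha>, \<nu>, \<sigma>)"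

lemma ex_transpose:
  assumes \<nu>: "\<nu> \<in> Cells1 L" "trg L \<nu> = trg L m"
  shows "\<exists>h. h \<in> hom (CC (src L \<nu>)) (hob G \<nu>) (Rob \<nu>) \<and>
    (\<forall>\<rho> \<sigma> \<alpha>. node \<nu> \<rho> \<sigma> \<alpha> \<longrightarrow> pr \<nu> \<rho> \<sigma> \<alpha> \<cdot>[src L \<nu>] h = leg \<nu> \<rho> \<sigma> \<alpha>)"
proof (rule pr_ex)
  note [simp] = \<nu>
  let ?q = "src L \<nu>"
  show "\<nu> \<in> Cells1 L" "?q = ?q" "hob G \<nu> \<in> Obj (CC ?q)" by simp_all
  fix \<rho> \<sigma> \<alpha> assume n: "node \<nu> \<rho> \<sigma> \<alpha>"
  note [simp] = nodeD[OF n]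
  show "leg \<nu> \<rho> \<sigma> \<alpha> \<in> hom (CC ?q) (hob G \<nu>) (T \<sigma> (hob D \<rho>))"
    by (simp add: leg_def hom_iff)
  show "PC \<sigma> \<tau> (hob D \<rho>') \<cdot>[?q] TA \<sigma> (hmor D (\<beta>, \<rho>, \<tau>)) \<cdot>[?q] leg \<nu> \<rho> \<sigma> \<alpha> =
      leg \<nu> \<rho>' (\<sigma> \<odot> \<tau>) ((\<alpha> \<rhd> \<tau>) \<bullet> (m \<lhd> \<beta>))" if e: "edge \<rho> \<beta> \<tau> \<rho>'" for \<beta> \<tau> \<rho>'
  proof -
    note [simp] = edgeD[OF e]
    let ?G = "hmor G (m \<lhd> \<beta>, m \<odot> \<rho>, \<tau>)" and ?p = "src L \<rho>"
    have th: "hmor D (\<beta>, \<rho>, \<tau>) \<cdot>[?p] hcmp \<theta> \<rho> = TA \<tau> (hcmp \<theta> \<rho>') \<cdot>[?p] ?G"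
      using hcmp_hmor[OF \<theta>, of \<beta> \<rho> \<tau> \<rho>' ?p] by simp
    have nat: "TA (\<sigma> \<odot> \<tau>) (hcmp \<theta> \<rho>') \<cdot>[?q] PC \<sigma> \<tau> (hob G (m \<odot> \<rho>')) =
        PC \<sigma> \<tau> (hob D \<rho>') \<cdot>[?q] TA \<sigma> (TA \<tau> (hcmp \<theta> \<rho>'))"
      by (rule PC_natural[where p = "src L \<tau>"]) simp_all
    have "PC \<sigma> \<tau> (hob D \<rho>') \<cdot>[?q] TA \<sigma> (hmor D (\<beta>, \<rho>, \<tau>)) \<cdot>[?q] leg \<nu> \<rho> \<sigma> \<alpha> =
        PC \<sigma> \<tau> (hob D \<rho>') \<cdot>[?q] TA \<sigma> (hmor D (\<beta>, \<rho>, \<tau>) \<cdot>[?p] hcmp \<theta> \<rho>) \<cdot>[?q] hmor G (\<alpha>, \<nu>, \<sigma>)"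
      by (simp add: leg_def)
    also have "\<dots> = (PC \<sigma> \<tau> (hob D \<rho>') \<cdot>[?q] TA \<sigma> (TA \<tau> (hcmp \<theta> \<rho>'))) \<cdot>[?q] TA \<sigma> ?G \<cdot>[?q]
        hmor G (\<alpha>, \<nu>, \<sigma>)"
      unfolding th by simp
    also have "\<dots> = TA (\<sigma> \<odot> \<tau>) (hcmp \<theta> \<rho>') \<cdot>[?q] (PC \<sigma> \<tau> (hob G (m \<odot> \<rho>')) \<cdot>[?q] TA \<sigma> ?G \<cdot>[?q]
        hmor G (\<alpha>, \<nu>, \<sigma>))"
      unfolding nat[symmetric] by simp
    also have "PC \<sigma> \<tau> (hob G (m \<odot> \<rho>')) \<cdot>[?q] TA \<sigma> ?G \<cdot>[?q] hmor G (\<alpha>, \<nu>, \<sigma>) =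
        hmor G ((\<alpha> \<rhd> \<tau>) \<bullet> (m \<lhd> \<beta>), \<nu>, \<sigma> \<odot> \<tau>)"
      by (rule hmor_hmor[OF G]) simp_all
    finally show ?thesis by (simp add: leg_def)
  qed
  show "TT \<gamma> (hob D \<rho>) \<cdot>[?q] leg \<nu> \<rho> \<sigma> \<alpha> = leg \<nu> \<rho> \<sigma>' ((\<nu> \<lhd> \<gamma>) \<bullet> \<alpha>)"
    if e: "edge2 \<sigma> \<gamma> \<sigma>'" for \<gamma> \<sigma>'
  proof -
    note [simp] = edge2D[OF e]
    have nat: "TA \<sigma>' (hcmp \<theta> \<rho>) \<cdot>[?q] TT \<gamma> (hob G (m \<odot> \<rho>)) = TT \<gamma> (hob D \<rho>) \<cdot>[?q] TA \<sigma> (hcmp \<theta> \<rho>)"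
      by (rule TT_natural[where p = "src L \<rho>"]) simp_all
    have "TT \<gamma> (hob D \<rho>) \<cdot>[?q] leg \<nu> \<rho> \<sigma> \<alpha> =
        (TT \<gamma> (hob D \<rho>) \<cdot>[?q] TA \<sigma> (hcmp \<theta> \<rho>)) \<cdot>[?q] hmor G (\<alpha>, \<nu>, \<sigma>)"
      by (simp add: leg_def)
    also have "\<dots> = TA \<sigma>' (hcmp \<theta> \<rho>) \<cdot>[?q] (TT \<gamma> (hob G (m \<odot> \<rho>)) \<cdot>[?q] hmor G (\<alpha>, \<nu>, \<sigma>))"
      unfolding nat[symmetric] by simp
    also have "TT \<gamma> (hob G (m \<odot> \<rho>)) \<cdot>[?q] hmor G (\<alpha>, \<nu>, \<sigma>) = hmor G ((\<nu> \<lhd> \<gamma>) \<bullet> \<alpha>, \<nu>, \<sigma>')"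
      by (rule TT_hmor[OF G]) simp_all
    finally show ?thesis by (simp add: leg_def)
  qed
qed

definition tr where
  "tr \<nu> = (SOME h. h \<in> hom (CC (src L \<nu>)) (hob G \<nu>) (Rob \<nu>) \<and>
    (\<forall>\<rho> \<sigma> \<alpha>. node \<nu> \<rho> \<sigma> \<alpha> \<longrightarrow> pr \<nu> \<rho> \<sigma> \<alpha> \<cdot>[src L \<nu>] h = leg \<nu> \<rho> \<sigma> \<alpha>))"

lemma tr_simps [simp]:
  assumes "\<nu> \<in> Cells1 L" "trg L \<nu> = trg L m" "src L \<nu> = q"
  shows "tr \<nu> \<in> Arr (CC q)" "Dom (CC q) (tr \<nu>) = hob G \<nu>" "Cod (CC q) (tr \<nu>) = Rob \<nu>"
  using someI_ex[OF ex_transpose[OF assms(1,2)]] assms(3) by (auto simp: tr_def hom_iff)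

lemma pr_tr:
  assumes "node \<nu> \<rho> \<sigma> \<alpha>" "src L \<nu> = q"
  shows "pr \<nu> \<rho> \<sigma> \<alpha> \<cdot>[q] tr \<nu> = TA \<sigma> (hcmp \<theta> \<rho>) \<cdot>[q] hmor G (\<alpha>, \<nu>, \<sigma>)"
  using someI_ex[OF ex_transpose[OF nodeD(1,5)[OF assms(1)]]] assms by (auto simp: tr_def leg_def)

definition transpose :: "('a, 'c, 'x, 'y) hat_arr" where
  "transpose = \<lparr>hsrc = G, htrg = Robj, hcmp = (\<lambda>\<nu>\<in>into L (trg L m). tr \<nu>)\<rparr>"

lemma transpose_simps [simp]:
  "hsrc transpose = G" "htrg transpose = Robj"
  "\<nu> \<in> Cells1 L \<Longrightarrow> trg L \<nu> = trg L m \<Longrightarrow> hcmp transpose \<nu> = tr \<nu>"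
  by (simp_all add: transpose_def)

text \<open>After projecting, both sides are the leg at the node that pasting with \<open>a\<close>
  produces, by the composition axiom of \<open>G\<close> on one side and the defining property of
  \<open>Rmor\<close> on the other.\<close>

lemma is_hat_arr_transpose [simp]: "is_hat_arr L C (trg L m) transpose"
proof (rule is_hat_arrI)
  show "hcmp transpose \<in> extensional (into L (trg L m))" by (simp add: transpose_def)
  fix a n s
  assume a: "a \<in> Cells2 L" "n \<in> Cells1 L" "s \<in> Cells1 L" "trg L s = src L n" "trg L n = trg L m"
    "vtrg L a = n \<odot> s"
  define \<mu> where "\<mu> = vsrc L a"
  have \<mu>: "\<mu> \<in> Cells1 L" "src L \<mu> = src L s" "trg L \<mu> = trg L m" "vsrc L a = \<mu>"
    using vsrc_decomp[OF a(1-4,6)] a(5) by (auto simp: \<mu>_def)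
  note [simp] = a \<mu> Rmor_simps[OF a \<mu>(4) HOL.refl]
  let ?q = "src L n"
  have "TA s (tr \<mu>) \<cdot>[?q] hmor G (a, n, s) = Rmor a n s \<cdot>[?q] tr n"
  proof (rule TA_pr_unique[where \<phi> = s and \<nu> = \<mu> and q = ?q and x = "hob G n"])
    fix \<rho> \<sigma> \<alpha> assume nd: "node \<mu> \<rho> \<sigma> \<alpha>"
    note [simp] = nodeD[OF nd]
    have n': "node n \<rho> (s \<odot> \<sigma>) ((a \<rhd> \<sigma>) \<bullet> \<alpha>)" by (rule node_decomp[OF nd]) simp_all
    let ?y = "hob D \<rho>" and ?pr = "pr \<mu> \<rho> \<sigma> \<alpha>" and ?x = "hob G (m \<odot> \<rho>)"
    have nat: "TA (s \<odot> \<sigma>) (hcmp \<theta> \<rho>) \<cdot>[?q] PC s \<sigma> ?x = PC s \<sigma> ?y \<cdot>[?q] TA s (TA \<sigma> (hcmp \<theta> \<rho>))"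
      by (rule PC_natural[where p = "src L \<rho>"]) simp_all
    have "PC s \<sigma> ?y \<cdot>[?q] TA s ?pr \<cdot>[?q] TA s (tr \<mu>) \<cdot>[?q] hmor G (a, n, s) =
        PC s \<sigma> ?y \<cdot>[?q] TA s (?pr \<cdot>[src L s] tr \<mu>) \<cdot>[?q] hmor G (a, n, s)"
      using nd by simp
    also have "\<dots> = (PC s \<sigma> ?y \<cdot>[?q] TA s (TA \<sigma> (hcmp \<theta> \<rho>))) \<cdot>[?q] TA s (hmor G (\<alpha>, \<mu>, \<sigma>)) \<cdot>[?q]
        hmor G (a, n, s)"
      unfolding pr_tr[OF nd \<mu>(2)] by simp
    also have "\<dots> = TA (s \<odot> \<sigma>) (hcmp \<theta> \<rho>) \<cdot>[?q] (PC s \<sigma> ?x \<cdot>[?q] TA s (hmor G (\<alpha>, \<mu>, \<sigma>)) \<cdot>[?q]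
        hmor G (a, n, s))"
      unfolding nat[symmetric] by simp
    also have "PC s \<sigma> ?x \<cdot>[?q] TA s (hmor G (\<alpha>, \<mu>, \<sigma>)) \<cdot>[?q] hmor G (a, n, s) =
        hmor G ((a \<rhd> \<sigma>) \<bullet> \<alpha>, n, s \<odot> \<sigma>)"
      by (rule hmor_hmor[OF G]) simp_all
    also have "TA (s \<odot> \<sigma>) (hcmp \<theta> \<rho>) \<cdot>[?q] \<dots> = pr n \<rho> (s \<odot> \<sigma>) ((a \<rhd> \<sigma>) \<bullet> \<alpha>) \<cdot>[?q] tr n"
      by (rule pr_tr[OF n' HOL.refl, symmetric])
    also have "\<dots> = (PC s \<sigma> ?y \<cdot>[?q] TA s ?pr \<cdot>[?q] Rmor a n s) \<cdot>[?q] tr n"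
      unfolding pr_Rmor[OF a \<mu>(4) HOL.refl nd] ..
    also have "\<dots> = PC s \<sigma> ?y \<cdot>[?q] TA s ?pr \<cdot>[?q] Rmor a n s \<cdot>[?q] tr n"
      using nd by simp
    finally show "PC s \<sigma> ?y \<cdot>[?q] TA s ?pr \<cdot>[?q] TA s (tr \<mu>) \<cdot>[?q] hmor G (a, n, s) =
      PC s \<sigma> ?y \<cdot>[?q] TA s ?pr \<cdot>[?q] Rmor a n s \<cdot>[?q] tr n" .
  qed (simp_all add: hom_iff)
  then show "TA s (hcmp transpose (vsrc L a)) \<cdot>[src L n] hmor (hsrc transpose) (a, n, s) =
      hmor (htrg transpose) (a, n, s) \<cdot>[src L n] hcmp transpose n"
    by simp
qed (simp_all add: hom_iff)

text \<open>At the identity node the leg is \<open>\<theta> \<rho>\<close> under \<open>C 1\<close>,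
  composed with a unit; naturality of the inverse unit brings the two units together, where they
  cancel.\<close>

lemma counit_transpose: "counit \<cdot>\<^bsub>hat_cat L C (src L m)\<^esub> farr (hat_fun L C m) transpose = \<theta>"
proof (rule hat_arr_eqI[of L C "src L m"])
  fix \<rho> assume \<rho> [simp]: "\<rho> \<in> Cells1 L" "trg L \<rho> = src L m"
  let ?p = "src L \<rho>" and ?i = "id1 L (src L \<rho>)" and ?x = "hob G (m \<odot> \<rho>)"
  let ?pr = "pr (m \<odot> \<rho>) \<rho> ?i (id2 L (m \<odot> \<rho>))"
  note i = node_id2[OF \<rho>]
  have "ev \<rho> \<cdot>[?p] tr (m \<odot> \<rho>) = V ?p (hob D \<rho>) \<cdot>[?p] (?pr \<cdot>[?p] tr (m \<odot> \<rho>))"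
    using i by (simp add: ev_def)
  also have "?pr \<cdot>[?p] tr (m \<odot> \<rho>) = TA ?i (hcmp \<theta> \<rho>) \<cdot>[?p] hmor G (id2 L (m \<odot> \<rho>), m \<odot> \<rho>, ?i)"
    by (rule pr_tr[OF i]) simp
  also have "hmor G (id2 L (m \<odot> \<rho>), m \<odot> \<rho>, ?i) = U ?p ?x"
    by (rule hmor_id2[OF G]) simp_all
  also have "V ?p (hob D \<rho>) \<cdot>[?p] TA ?i (hcmp \<theta> \<rho>) \<cdot>[?p] U ?p ?x =
      (V ?p (hob D \<rho>) \<cdot>[?p] TA ?i (hcmp \<theta> \<rho>)) \<cdot>[?p] U ?p ?x" by simp
  also have "V ?p (hob D \<rho>) \<cdot>[?p] TA ?i (hcmp \<theta> \<rho>) = hcmp \<theta> \<rho> \<cdot>[?p] V ?p ?x"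
    by (rule V_natural) simp_all
  also have "(hcmp \<theta> \<rho> \<cdot>[?p] V ?p ?x) \<cdot>[?p] U ?p ?x = hcmp \<theta> \<rho>" by simp
  finally show "hcmp (counit \<cdot>\<^bsub>hat_cat L C (src L m)\<^esub> farr (hat_fun L C m) transpose) \<rho> = hcmp \<theta> \<rho>"
    by simp
qed (simp_all add: is_hat_arr_Cmp)

text \<open>By \<open>TA_ev_Rmor\<close> each projection of \<open>hcmp g \<nu>\<close> factors
  through \<open>ev\<close> and a structure arrow, and naturality of \<open>g\<close> turns it into
  the leg of \<open>\<theta>\<close>. So \<open>\<theta>\<close> determines all projections of
  \<open>g\<close>.\<close>

lemma transpose_unique:
  assumes g [simp]: "is_hat_arr L C (trg L m) g" "hsrc g = G" "htrg g = Robj"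
    and eq: "counit \<cdot>\<^bsub>hat_cat L C (src L m)\<^esub> farr (hat_fun L C m) g = \<theta>"
  shows "g = transpose"
proof (rule hat_arr_eqI[of L C "trg L m"])
  fix \<nu> assume \<nu> [simp]: "\<nu> \<in> Cells1 L" "trg L \<nu> = trg L m"
  let ?q = "src L \<nu>"
  have "hcmp g \<nu> = tr \<nu>"
  proof (rule pr_unique[where \<nu> = \<nu> and p = ?q and x = "hob G \<nu>"])
    fix \<rho> \<sigma> \<alpha> assume n: "node \<nu> \<rho> \<sigma> \<alpha>"
    note [simp] = nodeD[OF n] Rmor_simps[of \<alpha> \<nu> \<sigma> "m \<odot> \<rho>" ?q]
    have th: "hcmp \<theta> \<rho> = ev \<rho> \<cdot>[src L \<rho>] hcmp g (m \<odot> \<rho>)"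
      using arg_cong[OF eq, of "\<lambda>t. hcmp t \<rho>"] by simp
    have gG: "TA \<sigma> (hcmp g (m \<odot> \<rho>)) \<cdot>[?q] hmor G (\<alpha>, \<nu>, \<sigma>) = Rmor \<alpha> \<nu> \<sigma> \<cdot>[?q] hcmp g \<nu>"
      using hcmp_hmor[OF g(1), of \<alpha> \<nu> \<sigma> "m \<odot> \<rho>" ?q] by simp
    have "pr \<nu> \<rho> \<sigma> \<alpha> \<cdot>[?q] tr \<nu> = TA \<sigma> (hcmp \<theta> \<rho>) \<cdot>[?q] hmor G (\<alpha>, \<nu>, \<sigma>)"
      by (rule pr_tr[OF n HOL.refl])
    also have "\<dots> = TA \<sigma> (ev \<rho>) \<cdot>[?q] (TA \<sigma> (hcmp g (m \<odot> \<rho>)) \<cdot>[?q] hmor G (\<alpha>, \<nu>, \<sigma>))"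
      unfolding th by simp
    also have "\<dots> = (TA \<sigma> (ev \<rho>) \<cdot>[?q] Rmor \<alpha> \<nu> \<sigma>) \<cdot>[?q] hcmp g \<nu>"
      unfolding gG by simp
    also have "TA \<sigma> (ev \<rho>) \<cdot>[?q] Rmor \<alpha> \<nu> \<sigma> = pr \<nu> \<rho> \<sigma> \<alpha>" by (rule TA_ev_Rmor[OF n HOL.refl])
    finally show "pr \<nu> \<rho> \<sigma> \<alpha> \<cdot>[?q] hcmp g \<nu> = pr \<nu> \<rho> \<sigma> \<alpha> \<cdot>[?q] tr \<nu>" by (rule HOL.sym)
  qed (simp_all add: hom_iff)
  then show "hcmp g \<nu> = hcmp transpose \<nu>" by simp
qed simp_all

end

lemma universal_arrow:
  "\<exists>R e. R \<in> Obj (hat_cat L C (trg L m)) \<and>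
    e \<in> hom (hat_cat L C (src L m)) (fobj (hat_fun L C m) R) D \<and>
    (\<forall>G\<in>Obj (hat_cat L C (trg L m)). \<forall>\<theta>\<in>hom (hat_cat L C (src L m)) (fobj (hat_fun L C m) G) D.
      \<exists>!g. g \<in> hom (hat_cat L C (trg L m)) G R \<and>
        e \<cdot>\<^bsub>hat_cat L C (src L m)\<^esub> farr (hat_fun L C m) g = \<theta>)"
proof (intro exI conjI ballI)
  show "Robj \<in> Obj (hat_cat L C (trg L m))" by simp
  show "counit \<in> hom (hat_cat L C (src L m)) (fobj (hat_fun L C m) Robj) D" by (simp add: hom_iff)
  fix G \<theta> assume "G \<in> Obj (hat_cat L C (trg L m))"
    "\<theta> \<in> hom (hat_cat L C (src L m)) (fobj (hat_fun L C m) G) D"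
  then have *: "is_hat_obj L C (trg L m) G" "is_hat_arr L C (src L m) \<theta>"
    "hsrc \<theta> = fobj (hat_fun L C m) G" "htrg \<theta> = D" by (simp_all add: hom_iff)
  show "\<exists>!g. g \<in> hom (hat_cat L C (trg L m)) G Robj \<and>
      counit \<cdot>\<^bsub>hat_cat L C (src L m)\<^esub> farr (hat_fun L C m) g = \<theta>"
  proof (rule ex1I[of _ "transpose G \<theta>"])
    show "transpose G \<theta> \<in> hom (hat_cat L C (trg L m)) G Robj \<and>
        counit \<cdot>\<^bsub>hat_cat L C (src L m)\<^esub> farr (hat_fun L C m) (transpose G \<theta>) = \<theta>"
      using is_hat_arr_transpose[OF *] counit_transpose[OF *] transpose_simps[OF *] by (simp add: hom_iff)
    fix g assume "g \<in> hom (hat_cat L C (trg L m)) G Robj \<and>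
      counit \<cdot>\<^bsub>hat_cat L C (src L m)\<^esub> farr (hat_fun L C m) g = \<theta>"
    then show "g = transpose G \<theta>" using transpose_unique[OF *] by (simp add: hom_iff)
  qed
qed

end

theorem corollary4p13:
  fixes L :: "('o, 'a, 'c) two_cat"
    and k :: "'k rel"
    and C :: "('o, 'a, 'c, 'x, 'y) cat_valued"
  assumes "two_category L"
    and "Cinfinite k" and "regularCard k" and "small_two_cat k L"
    and "pseudofunctor L Cat C"
    and "\<And>p. p \<in> Cells0 L \<Longrightarrow> has_small_limits k (act0 C p)"
    and "\<And>m. m \<in> Cells1 L \<Longrightarrow> preserves_small_limits k (act1 C m)"
  shows "(\<exists>R \<eta> \<epsilon>. right_adjoints L C R \<eta> \<epsilon>) \<and>
    (\<forall>R \<eta> \<epsilon>. right_adjoints L C R \<eta> \<epsilon> \<longrightarrow>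
      (\<exists>F. two_functor (coop (adjoin L)) Cat F \<and>
        (\<forall>p\<in>Cells0 L. act0 F (act0 (adjoin_incl L) p) = act0 (hat L C) p) \<and>
        (\<forall>m\<in>Cells1 L. act1 F (act1 (adjoin_incl L) m) = act1 (hat L C) m) \<and>
        (\<forall>a\<in>Cells2 L. act2 F (act2 (adjoin_incl L) a) = act2 (hat L C) a) \<and>
        (\<forall>m\<in>Cells1 L. act1 F (dagger L m) = R m \<and>
           act2 F (cell_class L (Unit m)) = \<epsilon> m \<and>
           act2 F (cell_class L (Counit m)) = \<eta> m)) \<and>
      (\<exists>P. pseudofunctor L Cat P \<and>
        (\<forall>p\<in>Cells0 L. act0 P p = act0 (hat L C) p) \<and>
        (\<forall>m\<in>Cells1 L. act1 P m = R m) \<and>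
        (\<forall>a\<in>Cells2 L. act2 P a =
           mate Cat (R (vtrg L a)) (\<eta> (vtrg L a)) (R (vsrc L a)) (\<epsilon> (vsrc L a))
             (act2 (hat L C) a))))"
proof (intro conjI allI impI)
  interpret cat_pseudofunctor L C by (rule cat_pseudofunctor.intro) (rule assms(5))
  have "\<exists>R \<eta> \<epsilon>. adjunction Cat (hat_fun L C m) R \<eta> \<epsilon>" if m: "m \<in> Cells1 L" for m
  proof (rule adjunction_Cat_of_universal_arrows[of _ "hat_cat L C (trg L m)" "hat_cat L C (src L m)"])
    fix D assume "D \<in> Obj (hat_cat L C (src L m))"
    then interpret coextension L C k m D
      by (intro coextension.intro coextension_axioms.intro cat_pseudofunctor_axioms)
        (use assms m in auto)
    show "\<exists>R e. R \<in> Obj (hat_cat L C (trg L m)) \<and>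
      e \<in> hom (hat_cat L C (src L m)) (fobj (hat_fun L C m) R) D \<and>
      (\<forall>G\<in>Obj (hat_cat L C (trg L m)). \<forall>\<theta>\<in>hom (hat_cat L C (src L m)) (fobj (hat_fun L C m) G) D.
        \<exists>!g. g \<in> hom (hat_cat L C (trg L m)) G R \<and>
          e \<cdot>\<^bsub>hat_cat L C (src L m)\<^esub> farr (hat_fun L C m) g = \<theta>)"
      by (rule universal_arrow)
  qed (use m in simp_all)
  then show "\<exists>R \<eta> \<epsilon>. right_adjoints L C R \<eta> \<epsilon>"
    unfolding right_adjoints_def by simp metis
  \<comment> \<open>From here on the adjoints are an arbitrary choice and no longer the limits just
    constructed; only the adjunction data enter.\<close>
  fix R \<eta> \<epsilon> assume adj: "right_adjoints L C R \<eta> \<epsilon>"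
  interpret local_right_adjoints L Cat "hat L C" R \<eta> \<epsilon>
    unfolding local_right_adjoints_def local_right_adjoints_axioms_def
    using two_category_Cat two_functor_hat adj assms(1) by (simp add: right_adjoints_def)
  show "\<exists>F. two_functor (coop (adjoin L)) Cat F \<and>
      (\<forall>p\<in>Cells0 L. act0 F (act0 (adjoin_incl L) p) = act0 (hat L C) p) \<and>
      (\<forall>m\<in>Cells1 L. act1 F (act1 (adjoin_incl L) m) = act1 (hat L C) m) \<and>
      (\<forall>a\<in>Cells2 L. act2 F (act2 (adjoin_incl L) a) = act2 (hat L C) a) \<and>
      (\<forall>m\<in>Cells1 L. act1 F (dagger L m) = R m \<and> act2 F (cell_class L (Unit m)) = \<epsilon> m \<and>
         act2 F (cell_class L (Counit m)) = \<eta> m)"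
    by (rule exI[of _ extension]) (simp add: two_functor_extension adjoin_incl_def)
  show "\<exists>P. pseudofunctor L Cat P \<and>
      (\<forall>p\<in>Cells0 L. act0 P p = act0 (hat L C) p) \<and> (\<forall>m\<in>Cells1 L. act1 P m = R m) \<and>
      (\<forall>a\<in>Cells2 L. act2 P a = mate Cat (R (vtrg L a)) (\<eta> (vtrg L a)) (R (vsrc L a)) (\<epsilon> (vsrc L a))
         (act2 (hat L C) a))"
    by (rule exI[of _ Rps]) (simp add: pseudofunctor_Rps, simp add: Rps_def Rmap_def)
qed

end
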